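(* Let $a,b,c$ be positive integers and $n$ an integer, and let $\mathcal{E}_{a,b,c,n}=\mathcal{E}(a,b,c)\otimes\mathcal{O}(n)$ be the (indecomposable, equivariant) rank $2$ vector bundle over $\mathbb{CP}^2$, where $\mathcal{E}(a,b,c)$ is the cokernel of the bundle map $\mathcal{O}\to\mathcal{O}(a)\oplus\mathcal{O}(b)\oplus\mathcal{O}(c)$, $1\mapsto(u_0^a,u_1^b,u_2^c)$. If $\mathcal{E}_{a,b,c,n}$ admits a splitting type, then $a=b=c$. In the case $a=b=c$, the splitting type of $\mathcal{E}_{a,a,a,n}$ is unique (up to ordering and isomorphism of line bundles) and is given by $(\mathcal{O}(2a+n),\,\mathcal{O}(a+n))$.
   Context: Work over $\mathbb{C}$. $\mathbb{CP}^2=\mathrm{Proj}\,\mathbb{C}[u_0,u_1,u_2]$ is regarded as a toric manifold with its standard torus action; its torus-invariant $\mathbb{CP}^1$'s are the three coordinate lines $\{u_i=0\}$, $i=0,1,2$. The bundle $\mathcal{E}(a,b,c)$ is defined by the exact sequence $0\to\mathcal{O}\to\mathcal{O}(a)\oplus\mathcal{O}(b)\oplus\mathcal{O}(c)\to\mathcal{E}(a,b,c)\to 0$ whose first map sends $1$ to $(u_0^a,u_1^b,u_2^c)$. A vector bundle $\mathcal{E}$ over a toric manifold is equivariant if $g^*\mathcal{E}\cong\mathcal{E}$ for every $g$ in the torus. Splitting type: let $\mathcal{E}$ be an equivariant vector bundle of rank $r$ over a toric manifold $X_\Sigma$ of dimension $m$. If there exist equivariant line bundles $L_1,\dots,L_r$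 over $X_\Sigma$ such that each $c_1(L_i)$ is either $\ge 0$ or $<0$, and such that for every cone $\tau$ of dimension $m-1$ in the fan $\Sigma$ the restriction $\mathcal{E}|_{V(\tau)}$ to the invariant curve $V(\tau)\cong\mathbb{CP}^1$ is isomorphic to $(L_1\oplus\cdots\oplus L_r)|_{V(\tau)}$, then $\{L_1,\dots,L_r\}$ is called a splitting type of $\mathcal{E}$. On $\mathbb{CP}^2$, $c_1(\mathcal{O}(k))\ge 0$ means $k\ge 0$ and $c_1(\mathcal{O}(k))<0$ means $k<0$, and the curves $V(\tau)$ are the three coordinate lines. *)

theory Defs
  imports Complex_Main "Jordan_Normal_Form.Matrix" "HOL-Library.Nat_Bijection"
begin

section \<open>The projective plane and its Zariski topology\<close>

definition proj_rel :: "complex vec \<Rightarrow> complex vec \<Rightarrow> bool" where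
  "proj_rel u v \<longleftrightarrow>
     u \<in> carrier_vec 3 \<and> u \<noteq> 0\<^sub>v 3 \<and> (\<exists>s. s \<noteq> 0 \<and> v = s \<cdot>\<^sub>v u)"

lemma proj_rel_part_equivp: "part_equivp proj_rel"
proof (rule part_equivpI)
  show "\<exists>u. proj_rel u u"
  proof
    have "unit_vec 3 0 \<noteq> (0\<^sub>v 3 :: complex vec)"
    proof
      assume "unit_vec 3 0 = (0\<^sub>v 3 :: complex vec)"
      then have "unit_vec 3 0 $ 0 = (0\<^sub>v 3 :: complex vec) $ 0"
        by simp
      then show False by simp
    qed
    then show "proj_rel (unit_vec 3 0) (unit_vec 3 0)"
      unfolding proj_rel_def by (intro conjI exI[of _ 1]) auto
  qed
  show "symp proj_rel"
  proof (rule sympI)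
    fix u v assume "proj_rel u v"
    then obtain s where s: "u \<in> carrier_vec 3" "u \<noteq> 0\<^sub>v 3" "s \<noteq> 0" "v = s \<cdot>\<^sub>v u"
      unfolding proj_rel_def by blast
    have u: "u = inverse s \<cdot>\<^sub>v v"
      using s by (simp add: smult_smult_assoc)
    then have "v \<noteq> 0\<^sub>v 3"
      using s(2) by auto
    then show "proj_rel v u"
      using s u unfolding proj_rel_def
      by (metis smult_carrier_vec inverse_zero_imp_zero)
  qed
  show "transp proj_rel"
  proof (rule transpI)
    fix u v w assume "proj_rel u v" "proj_rel v w"
    then obtain s t where s: "u \<in> carrier_vec 3" "u \<noteq> 0\<^sub>v 3" "s \<noteq> 0" "v = s \<cdot>\<^sub>v u"
      and t: "t \<noteq> 0" "w = t \<cdot>\<^sub>v v"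
      unfolding proj_rel_def by blast
    then have "w = (t * s) \<cdot>\<^sub>v u"
      by (simp add: smult_smult_assoc)
    then show "proj_rel u w"
      using s t unfolding proj_rel_def by (metis mult_eq_0_iff)
  qed
qed

quotient_type cp2 = "complex vec" / partial: proj_rel
  by (rule proj_rel_part_equivp)

text \<open>A choice of homogeneous coordinates \<open>u\<^sub>0, u\<^sub>1, u\<^sub>2\<close> of a point. Below it is only
  used in expressions that do not depend on the choice.\<close>

definition coords :: "cp2 \<Rightarrow> complex vec" where
  "coords = rep_cp2"

definition hom_poly :: "nat \<Rightarrow> (complex vec \<Rightarrow> complex) \<Rightarrow> bool" where
  "hom_poly d P \<longleftrightarrow> (\<exists>\<alpha> :: nat \<Rightarrow> nat \<Rightarrow> complex.
     P = (\<lambda>u. \<Sum>i\<le>d. \<Sum>j\<le>d - i. \<alpha> i j * u $ 0 ^ i * u $ 1 ^ j * u $ 2 ^ (d - i - j)))"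

definition zariski_open :: "cp2 set \<Rightarrow> bool" where
  "zariski_open U \<longleftrightarrow> (\<exists>F. (\<forall>P\<in>F. \<exists>d. hom_poly d P) \<and>
     U = {x. \<exists>P\<in>F. P (coords x) \<noteq> 0})"

text \<open>Regular functions on a locally closed subset \<open>S\<close>, taken with its reduced structure.\<close>

definition regular_on :: "cp2 set \<Rightarrow> (cp2 \<Rightarrow> complex) \<Rightarrow> bool" where
  "regular_on S f \<longleftrightarrow> (\<forall>x\<in>S. \<exists>U d P Q. zariski_open U \<and> x \<in> U \<and>
     hom_poly d P \<and> hom_poly d Q \<and>
     (\<forall>y\<in>S \<inter> U. Q (coords y) \<noteq> 0 \<and> f y = P (coords y) / Q (coords y)))"

definition regular_mat_on :: "cp2 set \<Rightarrow> nat \<Rightarrow> nat \<Rightarrow> (cp2 \<Rightarrow> complex mat) \<Rightarrow> bool" where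
  "regular_mat_on S m n A \<longleftrightarrow> (\<forall>x\<in>S. A x \<in> carrier_mat m n) \<and>
     (\<forall>p<m. \<forall>q<n. regular_on S (\<lambda>x. A x $$ (p, q)))"


section \<open>Algebraic vector bundles\<close>

text \<open>A vector bundle is given by a trivialising open cover of its base and transition matrices.
  A section is a family \<open>s\<^sub>i\<close> of column vectors on the charts with \<open>s\<^sub>i = trans i j *\<^sub>v s\<^sub>j\<close> on
  overlaps. As the Zariski topology is quasi-compact, covers indexed by natural numbers suffice.\<close>

record vbundle =
  vb_base :: "cp2 set"
  vb_rank :: nat
  vb_idx :: "nat set"
  chart :: "nat \<Rightarrow> cp2 set"
  trans :: "nat \<Rightarrow> nat \<Rightarrow> cp2 \<Rightarrow> complex mat"

definition vector_bundle :: "vbundle \<Rightarrow> bool" where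
  "vector_bundle E \<longleftrightarrow>
     (\<forall>i\<in>vb_idx E. \<exists>W. zariski_open W \<and> chart E i = vb_base E \<inter> W) \<and>
     vb_base E = (\<Union>i\<in>vb_idx E. chart E i) \<and>
     (\<forall>i\<in>vb_idx E. \<forall>j\<in>vb_idx E.
        regular_mat_on (chart E i \<inter> chart E j) (vb_rank E) (vb_rank E) (trans E i j)) \<and>
     (\<forall>i\<in>vb_idx E. \<forall>x\<in>chart E i. trans E i i x = 1\<^sub>m (vb_rank E)) \<and>
     (\<forall>i\<in>vb_idx E. \<forall>j\<in>vb_idx E. \<forall>k\<in>vb_idx E. \<forall>x\<in>chart E i \<inter> chart E j \<inter> chart E k.
        trans E i j x * trans E j k x = trans E i k x)"

text \<open>\<open>h j i\<close> is the matrix of the morphism from chart \<open>i\<close> of \<open>E\<close> to chart \<open>j\<close> of \<open>F\<close>.\<close>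

definition vb_morphism ::
    "vbundle \<Rightarrow> vbundle \<Rightarrow> (nat \<Rightarrow> nat \<Rightarrow> cp2 \<Rightarrow> complex mat) \<Rightarrow> bool" where
  "vb_morphism E F h \<longleftrightarrow> vb_base E = vb_base F \<and>
     (\<forall>i\<in>vb_idx E. \<forall>j\<in>vb_idx F.
        regular_mat_on (chart E i \<inter> chart F j) (vb_rank F) (vb_rank E) (h j i)) \<and>
     (\<forall>i\<in>vb_idx E. \<forall>i'\<in>vb_idx E. \<forall>j\<in>vb_idx F. \<forall>j'\<in>vb_idx F.
        \<forall>x\<in>chart E i \<inter> chart E i' \<inter> chart F j \<inter> chart F j'.
          h j' i' x = trans F j' j x * h j i x * trans E i i' x)"

definition vb_iso :: "vbundle \<Rightarrow> vbundle \<Rightarrow> bool" where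
  "vb_iso E F \<longleftrightarrow> (\<exists>h k. vb_morphism E F h \<and> vb_morphism F E k \<and>
     (\<forall>i\<in>vb_idx E. \<forall>j\<in>vb_idx F. \<forall>x\<in>chart E i \<inter> chart F j.
        k i j x * h j i x = 1\<^sub>m (vb_rank E) \<and> h j i x * k i j x = 1\<^sub>m (vb_rank F)))"

text \<open>Exactness of \<open>0 \<rightarrow> A \<rightarrow> B \<rightarrow> C \<rightarrow> 0\<close>, checked on fibres (for bundles this agrees with
  exactness of the sheaves of sections).\<close>

definition vb_short_exact ::
    "vbundle \<Rightarrow> vbundle \<Rightarrow> vbundle \<Rightarrow> (nat \<Rightarrow> nat \<Rightarrow> cp2 \<Rightarrow> complex mat) \<Rightarrow>
     (nat \<Rightarrow> nat \<Rightarrow> cp2 \<Rightarrow> complex mat) \<Rightarrow> bool" where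
  "vb_short_exact A B C f g \<longleftrightarrow> vb_morphism A B f \<and> vb_morphism B C g \<and>
     (\<forall>i\<in>vb_idx A. \<forall>j\<in>vb_idx B. \<forall>k\<in>vb_idx C. \<forall>x\<in>chart A i \<inter> chart B j \<inter> chart C k.
        inj_on (\<lambda>v. f j i x *\<^sub>v v) (carrier_vec (vb_rank A)) \<and>
        (\<lambda>v. f j i x *\<^sub>v v) ` carrier_vec (vb_rank A) =
          {w \<in> carrier_vec (vb_rank B). g k j x *\<^sub>v w = 0\<^sub>v (vb_rank C)} \<and>
        (\<lambda>w. g k j x *\<^sub>v w) ` carrier_vec (vb_rank B) = carrier_vec (vb_rank C))"

definition vb_restrict :: "vbundle \<Rightarrow> cp2 set \<Rightarrow> vbundle" where
  "vb_restrict E Z = E\<lparr>vb_base := vb_base E \<inter> Z, chart := (\<lambda>i. chart E i \<inter> Z)\<rparr>"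

definition vb_pullback :: "(cp2 \<Rightarrow> cp2) \<Rightarrow> vbundle \<Rightarrow> vbundle" where
  "vb_pullback f E = E\<lparr>vb_base := f -` vb_base E, chart := (\<lambda>i. f -` chart E i),
     trans := (\<lambda>i j x. trans E i j (f x))\<rparr>"

text \<open>Direct sums and tensor products of bundles on the same base are formed on the common
  refinement of the two covers.\<close>

definition vb_common_chart :: "vbundle \<Rightarrow> vbundle \<Rightarrow> nat \<Rightarrow> cp2 set" where
  "vb_common_chart E F i = chart E (fst (prod_decode i)) \<inter> chart F (snd (prod_decode i))"

definition vb_sum :: "vbundle \<Rightarrow> vbundle \<Rightarrow> vbundle" where
  "vb_sum E F =
    \<lparr>vb_base = vb_base E \<inter> vb_base F,
     vb_rank = vb_rank E + vb_rank F,
     vb_idx = prod_encode ` (vb_idx E \<times> vb_idx F),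
     chart = vb_common_chart E F,
     trans = (\<lambda>i j x. four_block_mat
       (trans E (fst (prod_decode i)) (fst (prod_decode j)) x)
       (0\<^sub>m (vb_rank E) (vb_rank F))
       (0\<^sub>m (vb_rank F) (vb_rank E))
       (trans F (snd (prod_decode i)) (snd (prod_decode j)) x))\<rparr>"

definition vb_zero :: "cp2 set \<Rightarrow> vbundle" where
  "vb_zero X = \<lparr>vb_base = X, vb_rank = 0, vb_idx = {0}, chart = (\<lambda>_. X),
     trans = (\<lambda>_ _ _. 1\<^sub>m 0)\<rparr>"

definition vb_sum_list :: "vbundle list \<Rightarrow> vbundle" where
  "vb_sum_list Es = foldr vb_sum Es (vb_zero UNIV)"

definition kronecker_mat :: "complex mat \<Rightarrow> complex mat \<Rightarrow> complex mat" where
  "kronecker_mat A B = mat (dim_row A * dim_row B) (dim_col A * dim_col B)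
     (\<lambda>(p, q). A $$ (p div dim_row B, q div dim_col B) * B $$ (p mod dim_row B, q mod dim_col B))"

definition vb_tensor :: "vbundle \<Rightarrow> vbundle \<Rightarrow> vbundle" where
  "vb_tensor E F =
    \<lparr>vb_base = vb_base E \<inter> vb_base F,
     vb_rank = vb_rank E * vb_rank F,
     vb_idx = prod_encode ` (vb_idx E \<times> vb_idx F),
     chart = vb_common_chart E F,
     trans = (\<lambda>i j x. kronecker_mat
       (trans E (fst (prod_decode i)) (fst (prod_decode j)) x)
       (trans F (snd (prod_decode i)) (snd (prod_decode j)) x))\<rparr>"


section \<open>The line bundles \<open>O(k)\<close> and the bundles \<open>E(a, b, c)\<close>\<close>

text \<open>A form \<open>F\<close> of degree \<open>k\<close> is the section of \<open>O(k)\<close> given by \<open>F / u\<^sub>i\<^sup>k\<close> on \<open>u\<^sub>i \<noteq> 0\<close>.\<close>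

definition O_bundle :: "int \<Rightarrow> vbundle" where
  "O_bundle k =
    \<lparr>vb_base = UNIV, vb_rank = 1, vb_idx = {..<3},
     chart = (\<lambda>i. {x. coords x $ i \<noteq> 0}),
     trans = (\<lambda>i j x. mat 1 1 (\<lambda>_. (coords x $ j / coords x $ i) powi k))\<rparr>"

text \<open>The map from \<open>O\<close> to \<open>O(a) \<oplus> O(b) \<oplus> O(c)\<close> with components \<open>u\<^sub>0\<^sup>a, u\<^sub>1\<^sup>b, u\<^sub>2\<^sup>c\<close>. The
  section 1 of \<open>O = O(0)\<close> is 1 in every chart \<open>i\<close>; a chart \<open>j\<close> of the target encodes one chart
  \<open>p\<close>, \<open>q\<close>, \<open>r\<close> of each summand.\<close>

definition power_map :: "nat \<Rightarrow> nat \<Rightarrow> nat \<Rightarrow> nat \<Rightarrow> nat \<Rightarrow> cp2 \<Rightarrow> complex mat" where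
  "power_map a b c j i x =
    (let u = coords x; (p, j') = prod_decode j; (q, j'') = prod_decode j'; (r, _) = prod_decode j''
     in mat 3 1 (\<lambda>(l, _). if l = 0 then (u $ 0 / u $ p) ^ a
                         else if l = 1 then (u $ 1 / u $ q) ^ b
                         else (u $ 2 / u $ r) ^ c))"

text \<open>\<open>E\<close> is a cokernel of the bundle map \<open>power_map a b c\<close>, i.e. a model of \<open>E(a, b, c)\<close>
  (which is determined up to isomorphism).\<close>

definition is_E_bundle :: "nat \<Rightarrow> nat \<Rightarrow> nat \<Rightarrow> vbundle \<Rightarrow> bool" where
  "is_E_bundle a b c E \<longleftrightarrow> vector_bundle E \<and>
     (\<exists>g. vb_short_exact (O_bundle 0)
            (vb_sum_list [O_bundle (int a), O_bundle (int b), O_bundle (int c)]) E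
            (power_map a b c) g)"


section \<open>Equivariance and splitting types on the projective plane\<close>

definition torus :: "complex vec set" where
  "torus = {t \<in> carrier_vec 3. \<forall>i<3. t $ i \<noteq> 0}"

definition torus_act :: "complex vec \<Rightarrow> cp2 \<Rightarrow> cp2" where
  "torus_act t x = abs_cp2 (vec 3 (\<lambda>i. t $ i * coords x $ i))"

definition equivariant :: "vbundle \<Rightarrow> bool" where
  "equivariant E \<longleftrightarrow> (\<forall>t\<in>torus. vb_iso (vb_pullback (torus_act t) E) E)"

definition coord_line :: "nat \<Rightarrow> cp2 set" where
  "coord_line i = {x. coords x $ i = 0}"

definition line_bundle :: "vbundle \<Rightarrow> bool" where
  "line_bundle L \<longleftrightarrow> vector_bundle L \<and> vb_base L = UNIV \<and> vb_rank L = 1"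

definition c1_nonneg :: "vbundle \<Rightarrow> bool" where
  "c1_nonneg L \<longleftrightarrow> (\<exists>k\<ge>0. vb_iso L (O_bundle k))"

definition c1_neg :: "vbundle \<Rightarrow> bool" where
  "c1_neg L \<longleftrightarrow> (\<exists>k<0. vb_iso L (O_bundle k))"

definition splitting_type :: "vbundle \<Rightarrow> vbundle list \<Rightarrow> bool" where
  "splitting_type E Ls \<longleftrightarrow>
     vector_bundle E \<and> vb_base E = UNIV \<and> equivariant E \<and>
     length Ls = vb_rank E \<and>
     (\<forall>L\<in>set Ls. line_bundle L \<and> equivariant L \<and> (c1_nonneg L \<or> c1_neg L)) \<and>
     (\<forall>i<3. vb_iso (vb_restrict E (coord_line i)) (vb_restrict (vb_sum_list Ls) (coord_line i)))"

definition same_up_to_order_iso :: "vbundle list \<Rightarrow> vbundle list \<Rightarrow> bool" where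
  "same_up_to_order_iso Ls Ms \<longleftrightarrow> (\<exists>Ns. mset Ns = mset Ms \<and> list_all2 vb_iso Ls Ns)"

end

theory Submission
  imports "HOL-Complex_Analysis.Cauchy_Integral_Formula" Defs "Jordan_Normal_Form.Determinant"
begin

hide_type (open) Finite_Cartesian_Product.vec
hide_const (open) Finite_Cartesian_Product.vec
unbundle no vec_syntax

text \<open>Write \<open>w = (a, b, c)\<close> and \<open>{i, j, k} = {0, 1, 2}\<close>. On the line \<open>u\<^sub>i = 0\<close> the \<open>i\<close>-th entry of the
  defining section vanishes, so the map
  \<open>v \<mapsto> (u\<^sub>k\<^bsup>w\<^sub>k\<^esup> v\<^sub>j - u\<^sub>j\<^bsup>w\<^sub>j\<^esup> v\<^sub>k, v\<^sub>i)\<close> has the same kernel as the projection to \<open>E(a, b, c)\<close>, which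
  therefore restricts to \<open>O(w\<^sub>j + w\<^sub>k) \<oplus> O(w\<^sub>i)\<close>. By Liouville's theorem there is no nonzero morphism
  \<open>O(k) \<rightarrow> O(l)\<close> on a line when \<open>k > l\<close>, hence the degrees of the summands are determined by the
  restriction. A splitting type thus forces \<open>{w\<^sub>i, w\<^sub>j + w\<^sub>k}\<close> not to depend on \<open>i\<close>, and positivity gives
  \<open>a = b = c\<close>. Equivariance holds because, up to scaling, \<open>diag(t\<^sub>l\<^bsup>-w\<^sub>l\<^esup>)\<close> carries the pullback of
  the section along \<open>t\<close> back to the section.\<close>

section \<open>Forms on the projective plane\<close>

text \<open>Bundles are cocycles over unrelated covers, and \<open>coords\<close> picks a
  representative of each point without any regularity. The obstacle is therefore to compare
  morphisms without carrying charts and representatives along. Pointwise frames reduce an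
  isomorphism to linear algebra in one fibre together with a local regularity check. For cokernels
  the linear algebra is a single criterion: two surjections from one bundle with equal kernels in
  every fibre have isomorphic targets. It is applied twice, once to the pulled-back projection for
  equivariance and once to the explicit map on a coordinate line. Positivity enters at two places:
  \<open>u_i ^ w_i\<close> vanishes on \<open>u_i = 0\<close> because \<open>w_i > 0\<close>, and
  \<open>{b + c, a} = {a + c, b}\<close> forces \<open>a = b\<close> because \<open>c > 0\<close>
  excludes \<open>b + c = b\<close>. Degrees are compared as sets, without multiplicities; as both
  sets come from lists of length two, this still determines the pair up to order. All claims are
  made for an arbitrary cokernel \<open>E\<close>, so an explicit cokernel is constructed as
  well.\<close>

lemma hom_poly_monomial:
  assumes "i + j + k = d"
  shows "hom_poly d (\<lambda>u. c * u $ 0 ^ i * u $ 1 ^ j * u $ 2 ^ k)"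
proof -
  define \<alpha> where "\<alpha> = (\<lambda>p q. if p = i \<and> q = j then c else 0)"
  have "(\<Sum>p\<le>d. \<Sum>q\<le>d - p. \<alpha> p q * u $ 0 ^ p * u $ 1 ^ q * u $ 2 ^ (d - p - q)) =
      c * u $ 0 ^ i * u $ 1 ^ j * u $ 2 ^ k" for u :: "complex vec"
  proof -
    have "(\<Sum>q\<le>d - p. \<alpha> p q * u $ 0 ^ p * u $ 1 ^ q * u $ 2 ^ (d - p - q)) =
        (if p = i then c * u $ 0 ^ i * u $ 1 ^ j * u $ 2 ^ k else 0)" for p
    proof -
      have "(\<Sum>q\<le>d - p. \<alpha> p q * u $ 0 ^ p * u $ 1 ^ q * u $ 2 ^ (d - p - q)) =
          (\<Sum>q\<le>d - p. if q = j then if p = i then c * u $ 0 ^ i * u $ 1 ^ j * u $ 2 ^ k else 0 else 0)"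
        unfolding \<alpha>_def using assms by (intro sum.cong refl) auto
      also have "\<dots> = (if p = i then c * u $ 0 ^ i * u $ 1 ^ j * u $ 2 ^ k else 0)"
        using assms by (subst sum.delta) auto
      finally show ?thesis .
    qed
    then show ?thesis
      using assms by simp
  qed
  then show ?thesis
    unfolding hom_poly_def by (intro exI[of _ \<alpha>]) (auto simp: fun_eq_iff)
qed

abbreviation form :: "nat \<Rightarrow> (nat \<Rightarrow> nat \<Rightarrow> complex) \<Rightarrow> complex vec \<Rightarrow> complex" where
  "form d \<alpha> \<equiv> \<lambda>u. \<Sum>i\<le>d. \<Sum>j\<le>d - i. \<alpha> i j * u $ 0 ^ i * u $ 1 ^ j * u $ 2 ^ (d - i - j)"

lemma hom_polyE:
  assumes "hom_poly d P" obtains \<alpha> where "P = form d \<alpha>"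
  using assms unfolding hom_poly_def by blast

lemma hom_poly_zero: "hom_poly d (\<lambda>_. 0)"
  unfolding hom_poly_def by (intro exI[of _ "\<lambda>_ _. 0"]) auto

lemma hom_poly_add:
  assumes "hom_poly d P" "hom_poly d Q"
  shows "hom_poly d (\<lambda>u. P u + Q u)"
proof -
  obtain \<alpha> where P: "P = form d \<alpha>" by (rule hom_polyE[OF assms(1)])
  obtain \<beta> where Q: "Q = form d \<beta>" by (rule hom_polyE[OF assms(2)])
  from P Q show ?thesis
    unfolding hom_poly_def
    by (intro exI[of _ "\<lambda>i j. \<alpha> i j + \<beta> i j"]) (simp add: sum.distrib algebra_simps)
qed

lemma hom_poly_sum:
  assumes "\<And>i. i \<in> I \<Longrightarrow> hom_poly d (P i)"
  shows "hom_poly d (\<lambda>u. \<Sum>i\<in>I. P i u)"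
  using assms by (induction I rule: infinite_finite_induct) (auto intro: hom_poly_zero hom_poly_add)

lemma hom_poly_mult:
  assumes "hom_poly d P" "hom_poly e Q"
  shows "hom_poly (d + e) (\<lambda>u. P u * Q u)"
proof -
  obtain \<alpha> where P: "P = form d \<alpha>" by (rule hom_polyE[OF assms(1)])
  obtain \<beta> where Q: "Q = form e \<beta>" by (rule hom_polyE[OF assms(2)])
  have "hom_poly (d + e) (\<lambda>u. \<Sum>i\<le>d. \<Sum>j\<le>d - i. \<Sum>k\<le>e. \<Sum>l\<le>e - k.
      (\<alpha> i j * \<beta> k l) * u $ 0 ^ (i + k) * u $ 1 ^ (j + l) * u $ 2 ^ ((d - i - j) + (e - k - l)))"
    by (intro hom_poly_sum hom_poly_monomial) auto
  moreover have "(\<lambda>u. P u * Q u) = (\<lambda>u. \<Sum>i\<le>d. \<Sum>j\<le>d - i. \<Sum>k\<le>e. \<Sum>l\<le>e - k.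
      (\<alpha> i j * \<beta> k l) * u $ 0 ^ (i + k) * u $ 1 ^ (j + l) * u $ 2 ^ ((d - i - j) + (e - k - l)))"
    unfolding P Q unfolding sum_distrib_right unfolding sum_distrib_left
    by (intro ext sum.cong refl) (simp only: power_add mult_ac)
  ultimately show ?thesis by simp
qed

lemma hom_poly_const: "hom_poly 0 (\<lambda>_. c)"
  using hom_poly_monomial[of 0 0 0 0 c] by simp

lemma hom_poly_cmult: "hom_poly d P \<Longrightarrow> hom_poly d (\<lambda>u. c * P u)"
  using hom_poly_mult[OF hom_poly_const] by simp

lemma hom_poly_coord_power:
  assumes "l < 3" shows "hom_poly k (\<lambda>u. u $ l ^ k)"
proof -
  consider "l = 0" | "l = 1" | "l = 2" using assms by linarith
  then show ?thesis
    using hom_poly_monomial[of k 0 0 k 1] hom_poly_monomial[of 0 k 0 k 1] hom_poly_monomial[of 0 0 k k 1]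
    by cases simp_all
qed

lemma hom_poly_smult:
  assumes "hom_poly d P" "u \<in> carrier_vec 3"
  shows "P (s \<cdot>\<^sub>v u) = s ^ d * P u"
proof -
  obtain \<alpha> where P: "P = form d \<alpha>" by (rule hom_polyE[OF assms(1)])
  have pow: "s ^ d = s ^ i * s ^ j * s ^ (d - i - j)" if "i \<le> d" "j \<le> d - i" for i j
  proof -
    have "d = i + j + (d - i - j)" using that by simp
    then show ?thesis by (metis power_add)
  qed
  have "\<alpha> i j * (s \<cdot>\<^sub>v u) $ 0 ^ i * (s \<cdot>\<^sub>v u) $ 1 ^ j * (s \<cdot>\<^sub>v u) $ 2 ^ (d - i - j) =
      s ^ d * (\<alpha> i j * u $ 0 ^ i * u $ 1 ^ j * u $ 2 ^ (d - i - j))" if "i \<le> d" "j \<le> d - i" for i j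
    using assms(2) that by (simp add: pow[OF that] power_mult_distrib)
  then show ?thesis
    unfolding P sum_distrib_left by (intro sum.cong refl) auto
qed

text \<open>Rescaling the variables multiplies each coefficient by the corresponding monomial in
  \<open>t\<close>.\<close>

lemma hom_poly_torus:
  assumes "hom_poly d P"
  shows "hom_poly d (\<lambda>u. P (vec 3 (\<lambda>i. t $ i * u $ i)))"
proof -
  obtain \<alpha> where P: "P = form d \<alpha>" by (rule hom_polyE[OF assms(1)])
  show ?thesis
    unfolding P hom_poly_def
    by (intro exI[of _ "\<lambda>i j. \<alpha> i j * t $ 0 ^ i * t $ 1 ^ j * t $ 2 ^ (d - i - j)"])
      (simp add: power_mult_distrib algebra_simps)
qed

subsection \<open>Points and open sets\<close>

lemma coords_carrier [simp]: "coords x \<in> carrier_vec 3"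
  and coords_nonzero: "coords x \<noteq> 0\<^sub>v 3"
proof -
  have "proj_rel (rep_cp2 x) (rep_cp2 x)"
    using Quotient3_cp2 by (rule Quotient3_rep_reflp)
  then show "coords x \<in> carrier_vec 3" "coords x \<noteq> 0\<^sub>v 3"
    unfolding proj_rel_def coords_def by auto
qed

lemma dim_coords [simp]: "dim_vec (coords x) = 3"
  using coords_carrier by (metis carrier_vecD)

lemma coords_nonzero_entry:
  obtains m where "m < 3" "coords x $ m \<noteq> 0"
proof (rule ccontr)
  assume "\<not> thesis"
  then have "coords x = 0\<^sub>v 3" using that by (intro eq_vecI) auto
  then show False using coords_nonzero by blast
qed

lemma coords_abs:
  assumes "v \<in> carrier_vec 3" "v \<noteq> 0\<^sub>v 3"
  obtains s where "s \<noteq> 0" "coords (abs_cp2 v) = s \<cdot>\<^sub>v v"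
proof -
  have "proj_rel v v"
    unfolding proj_rel_def using assms by (auto intro!: exI[of _ 1])
  then have "proj_rel (rep_cp2 (abs_cp2 v)) v"
    using Quotient3_cp2 by (metis rep_abs_rsp_left)
  then obtain s where "s \<noteq> 0" "v = s \<cdot>\<^sub>v coords (abs_cp2 v)"
    unfolding proj_rel_def coords_def by blast
  then have "inverse s \<cdot>\<^sub>v v = inverse s \<cdot>\<^sub>v (s \<cdot>\<^sub>v coords (abs_cp2 v))" by simp
  with \<open>s \<noteq> 0\<close> show thesis
    by (intro that[of "inverse s"]) (simp_all add: smult_smult_assoc)
qed

text \<open>\<open>coords\<close> of the moved point is again an arbitrary representative, and this
  factor is its discrepancy from the vector \<open>t $ i * coords x $ i\<close>. It depends on
  \<open>x\<close> with no regularity, so it has to cancel wherever regularity is claimed.\<close>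

definition torus_scale :: "complex vec \<Rightarrow> cp2 \<Rightarrow> complex" where
  "torus_scale t x = (SOME s. s \<noteq> 0 \<and>
     (\<forall>i<3. coords (torus_act t x) $ i = s * (t $ i * coords x $ i)))"

lemma torus_scale:
  assumes "t \<in> torus"
  shows "torus_scale t x \<noteq> 0"
    and "i < 3 \<Longrightarrow> coords (torus_act t x) $ i = torus_scale t x * (t $ i * coords x $ i)"
proof -
  define v where "v = vec 3 (\<lambda>i. t $ i * coords x $ i)"
  obtain m where m: "m < 3" "coords x $ m \<noteq> 0" by (rule coords_nonzero_entry)
  then have "v $ m \<noteq> 0" using assms unfolding v_def torus_def by auto
  then have "v \<noteq> 0\<^sub>v 3" using m(1) by auto
  then obtain s where "s \<noteq> 0" "coords (torus_act t x) = s \<cdot>\<^sub>v v"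
    using coords_abs[of v] unfolding torus_act_def v_def by auto
  then have "\<exists>s. s \<noteq> 0 \<and> (\<forall>i<3. coords (torus_act t x) $ i = s * (t $ i * coords x $ i))"
    by (intro exI[of _ s]) (auto simp: v_def)
  from someI_ex[OF this]
  show "torus_scale t x \<noteq> 0"
    "i < 3 \<Longrightarrow> coords (torus_act t x) $ i = torus_scale t x * (t $ i * coords x $ i)"
    unfolding torus_scale_def by auto
qed

lemma hom_poly_torus_act:
  assumes "t \<in> torus" "hom_poly d P"
  shows "P (coords (torus_act t x)) =
    torus_scale t x ^ d * P (vec 3 (\<lambda>i. t $ i * coords x $ i))"
proof -
  have "coords (torus_act t x) = torus_scale t x \<cdot>\<^sub>v vec 3 (\<lambda>i. t $ i * coords x $ i)"
    using torus_scale(2)[OF assms(1), of _ x] by (intro eq_vecI) auto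
  then show ?thesis using hom_poly_smult[OF assms(2)] by simp
qed

lemma zariski_open_UNIV: "zariski_open UNIV"
  unfolding zariski_open_def by (intro exI[of _ "{\<lambda>_. 1}"]) (auto intro: hom_poly_const)

lemma zariski_open_basic: "hom_poly d P \<Longrightarrow> zariski_open {x. P (coords x) \<noteq> 0}"
  unfolding zariski_open_def by (intro exI[of _ "{P}"]) auto

lemma zariski_open_Int:
  assumes "zariski_open U" "zariski_open V" shows "zariski_open (U \<inter> V)"
proof -
  obtain F G where *: "\<forall>P\<in>F. \<exists>d. hom_poly d P" "U = {x. \<exists>P\<in>F. P (coords x) \<noteq> 0}"
    "\<forall>P\<in>G. \<exists>d. hom_poly d P" "V = {x. \<exists>P\<in>G. P (coords x) \<noteq> 0}"
    using assms unfolding zariski_open_def by auto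
  show ?thesis
    unfolding zariski_open_def
  proof (intro exI[of _ "(\<lambda>(P, Q) u. P u * Q u) ` (F \<times> G)"] conjI ballI)
    fix R assume "R \<in> (\<lambda>(P, Q) u. P u * Q u) ` (F \<times> G)"
    then show "\<exists>d. hom_poly d R" using *(1,3) hom_poly_mult by fast
  qed (auto simp: *)
qed

lemma zariski_open_coord: "l < 3 \<Longrightarrow> zariski_open {x. coords x $ l \<noteq> 0}"
  using zariski_open_basic[OF hom_poly_coord_power[of l 1]] by simp

text \<open>The factor \<open>torus_scale t x ^ d\<close> between a form at the moved point and the
  substituted form is nonzero, so both vanish at the same points.\<close>

lemma zariski_open_torus:
  assumes "t \<in> torus" "zariski_open U" shows "zariski_open (torus_act t -` U)"
proof -
  obtain F where *: "\<forall>P\<in>F. \<exists>d. hom_poly d P" "U = {x. \<exists>P\<in>F. P (coords x) \<noteq> 0}"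
    using assms unfolding zariski_open_def by auto
  have nz: "P (coords (torus_act t x)) \<noteq> 0 \<longleftrightarrow> P (vec 3 (\<lambda>i. t $ i * coords x $ i)) \<noteq> 0" if "P \<in> F" for P x
    using * that hom_poly_torus_act[OF assms(1), of _ P x] torus_scale(1)[OF assms(1)] by force
  then show ?thesis
    unfolding zariski_open_def
  proof (intro exI[of _ "(\<lambda>P u. P (vec 3 (\<lambda>i. t $ i * u $ i))) ` F"] conjI ballI)
    fix R assume "R \<in> (\<lambda>P u. P (vec 3 (\<lambda>i. t $ i * u $ i))) ` F"
    then show "\<exists>d. hom_poly d R" using *(1) hom_poly_torus by blast
  next
    show "torus_act t -` U = {x. \<exists>R\<in>(\<lambda>P u. P (vec 3 (\<lambda>i. t $ i * u $ i))) ` F. R (coords x) \<noteq> 0}"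
      using nz unfolding *(2) by simp
  qed
qed

subsection \<open>Regular functions\<close>

text \<open>The clause of \<open>regular_on\<close> at a single point, named so that its four
  witnesses can be supplied in one rule.\<close>

definition rational_near :: "cp2 set \<Rightarrow> (cp2 \<Rightarrow> complex) \<Rightarrow> cp2 \<Rightarrow> bool" where
  "rational_near S f x \<longleftrightarrow> (\<exists>U d P Q. zariski_open U \<and> x \<in> U \<and> hom_poly d P \<and> hom_poly d Q \<and>
     (\<forall>y\<in>S \<inter> U. Q (coords y) \<noteq> 0 \<and> f y = P (coords y) / Q (coords y)))"

lemma rational_nearI:
  assumes "zariski_open U" "x \<in> U" "hom_poly d P" "hom_poly d Q"
    "\<And>y. y \<in> S \<Longrightarrow> y \<in> U \<Longrightarrow> Q (coords y) \<noteq> 0 \<and> f y = P (coords y) / Q (coords y)"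
  shows "rational_near S f x"
  unfolding rational_near_def using assms
  by (intro exI[of _ U] exI[of _ d] exI[of _ P] exI[of _ Q]) auto

lemma regular_on_iff: "regular_on S f \<longleftrightarrow> (\<forall>x\<in>S. rational_near S f x)"
  unfolding regular_on_def rational_near_def ..

lemma regular_onE:
  assumes "regular_on S f" "x \<in> S"
  obtains U d P Q where "zariski_open U" "x \<in> U" "hom_poly d P" "hom_poly d Q"
    "\<forall>y\<in>S \<inter> U. Q (coords y) \<noteq> 0 \<and> f y = P (coords y) / Q (coords y)"
  using bspec[OF assms[unfolded regular_on_def]] by (elim exE conjE) simp

lemma regular_on_localI:
  assumes "\<And>x. x \<in> S \<Longrightarrow> \<exists>U g. zariski_open U \<and> x \<in> U \<and> regular_on (S \<inter> U) g \<and> (\<forall>y\<in>S \<inter> U. f y = g y)"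
  shows "regular_on S f"
  unfolding regular_on_iff
proof
  fix x assume x: "x \<in> S"
  obtain U g where U: "zariski_open U" "x \<in> U" "regular_on (S \<inter> U) g" "\<forall>y\<in>S \<inter> U. f y = g y"
    using assms[OF x] by blast
  with x obtain V d P Q where V: "zariski_open V" "x \<in> V" "hom_poly d P" "hom_poly d Q"
    "\<forall>y\<in>S \<inter> U \<inter> V. Q (coords y) \<noteq> 0 \<and> g y = P (coords y) / Q (coords y)"
    by (metis IntI regular_onE)
  then show "rational_near S f x"
    using U by (intro rational_nearI[of "U \<inter> V" x d P Q]) (auto intro: zariski_open_Int)
qed

lemma regular_on_cong: "regular_on S g \<Longrightarrow> (\<And>x. x \<in> S \<Longrightarrow> f x = g x) \<Longrightarrow> regular_on S f"
  by (rule regular_on_localI) (auto intro!: exI[of _ UNIV] exI[of _ g] zariski_open_UNIV)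

lemma regular_on_subset: "regular_on S f \<Longrightarrow> T \<subseteq> S \<Longrightarrow> regular_on T f"
  unfolding regular_on_iff
proof
  fix x assume "\<forall>x\<in>S. rational_near S f x" "T \<subseteq> S" "x \<in> T"
  then have "rational_near S f x" by blast
  then obtain U d P Q where "zariski_open U" "x \<in> U" "hom_poly d P" "hom_poly d Q"
      "\<forall>y\<in>S \<inter> U. Q (coords y) \<noteq> 0 \<and> f y = P (coords y) / Q (coords y)"
    unfolding rational_near_def by fast
  with \<open>T \<subseteq> S\<close> show "rational_near T f x"
    by (intro rational_nearI[of U x d P Q]) auto
qed

lemma regular_on_ratio:
  assumes "hom_poly d P" "hom_poly d Q" "\<And>x. x \<in> S \<Longrightarrow> Q (coords x) \<noteq> 0"
    "\<And>x. x \<in> S \<Longrightarrow> f x = P (coords x) / Q (coords x)"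
  shows "regular_on S f"
  unfolding regular_on_def using assms zariski_open_UNIV by blast

lemma regular_on_const: "regular_on S (\<lambda>_. c)"
  by (rule regular_on_ratio[OF hom_poly_const[of c] hom_poly_const[of 1]]) auto

text \<open>Sum and product of two fractions admit the common denominator \<open>Q u * Q' u\<close>
  of degree \<open>d + e\<close>; only the numerator \<open>R\<close> depends on the operation, so
  the choice of neighbourhoods is done once for both.\<close>

lemma regular_on_binop:
  assumes f: "regular_on S f" and g: "regular_on S g"
    and op: "\<And>d e P Q P' Q'. hom_poly d P \<Longrightarrow> hom_poly d Q \<Longrightarrow> hom_poly e P' \<Longrightarrow> hom_poly e Q' \<Longrightarrow>
      \<exists>R. hom_poly (d + e) R \<and> (\<forall>u. Q u \<noteq> 0 \<longrightarrow> Q' u \<noteq> 0 \<longrightarrow> op (P u / Q u) (P' u / Q' u) = R u / (Q u * Q' u))"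
  shows "regular_on S (\<lambda>x. op (f x) (g x))"
  unfolding regular_on_iff
proof
  fix x assume x: "x \<in> S"
  obtain U d P Q where U: "zariski_open U" "x \<in> U" "hom_poly d P" "hom_poly d Q"
    "\<forall>y\<in>S \<inter> U. Q (coords y) \<noteq> 0 \<and> f y = P (coords y) / Q (coords y)"
    using f x by (auto elim!: regular_onE)
  obtain V e P' Q' where V: "zariski_open V" "x \<in> V" "hom_poly e P'" "hom_poly e Q'"
    "\<forall>y\<in>S \<inter> V. Q' (coords y) \<noteq> 0 \<and> g y = P' (coords y) / Q' (coords y)"
    using g x by (auto elim!: regular_onE)
  obtain R where "hom_poly (d + e) R"
    "\<forall>u. Q u \<noteq> 0 \<longrightarrow> Q' u \<noteq> 0 \<longrightarrow> op (P u / Q u) (P' u / Q' u) = R u / (Q u * Q' u)"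
    using op[OF U(3,4) V(3,4)] by blast
  then show "rational_near S (\<lambda>x. op (f x) (g x)) x"
    using U V
    by (intro rational_nearI[of "U \<inter> V" x "d + e" R "\<lambda>u. Q u * Q' u"])
      (auto intro: zariski_open_Int hom_poly_mult)
qed

lemma regular_on_add: "regular_on S f \<Longrightarrow> regular_on S g \<Longrightarrow> regular_on S (\<lambda>x. f x + g x)"
proof (rule regular_on_binop[where op = "(+)"])
  fix d e P Q P' Q' assume *: "hom_poly d P" "hom_poly d Q" "hom_poly e P'" "hom_poly e Q'"
  have "hom_poly (d + e) (\<lambda>u. P u * Q' u + Q u * P' u)"
    using * by (intro hom_poly_add hom_poly_mult)
  then show "\<exists>R. hom_poly (d + e) R \<and> (\<forall>u. Q u \<noteq> 0 \<longrightarrow> Q' u \<noteq> 0 \<longrightarrow>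
      P u / Q u + P' u / Q' u = R u / (Q u * Q' u))"
    by (intro exI[of _ "\<lambda>u. P u * Q' u + Q u * P' u"]) (simp add: field_simps)
qed

lemma regular_on_mult: "regular_on S f \<Longrightarrow> regular_on S g \<Longrightarrow> regular_on S (\<lambda>x. f x * g x)"
proof (rule regular_on_binop[where op = "(*)"])
  fix d e P Q P' Q' assume "hom_poly d P" "hom_poly d Q" "hom_poly e P'" "hom_poly e Q'"
  then show "\<exists>R. hom_poly (d + e) R \<and> (\<forall>u. Q u \<noteq> 0 \<longrightarrow> Q' u \<noteq> 0 \<longrightarrow>
      P u / Q u * (P' u / Q' u) = R u / (Q u * Q' u))"
    by (intro exI[of _ "\<lambda>u. P u * P' u"]) (simp add: hom_poly_mult)
qed

lemma regular_on_sum: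
  "(\<And>i. i \<in> I \<Longrightarrow> regular_on S (f i)) \<Longrightarrow> regular_on S (\<lambda>x. \<Sum>i\<in>I. f i x)"
  by (induction I rule: infinite_finite_induct) (auto intro: regular_on_const regular_on_add)

lemma regular_on_prod:
  "(\<And>i. i \<in> I \<Longrightarrow> regular_on S (f i)) \<Longrightarrow> regular_on S (\<lambda>x. \<Prod>i\<in>I. f i x)"
  by (induction I rule: infinite_finite_induct) (auto intro: regular_on_const regular_on_mult)

text \<open>Numerator and denominator exchange roles; \<open>f x \<noteq> 0\<close> makes the old
  numerator an admissible denominator.\<close>

lemma regular_on_inverse:
  assumes "regular_on S f" "\<And>x. x \<in> S \<Longrightarrow> f x \<noteq> 0"
  shows "regular_on S (\<lambda>x. inverse (f x))"
  unfolding regular_on_iff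
proof
  fix x assume x: "x \<in> S"
  then obtain U d P Q where U: "zariski_open U" "x \<in> U" "hom_poly d P" "hom_poly d Q"
    "\<forall>y\<in>S \<inter> U. Q (coords y) \<noteq> 0 \<and> f y = P (coords y) / Q (coords y)"
    using assms(1) by (auto elim!: regular_onE)
  then show "rational_near S (\<lambda>x. inverse (f x)) x"
    using assms(2) by (intro rational_nearI[of U x d Q P]) fastforce+
qed

text \<open>Near \<open>x\<close> the zeros of \<open>f\<close> are those of its numerator, a closed
  condition. This serves to shrink a neighbourhood until a determinant has no zero.\<close>

lemma regular_on_nonzero_nbhd:
  assumes "regular_on S f" "x \<in> S" "f x \<noteq> 0"
  obtains U where "zariski_open U" "x \<in> U" "\<And>y. y \<in> S \<inter> U \<Longrightarrow> f y \<noteq> 0"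
proof -
  obtain U d P Q where U: "zariski_open U" "x \<in> U" "hom_poly d P" "hom_poly d Q"
    "\<forall>y\<in>S \<inter> U. Q (coords y) \<noteq> 0 \<and> f y = P (coords y) / Q (coords y)"
    using assms by (auto elim!: regular_onE)
  show thesis
    using U assms(2,3)
    by (intro that[of "U \<inter> {y. P (coords y) \<noteq> 0}"] zariski_open_Int zariski_open_basic[of d]) auto
qed

lemma regular_on_power: "regular_on S f \<Longrightarrow> regular_on S (\<lambda>x. f x ^ n)"
  by (induction n) (auto intro: regular_on_const regular_on_mult)

lemma regular_on_powi:
  assumes "regular_on S f" "\<And>x. x \<in> S \<Longrightarrow> f x \<noteq> 0"
  shows "regular_on S (\<lambda>x. f x powi k)"
  unfolding power_int_def using assms
  by (cases "k \<ge> 0") (simp_all add: regular_on_power regular_on_inverse)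

lemma regular_on_coord_ratio:
  assumes "p < 3" "q < 3" "\<And>x. x \<in> S \<Longrightarrow> coords x $ q \<noteq> 0"
  shows "regular_on S (\<lambda>x. coords x $ p / coords x $ q)"
  using assms hom_poly_coord_power[of p 1] hom_poly_coord_power[of q 1]
  by (intro regular_on_ratio[of 1 "\<lambda>u. u $ p" "\<lambda>u. u $ q"]) auto

text \<open>Numerator and denominator have the same degree, so the irregular factors
  \<open>torus_scale t y ^ d\<close> cancel in the fraction.\<close>

lemma regular_on_torus:
  assumes t: "t \<in> torus" and f: "regular_on S f"
  shows "regular_on (torus_act t -` S) (\<lambda>x. f (torus_act t x))"
  unfolding regular_on_iff
proof
  fix x assume "x \<in> torus_act t -` S"
  then obtain U d P Q where U: "zariski_open U" "torus_act t x \<in> U" "hom_poly d P" "hom_poly d Q"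
    "\<forall>y\<in>S \<inter> U. Q (coords y) \<noteq> 0 \<and> f y = P (coords y) / Q (coords y)"
    using f by (auto elim!: regular_onE)
  show "rational_near (torus_act t -` S) (\<lambda>x. f (torus_act t x)) x"
  proof (rule rational_nearI)
    show "zariski_open (torus_act t -` U)" using t U zariski_open_torus by blast
    show "x \<in> torus_act t -` U" using U by simp
    show "hom_poly d (\<lambda>u. P (vec 3 (\<lambda>i. t $ i * u $ i)))" "hom_poly d (\<lambda>u. Q (vec 3 (\<lambda>i. t $ i * u $ i)))"
      using U hom_poly_torus by auto
    fix y assume "y \<in> torus_act t -` S" "y \<in> torus_act t -` U"
    then have "Q (coords (torus_act t y)) \<noteq> 0 \<and>
        f (torus_act t y) = P (coords (torus_act t y)) / Q (coords (torus_act t y))"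
      using U by auto
    then show "Q (vec 3 (\<lambda>i. t $ i * coords y $ i)) \<noteq> 0 \<and>
      f (torus_act t y) = P (vec 3 (\<lambda>i. t $ i * coords y $ i)) / Q (vec 3 (\<lambda>i. t $ i * coords y $ i))"
      using hom_poly_torus_act[OF t U(3), of y] hom_poly_torus_act[OF t U(4), of y] torus_scale(1)[OF t, of y]
      by auto
  qed
qed

subsection \<open>Regular matrices\<close>

lemma regular_mat_onI:
  assumes "\<And>x. x \<in> S \<Longrightarrow> A x \<in> carrier_mat m n"
    "\<And>p q. p < m \<Longrightarrow> q < n \<Longrightarrow> regular_on S (\<lambda>x. A x $$ (p, q))"
  shows "regular_mat_on S m n A"
  using assms unfolding regular_mat_on_def by auto

lemma regular_mat_on_carrier: "regular_mat_on S m n A \<Longrightarrow> x \<in> S \<Longrightarrow> A x \<in> carrier_mat m n"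
  unfolding regular_mat_on_def by auto

lemma regular_mat_on_entry:
  "regular_mat_on S m n A \<Longrightarrow> p < m \<Longrightarrow> q < n \<Longrightarrow> regular_on S (\<lambda>x. A x $$ (p, q))"
  unfolding regular_mat_on_def by auto

lemma regular_mat_on_localI:
  assumes "\<And>x. x \<in> S \<Longrightarrow> \<exists>U B. zariski_open U \<and> x \<in> U \<and> regular_mat_on (S \<inter> U) m n B \<and>
      (\<forall>y\<in>S \<inter> U. A y = B y)"
  shows "regular_mat_on S m n A"
proof (rule regular_mat_onI)
  fix x assume "x \<in> S"
  then show "A x \<in> carrier_mat m n" using assms regular_mat_on_carrier by (metis IntI)
next
  fix p q assume pq: "p < m" "q < n"
  show "regular_on S (\<lambda>x. A x $$ (p, q))"
  proof (rule regular_on_localI)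
    fix x assume "x \<in> S"
    from assms[OF this] obtain U B where "zariski_open U" "x \<in> U" "regular_mat_on (S \<inter> U) m n B"
      "\<forall>y\<in>S \<inter> U. A y = B y" by blast
    with pq show "\<exists>U g. zariski_open U \<and> x \<in> U \<and> regular_on (S \<inter> U) g \<and> (\<forall>y\<in>S \<inter> U. A y $$ (p, q) = g y)"
      by (intro exI[of _ U] exI[of _ "\<lambda>x. B x $$ (p, q)"]) (auto intro: regular_mat_on_entry)
  qed
qed

lemma regular_mat_on_cong:
  "regular_mat_on S m n B \<Longrightarrow> (\<And>x. x \<in> S \<Longrightarrow> A x = B x) \<Longrightarrow> regular_mat_on S m n A"
  by (rule regular_mat_on_localI) (auto intro!: exI[of _ UNIV] exI[of _ B] zariski_open_UNIV)

lemma regular_mat_on_subset: "regular_mat_on S m n A \<Longrightarrow> T \<subseteq> S \<Longrightarrow> regular_mat_on T m n A"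
  unfolding regular_mat_on_def using regular_on_subset by (metis subset_eq)

lemma regular_mat_on_const: "M \<in> carrier_mat m n \<Longrightarrow> regular_mat_on S m n (\<lambda>_. M)"
  by (rule regular_mat_onI) (auto intro: regular_on_const)

lemma regular_mat_on_mult:
  assumes "regular_mat_on S m n A" "regular_mat_on S n k B"
  shows "regular_mat_on S m k (\<lambda>x. A x * B x)"
proof (rule regular_mat_onI)
  fix x assume "x \<in> S"
  then show "A x * B x \<in> carrier_mat m k" using assms regular_mat_on_carrier by (metis mult_carrier_mat)
next
  fix p q assume pq: "p < m" "q < k"
  have "regular_on S (\<lambda>x. \<Sum>l\<in>{0..<n}. A x $$ (p, l) * B x $$ (l, q))"
    using pq assms by (intro regular_on_sum regular_on_mult regular_mat_on_entry) auto
  then show "regular_on S (\<lambda>x. (A x * B x) $$ (p, q))"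
  proof (rule regular_on_cong)
    fix x assume "x \<in> S"
    then have "A x \<in> carrier_mat m n" "B x \<in> carrier_mat n k" using assms regular_mat_on_carrier by auto
    then show "(A x * B x) $$ (p, q) = (\<Sum>l\<in>{0..<n}. A x $$ (p, l) * B x $$ (l, q))"
      using pq by (simp add: scalar_prod_def)
  qed
qed

lemma regular_mat_on_smult:
  assumes "regular_on S f" "regular_mat_on S m n A"
  shows "regular_mat_on S m n (\<lambda>x. f x \<cdot>\<^sub>m A x)"
proof (rule regular_mat_onI)
  fix p q assume pq: "p < m" "q < n"
  then have "regular_on S (\<lambda>x. f x * A x $$ (p, q))"
    using assms by (intro regular_on_mult regular_mat_on_entry)
  then show "regular_on S (\<lambda>x. (f x \<cdot>\<^sub>m A x) $$ (p, q))"
    by (rule regular_on_cong) (use pq regular_mat_on_carrier[OF assms(2)] in fastforce)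
qed (use regular_mat_on_carrier[OF assms(2)] in auto)

lemma regular_mat_on_torus:
  assumes "t \<in> torus" "regular_mat_on S m n A"
  shows "regular_mat_on (torus_act t -` S) m n (\<lambda>x. A (torus_act t x))"
proof (rule regular_mat_onI)
  fix p q assume "p < m" "q < n"
  then show "regular_on (torus_act t -` S) (\<lambda>x. A (torus_act t x) $$ (p, q))"
    by (rule regular_on_torus[OF assms(1) regular_mat_on_entry[OF assms(2)]])
qed (use regular_mat_on_carrier[OF assms(2)] in auto)

section \<open>Determinants, adjugates and inverses of regular matrices\<close>

lemma regular_on_det:
  assumes "regular_mat_on S n n A"
  shows "regular_on S (\<lambda>x. det (A x))"
proof (rule regular_on_cong)
  show "regular_on S (\<lambda>x. \<Sum>\<pi>\<in>{\<pi>. \<pi> permutes {0..<n}}. signof \<pi> * (\<Prod>i = 0..<n. A x $$ (i, \<pi> i)))"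
  proof (intro regular_on_sum regular_on_mult regular_on_const regular_on_prod regular_mat_on_entry[OF assms])
    fix \<pi> i assume "\<pi> \<in> {\<pi>. \<pi> permutes {0..<n}}" "i \<in> {0..<n}"
    then show "i < n" "\<pi> i < n"
      by (auto dest: permutes_in_image[where x = i])
  qed
  show "det (A x) = (\<Sum>\<pi>\<in>{\<pi>. \<pi> permutes {0..<n}}. signof \<pi> * (\<Prod>i = 0..<n. A x $$ (i, \<pi> i)))"
    if "x \<in> S" for x
    using det_def'[OF regular_mat_on_carrier[OF assms that]] .
qed

lemma regular_mat_on_adj:
  assumes A: "regular_mat_on S n n A"
  shows "regular_mat_on S n n (\<lambda>x. adj_mat (A x))"
proof (rule regular_mat_onI)
  fix p q assume pq: "p < n" "q < n"
  have "regular_mat_on S (n - 1) (n - 1) (\<lambda>x. mat_delete (A x) q p)"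
  proof (rule regular_mat_onI)
    fix k l assume kl: "k < n - 1" "l < n - 1"
    have "regular_on S (\<lambda>x. A x $$ (insert_index q k, insert_index p l))"
      using kl by (intro regular_mat_on_entry[OF A]) (auto simp: insert_index_def)
    then show "regular_on S (\<lambda>x. mat_delete (A x) q p $$ (k, l))"
    proof (rule regular_on_cong)
      fix x assume "x \<in> S"
      with kl regular_mat_on_carrier[OF A, of x] show "mat_delete (A x) q p $$ (k, l) = A x $$ (insert_index q k, insert_index p l)"
        by (auto simp: mat_delete_def insert_index_def)
    qed
  qed (use mat_delete_carrier regular_mat_on_carrier[OF A] in blast)
  then have "regular_on S (\<lambda>x. (-1) ^ (q + p) * det (mat_delete (A x) q p))"
    by (intro regular_on_mult regular_on_const regular_on_det)
  then show "regular_on S (\<lambda>x. adj_mat (A x) $$ (p, q))"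
  proof (rule regular_on_cong)
    fix x assume "x \<in> S"
    with pq regular_mat_on_carrier[OF A, of x] 
    show "adj_mat (A x) $$ (p, q) = (-1) ^ (q + p) * det (mat_delete (A x) q p)"
      by (auto simp: adj_mat_def cofactor_def)
  qed
qed (use adj_mat(1) regular_mat_on_carrier[OF A] in auto)

text \<open>Cramer's rule: adjugate and determinant are polynomial in the entries, and the
  determinant is a unit on \<open>S\<close>.\<close>

lemma regular_mat_on_inverse:
  assumes A: "regular_mat_on S n n A" and "\<And>x. x \<in> S \<Longrightarrow> det (A x) \<noteq> 0"
  obtains B where "regular_mat_on S n n B" "\<And>x. x \<in> S \<Longrightarrow> A x * B x = 1\<^sub>m n"
    "\<And>x. x \<in> S \<Longrightarrow> B x * A x = 1\<^sub>m n"
proof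
  let ?B = "\<lambda>x. inverse (det (A x)) \<cdot>\<^sub>m adj_mat (A x)"
  show "regular_mat_on S n n ?B"
    using assms by (intro regular_mat_on_smult regular_on_inverse regular_on_det[OF A] regular_mat_on_adj)
  fix x assume x: "x \<in> S"
  have "A x \<in> carrier_mat n n" using x A regular_mat_on_carrier by blast
  then show "A x * ?B x = 1\<^sub>m n" "?B x * A x = 1\<^sub>m n"
    using assms(2)[OF x] adj_mat[of "A x" n]
    by (auto simp: mult_smult_distrib[of _ n n] mult_smult_assoc_mat[of _ n n] intro!: eq_matI)
qed

lemma regular_mat_on_four_block_diag:
  assumes A: "regular_mat_on S m n A" and B: "regular_mat_on S m' n' B"
  shows "regular_mat_on S (m + m') (n + n') (\<lambda>x. four_block_mat (A x) (0\<^sub>m m n') (0\<^sub>m m' n) (B x))"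
proof (rule regular_mat_onI)
  show "four_block_mat (A x) (0\<^sub>m m n') (0\<^sub>m m' n) (B x) \<in> carrier_mat (m + m') (n + n')" if "x \<in> S" for x
    using that A B regular_mat_on_carrier by (metis four_block_carrier_mat)
  fix p q assume pq: "p < m + m'" "q < n + n'"
  let ?e = "\<lambda>x. if p < m then if q < n then A x $$ (p, q) else 0
     else if q < n then 0 else B x $$ (p - m, q - n)"
  consider "p < m" "q < n" | "p < m" "\<not> q < n" | "\<not> p < m" "q < n" | "\<not> p < m" "\<not> q < n" by blast
  then have "regular_on S ?e"
    using pq regular_mat_on_entry[OF A, of p q] regular_mat_on_entry[OF B, of "p - m" "q - n"]
    by cases (simp_all add: regular_on_const)
  then show "regular_on S (\<lambda>x. four_block_mat (A x) (0\<^sub>m m n') (0\<^sub>m m' n) (B x) $$ (p, q))"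
  proof (rule regular_on_cong)
    fix x assume "x \<in> S"
    then show "four_block_mat (A x) (0\<^sub>m m n') (0\<^sub>m m' n) (B x) $$ (p, q) = ?e x"
      using pq regular_mat_on_carrier[OF A] regular_mat_on_carrier[OF B] by fastforce
  qed
qed

section \<open>Vector bundles through fibrewise frames\<close>

lemma vector_bundle_chart:
  assumes "vector_bundle E" "i \<in> vb_idx E"
  obtains W where "zariski_open W" "chart E i = vb_base E \<inter> W"
  using assms unfolding vector_bundle_def by blast

lemma vector_bundle_cover:
  assumes "vector_bundle E" "x \<in> vb_base E"
  obtains i where "i \<in> vb_idx E" "x \<in> chart E i"
  using assms unfolding vector_bundle_def by blast

lemma vector_bundle_chart_subset: "vector_bundle E \<Longrightarrow> i \<in> vb_idx E \<Longrightarrow> x \<in> chart E i \<Longrightarrow> x \<in> vb_base E"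
  using vector_bundle_chart by blast

lemma vector_bundle_trans_regular:
  "vector_bundle E \<Longrightarrow> i \<in> vb_idx E \<Longrightarrow> j \<in> vb_idx E \<Longrightarrow>
    regular_mat_on (chart E i \<inter> chart E j) (vb_rank E) (vb_rank E) (trans E i j)"
  unfolding vector_bundle_def by simp

lemma vector_bundle_trans_carrier:
  "vector_bundle E \<Longrightarrow> i \<in> vb_idx E \<Longrightarrow> j \<in> vb_idx E \<Longrightarrow> x \<in> chart E i \<Longrightarrow> x \<in> chart E j \<Longrightarrow>
    trans E i j x \<in> carrier_mat (vb_rank E) (vb_rank E)"
  using regular_mat_on_carrier[OF vector_bundle_trans_regular] by blast

lemma vector_bundle_trans_self:
  "vector_bundle E \<Longrightarrow> i \<in> vb_idx E \<Longrightarrow> x \<in> chart E i \<Longrightarrow> trans E i i x = 1\<^sub>m (vb_rank E)"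
  unfolding vector_bundle_def by simp

lemma vector_bundle_cocycle:
  "vector_bundle E \<Longrightarrow> i \<in> vb_idx E \<Longrightarrow> j \<in> vb_idx E \<Longrightarrow> k \<in> vb_idx E \<Longrightarrow>
    x \<in> chart E i \<Longrightarrow> x \<in> chart E j \<Longrightarrow> x \<in> chart E k \<Longrightarrow>
    trans E i j x * trans E j k x = trans E i k x"
  unfolding vector_bundle_def by simp

lemma vb_morphism_regular:
  "vb_morphism E F h \<Longrightarrow> i \<in> vb_idx E \<Longrightarrow> j \<in> vb_idx F \<Longrightarrow>
    regular_mat_on (chart E i \<inter> chart F j) (vb_rank F) (vb_rank E) (h j i)"
  unfolding vb_morphism_def by simp

lemma vb_morphism_carrier:
  "vb_morphism E F h \<Longrightarrow> i \<in> vb_idx E \<Longrightarrow> j \<in> vb_idx F \<Longrightarrow> x \<in> chart E i \<Longrightarrow> x \<in> chart F j \<Longrightarrow>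
    h j i x \<in> carrier_mat (vb_rank F) (vb_rank E)"
  using regular_mat_on_carrier[OF vb_morphism_regular] by blast

lemma vb_morphism_compat:
  "vb_morphism E F h \<Longrightarrow> i \<in> vb_idx E \<Longrightarrow> i' \<in> vb_idx E \<Longrightarrow> j \<in> vb_idx F \<Longrightarrow> j' \<in> vb_idx F \<Longrightarrow>
    x \<in> chart E i \<Longrightarrow> x \<in> chart E i' \<Longrightarrow> x \<in> chart F j \<Longrightarrow> x \<in> chart F j' \<Longrightarrow>
    h j' i' x = trans F j' j x * h j i x * trans E i i' x"
  unfolding vb_morphism_def by blast

section \<open>Invertible matrices of a fixed size\<close>

definition invm :: "nat \<Rightarrow> complex mat \<Rightarrow> bool" where
  "invm r A \<longleftrightarrow> A \<in> carrier_mat r r \<and> (\<exists>B\<in>carrier_mat r r. A * B = 1\<^sub>m r \<and> B * A = 1\<^sub>m r)"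

definition minv :: "nat \<Rightarrow> complex mat \<Rightarrow> complex mat" where
  "minv r A = (SOME B. B \<in> carrier_mat r r \<and> A * B = 1\<^sub>m r \<and> B * A = 1\<^sub>m r)"

lemma
  assumes "invm r A"
  shows invm_carrier: "A \<in> carrier_mat r r"
    and minv_carrier: "minv r A \<in> carrier_mat r r"
    and minv_right: "A * minv r A = 1\<^sub>m r"
    and minv_left: "minv r A * A = 1\<^sub>m r"
proof -
  show "A \<in> carrier_mat r r" using assms unfolding invm_def by simp
  have "\<exists>B. B \<in> carrier_mat r r \<and> A * B = 1\<^sub>m r \<and> B * A = 1\<^sub>m r"
    using assms unfolding invm_def by blast
  from someI_ex[OF this]
  show "minv r A \<in> carrier_mat r r" "A * minv r A = 1\<^sub>m r" "minv r A * A = 1\<^sub>m r"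
    unfolding minv_def by auto
qed

lemma minv_cancel_left:
  assumes "invm r A" "B \<in> carrier_mat r n"
  shows "minv r A * (A * B) = B" "A * (minv r A * B) = B"
  using assms
  by (simp_all flip: assoc_mult_mat[of _ r r _ r _ n] add: invm_carrier minv_carrier minv_left minv_right)

lemma minv_cancel_right:
  assumes "invm r A" "B \<in> carrier_mat n r"
  shows "B * A * minv r A = B" "B * minv r A * A = B"
  using assms
  by (simp_all add: assoc_mult_mat[of _ n r _ r _ r] invm_carrier minv_carrier minv_left minv_right)

lemma invm_left_cancel:
  assumes "invm r A" "B \<in> carrier_mat r n" "C \<in> carrier_mat r n" "A * B = A * C"
  shows "B = C"
  using assms minv_cancel_left(1) by metis

lemma invm_right_cancel:
  assumes "invm r A" "B \<in> carrier_mat n r" "C \<in> carrier_mat n r" "B * A = C * A"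
  shows "B = C"
  using assms minv_cancel_right(1) by metis

text \<open>A frame identifies the fibres with \<open>\<complex>\<^sup>r\<close> pointwise, without any regularity. It turns the
  cocycle of transition matrices into a coboundary, so that a bundle morphism becomes a single
  matrix-valued function \<open>H\<close> on the base; regularity is tested in one pair of charts at each point.\<close>

definition vb_frame :: "vbundle \<Rightarrow> (nat \<Rightarrow> cp2 \<Rightarrow> complex mat) \<Rightarrow> bool" where
  "vb_frame E \<Phi> \<longleftrightarrow>
     (\<forall>i\<in>vb_idx E. \<forall>x\<in>chart E i. invm (vb_rank E) (\<Phi> i x)) \<and>
     (\<forall>i\<in>vb_idx E. \<forall>j\<in>vb_idx E. \<forall>x\<in>chart E i \<inter> chart E j. \<Phi> i x * trans E i j x = \<Phi> j x)"

text \<open>\<open>N\<close> is the matrix of the morphism in the charts \<open>i\<close> and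
  \<open>j\<close>. The intertwining equation says that conjugating \<open>H\<close> by the frames
  gives a regular matrix near \<open>x\<close>, without writing an inverse. \<open>H\<close> itself
  is usually irregular, because the frames are.\<close>

definition framed_at ::
    "vbundle \<Rightarrow> (nat \<Rightarrow> cp2 \<Rightarrow> complex mat) \<Rightarrow> vbundle \<Rightarrow> (nat \<Rightarrow> cp2 \<Rightarrow> complex mat) \<Rightarrow>
     (cp2 \<Rightarrow> complex mat) \<Rightarrow> cp2 \<Rightarrow> bool" where
  "framed_at E \<Phi> F \<Psi> H x \<longleftrightarrow>
     (\<exists>i\<in>vb_idx E. \<exists>j\<in>vb_idx F. \<exists>U N. zariski_open U \<and> x \<in> U \<and> x \<in> chart E i \<and> x \<in> chart F j \<and>
        regular_mat_on (chart E i \<inter> chart F j \<inter> U) (vb_rank F) (vb_rank E) N \<and>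
        (\<forall>y\<in>chart E i \<inter> chart F j \<inter> U. \<Psi> j y * N y = H y * \<Phi> i y))"

definition framed_map ::
    "vbundle \<Rightarrow> (nat \<Rightarrow> cp2 \<Rightarrow> complex mat) \<Rightarrow> vbundle \<Rightarrow> (nat \<Rightarrow> cp2 \<Rightarrow> complex mat) \<Rightarrow>
     (cp2 \<Rightarrow> complex mat) \<Rightarrow> bool" where
  "framed_map E \<Phi> F \<Psi> H \<longleftrightarrow> vb_base E = vb_base F \<and>
     (\<forall>x\<in>vb_base E. H x \<in> carrier_mat (vb_rank F) (vb_rank E) \<and> framed_at E \<Phi> F \<Psi> H x)"

lemma vb_frame_invm: "vb_frame E \<Phi> \<Longrightarrow> i \<in> vb_idx E \<Longrightarrow> x \<in> chart E i \<Longrightarrow> invm (vb_rank E) (\<Phi> i x)"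
  unfolding vb_frame_def by simp

lemma vb_frame_trans:
  "vb_frame E \<Phi> \<Longrightarrow> i \<in> vb_idx E \<Longrightarrow> j \<in> vb_idx E \<Longrightarrow> x \<in> chart E i \<Longrightarrow> x \<in> chart E j \<Longrightarrow>
    \<Phi> i x * trans E i j x = \<Phi> j x"
  unfolding vb_frame_def by simp

lemma framed_atI:
  assumes "i \<in> vb_idx E" "j \<in> vb_idx F" "zariski_open U" "x \<in> U" "x \<in> chart E i" "x \<in> chart F j"
    "regular_mat_on (chart E i \<inter> chart F j \<inter> U) (vb_rank F) (vb_rank E) N"
    "\<And>y. y \<in> chart E i \<inter> chart F j \<inter> U \<Longrightarrow> \<Psi> j y * N y = H y * \<Phi> i y"
  shows "framed_at E \<Phi> F \<Psi> H x"
  unfolding framed_at_def using assms by blast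

lemma framed_mapI:
  assumes "vb_base E = vb_base F" "\<And>x. x \<in> vb_base E \<Longrightarrow> H x \<in> carrier_mat (vb_rank F) (vb_rank E)"
    "\<And>x. x \<in> vb_base E \<Longrightarrow> framed_at E \<Phi> F \<Psi> H x"
  shows "framed_map E \<Phi> F \<Psi> H"
  unfolding framed_map_def by (intro conjI ballI assms)

lemma framed_mapE:
  assumes "framed_map E \<Phi> F \<Psi> H" "x \<in> vb_base E"
  obtains i j U N where "i \<in> vb_idx E" "j \<in> vb_idx F" "zariski_open U" "x \<in> U" "x \<in> chart E i" "x \<in> chart F j"
    "regular_mat_on (chart E i \<inter> chart F j \<inter> U) (vb_rank F) (vb_rank E) N"
    "\<forall>y\<in>chart E i \<inter> chart F j \<inter> U. \<Psi> j y * N y = H y * \<Phi> i y"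
  using assms unfolding framed_map_def framed_at_def by meson

lemma framed_map_base: "framed_map E \<Phi> F \<Psi> H \<Longrightarrow> vb_base E = vb_base F"
  unfolding framed_map_def by (rule conjunct1)

lemma framed_map_carrier:
  "framed_map E \<Phi> F \<Psi> H \<Longrightarrow> x \<in> vb_base E \<Longrightarrow> H x \<in> carrier_mat (vb_rank F) (vb_rank E)"
  unfolding framed_map_def by (drule conjunct2, drule (1) bspec, erule conjunct1)

text \<open>Choose one chart at each point and measure every other chart against it by the
  transition matrix; the cocycle identity is then exactly the frame identity.\<close>

lemma vb_frame_exists:
  assumes E: "vector_bundle E"
  obtains \<Phi> where "vb_frame E \<Phi>"
proof -
  define sel where "sel x = (SOME i. i \<in> vb_idx E \<and> x \<in> chart E i)" for x
  have sel: "sel x \<in> vb_idx E" "x \<in> chart E (sel x)" if "i \<in> vb_idx E" "x \<in> chart E i" for i x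
    using someI[of "\<lambda>i. i \<in> vb_idx E \<and> x \<in> chart E i", OF conjI[OF that]] unfolding sel_def by auto
  have "invm (vb_rank E) (trans E (sel x) i x)" if "i \<in> vb_idx E" "x \<in> chart E i" for i x
    unfolding invm_def using that sel[OF that] E
    by (auto intro!: bexI[of _ "trans E i (sel x) x"] vector_bundle_trans_carrier
        simp: vector_bundle_cocycle vector_bundle_trans_self)
  then have "vb_frame E (\<lambda>i x. trans E (sel x) i x)"
    unfolding vb_frame_def using sel E by (auto intro!: vector_bundle_cocycle)
  then show thesis by (rule that)
qed

text \<open>Changing the charts of source and target replaces the chart matrix \<open>N\<close> by
  \<open>T' * N * T\<close> and leaves \<open>H\<close> untouched.\<close>

lemma frame_change:
  assumes c: "T' \<in> carrier_mat f f" "T \<in> carrier_mat e e" "N \<in> carrier_mat f e" "B' \<in> carrier_mat f f"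
      "A \<in> carrier_mat e e" "H \<in> carrier_mat f e"
    and eq: "B' * T' = B" "B * N = H * A" "A * T = A'"
  shows "B' * (T' * N * T) = H * (A' :: complex mat)"
proof -
  have TN: "T' * N \<in> carrier_mat f e" using c by simp
  have "B' * (T' * N * T) = B' * (T' * N) * T" by (rule assoc_mult_mat[OF c(4) TN c(2), symmetric])
  also have "B' * (T' * N) = H * A"
    using assoc_mult_mat[OF c(4,1,3)] unfolding eq by (rule sym)
  also have "H * A * T = H * A'" unfolding eq(3)[symmetric] by (rule assoc_mult_mat[OF c(6,5,2)])
  finally show ?thesis .
qed

text \<open>Solving the intertwining equation defines the chart matrices for all pairs of charts at
  once, and their compatibility is automatic. Regularity is known for one pair around each point and
  is carried to any other pair by the transition matrices.\<close>

lemma framed_map_morphism: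
  assumes E: "vector_bundle E" and F: "vector_bundle F" and \<Phi>: "vb_frame E \<Phi>" and \<Psi>: "vb_frame F \<Psi>"
    and H: "framed_map E \<Phi> F \<Psi> H"
  obtains h where "vb_morphism E F h"
    "\<And>i j x. i \<in> vb_idx E \<Longrightarrow> j \<in> vb_idx F \<Longrightarrow> x \<in> chart E i \<Longrightarrow> x \<in> chart F j \<Longrightarrow>
       \<Psi> j x * h j i x = H x * \<Phi> i x"
proof -
  define h where "h j i x = minv (vb_rank F) (\<Psi> j x) * (H x * \<Phi> i x)" for j i x
  let ?e = "vb_rank E" and ?f = "vb_rank F"
  have base: "vb_base E = vb_base F" using framed_map_base[OF H] .
  have Hc: "H x \<in> carrier_mat ?f ?e" if "x \<in> vb_base E" for x
    using framed_map_carrier[OF H that] .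
  have H\<Phi>c: "H x * \<Phi> i x \<in> carrier_mat ?f ?e" if "i \<in> vb_idx E" "x \<in> chart E i" for i x
    using Hc[OF vector_bundle_chart_subset[OF E that]] invm_carrier[OF vb_frame_invm[OF \<Phi> that]] by simp
  have hc: "h j i x \<in> carrier_mat ?f ?e"
    and h: "\<Psi> j x * h j i x = H x * \<Phi> i x"
    if "i \<in> vb_idx E" "j \<in> vb_idx F" "x \<in> chart E i" "x \<in> chart F j" for i j x
    using that H\<Phi>c[of i x] minv_carrier[OF vb_frame_invm[OF \<Psi>, of j x]]
      minv_cancel_left(2)[OF vb_frame_invm[OF \<Psi>, of j x]]
    unfolding h_def by auto
  have reg: "regular_mat_on (chart E i \<inter> chart F j) ?f ?e (h j i)" if i: "i \<in> vb_idx E" and j: "j \<in> vb_idx F" for i j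
  proof (rule regular_mat_on_localI)
    fix x assume x: "x \<in> chart E i \<inter> chart F j"
    then have "x \<in> vb_base E" using vector_bundle_chart_subset[OF E i] by simp
    then obtain i0 j0 U N where *: "i0 \<in> vb_idx E" "j0 \<in> vb_idx F" "zariski_open U" "x \<in> U"
      "x \<in> chart E i0" "x \<in> chart F j0" "regular_mat_on (chart E i0 \<inter> chart F j0 \<inter> U) ?f ?e N"
      "\<forall>y\<in>chart E i0 \<inter> chart F j0 \<inter> U. \<Psi> j0 y * N y = H y * \<Phi> i0 y"
      by (rule framed_mapE[OF H])
    obtain V where V: "zariski_open V" "chart E i0 = vb_base E \<inter> V"
      using vector_bundle_chart[OF E *(1)] .
    obtain W where W: "zariski_open W" "chart F j0 = vb_base E \<inter> W"
      using vector_bundle_chart[OF F *(2)] base by metis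
    \<comment> \<open>Intersecting with \<open>V\<close> and \<open>W\<close> puts every point also
      into the charts \<open>i0\<close> and \<open>j0\<close> where regularity is known.\<close>
    let ?T = "chart E i \<inter> chart F j \<inter> (U \<inter> V \<inter> W)"
    have T: "y \<in> chart E i" "y \<in> chart F j" "y \<in> chart E i0" "y \<in> chart F j0" "y \<in> U" if "y \<in> ?T" for y
      using that V W vector_bundle_chart_subset[OF E i] by auto
    let ?B = "\<lambda>y. trans F j j0 y * N y * trans E i0 i y"
    have B: "regular_mat_on ?T ?f ?e ?B"
    proof (rule regular_mat_on_mult[OF regular_mat_on_mult])
      show "regular_mat_on ?T ?f ?f (trans F j j0)"
        using T by (intro regular_mat_on_subset[OF vector_bundle_trans_regular[OF F j *(2)]]) blast
      show "regular_mat_on ?T ?f ?e N"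
        using T by (intro regular_mat_on_subset[OF *(7)]) blast
      show "regular_mat_on ?T ?e ?e (trans E i0 i)"
        using T by (intro regular_mat_on_subset[OF vector_bundle_trans_regular[OF E *(1) i]]) blast
    qed
    have "h j i y = ?B y" if y: "y \<in> ?T" for y
    proof (rule invm_left_cancel)
      note t = T[OF y]
      have c: "trans F j j0 y \<in> carrier_mat ?f ?f" "trans E i0 i y \<in> carrier_mat ?e ?e"
        "N y \<in> carrier_mat ?f ?e" "\<Psi> j y \<in> carrier_mat ?f ?f" "\<Phi> i0 y \<in> carrier_mat ?e ?e" "H y \<in> carrier_mat ?f ?e"
        using t * i j Hc[OF vector_bundle_chart_subset[OF E i]] invm_carrier[OF vb_frame_invm[OF \<Psi>]]
          invm_carrier[OF vb_frame_invm[OF \<Phi>]] regular_mat_on_carrier[OF *(7)]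
        by (auto intro: vector_bundle_trans_carrier[OF E] vector_bundle_trans_carrier[OF F])
      show "invm ?f (\<Psi> j y)" using vb_frame_invm[OF \<Psi> j] t by blast
      show "h j i y \<in> carrier_mat ?f ?e" using hc i j t by blast
      show "?B y \<in> carrier_mat ?f ?e" using B y regular_mat_on_carrier by blast
      have "\<Psi> j y * ?B y = H y * \<Phi> i y"
        by (rule frame_change[OF c vb_frame_trans[OF \<Psi> j *(2) t(2,4)] bspec[OF *(8)]
              vb_frame_trans[OF \<Phi> *(1) i t(3,1)]]) (use t in simp)
      then show "\<Psi> j y * h j i y = \<Psi> j y * ?B y"
        using h i j t by metis
    qed
    then show "\<exists>U B. zariski_open U \<and> x \<in> U \<and> regular_mat_on (chart E i \<inter> chart F j \<inter> U) ?f ?e B \<and>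
        (\<forall>y\<in>chart E i \<inter> chart F j \<inter> U. h j i y = B y)"
      using B V W * by (intro exI[of _ "U \<inter> V \<inter> W"] exI[of _ ?B]) (auto intro!: zariski_open_Int)
  qed
  have "h j' i' x = trans F j' j x * h j i x * trans E i i' x"
    if i: "i \<in> vb_idx E" "i' \<in> vb_idx E" and j: "j \<in> vb_idx F" "j' \<in> vb_idx F"
      and x: "x \<in> chart E i" "x \<in> chart E i'" "x \<in> chart F j" "x \<in> chart F j'" for i i' j j' x
  proof (rule invm_left_cancel)
    have c: "trans F j' j x \<in> carrier_mat ?f ?f" "trans E i i' x \<in> carrier_mat ?e ?e"
      "h j i x \<in> carrier_mat ?f ?e" "\<Psi> j' x \<in> carrier_mat ?f ?f" "\<Phi> i x \<in> carrier_mat ?e ?e" "H x \<in> carrier_mat ?f ?e"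
      using x i j Hc[OF vector_bundle_chart_subset[OF E i(1)]] hc invm_carrier[OF vb_frame_invm[OF \<Psi>]]
        invm_carrier[OF vb_frame_invm[OF \<Phi>]]
      by (auto intro: vector_bundle_trans_carrier[OF E] vector_bundle_trans_carrier[OF F])
    show "invm ?f (\<Psi> j' x)" using vb_frame_invm[OF \<Psi> j(2)] x by blast
    show "h j' i' x \<in> carrier_mat ?f ?e" using hc i j x by blast
    show "trans F j' j x * h j i x * trans E i i' x \<in> carrier_mat ?f ?e" using c by simp
    have "\<Psi> j' x * (trans F j' j x * h j i x * trans E i i' x) = H x * \<Phi> i' x"
      by (rule frame_change[OF c vb_frame_trans[OF \<Psi> j(2,1) x(4,3)] h[OF i(1) j(1) x(1,3)] vb_frame_trans[OF \<Phi> i x(1,2)]])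
    then show "\<Psi> j' x * h j' i' x = \<Psi> j' x * (trans F j' j x * h j i x * trans E i i' x)"
      using h i j x by metis
  qed
  then have "vb_morphism E F h"
    unfolding vb_morphism_def using base reg by blast
  then show thesis using h by (rule that)
qed

text \<open>Converse direction: \<open>H\<close> is computed in one chosen pair of charts at each
  point, and compatibility of the morphism shows that every other pair gives the same
  matrix.\<close>

lemma vb_morphism_framed_map:
  assumes E: "vector_bundle E" and F: "vector_bundle F" and \<Phi>: "vb_frame E \<Phi>" and \<Psi>: "vb_frame F \<Psi>"
    and h: "vb_morphism E F h"
  obtains H where "framed_map E \<Phi> F \<Psi> H"
    "\<And>i j x. i \<in> vb_idx E \<Longrightarrow> j \<in> vb_idx F \<Longrightarrow> x \<in> chart E i \<Longrightarrow> x \<in> chart F j \<Longrightarrow>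
       \<Psi> j x * h j i x = H x * \<Phi> i x"
proof -
  let ?e = "vb_rank E" and ?f = "vb_rank F"
  have base: "vb_base E = vb_base F" using h unfolding vb_morphism_def by simp
  let ?P = "\<lambda>x p. fst p \<in> vb_idx E \<and> x \<in> chart E (fst p) \<and> snd p \<in> vb_idx F \<and> x \<in> chart F (snd p)"
  define sel where "sel x = (SOME p. ?P x p)" for x
  have ex: "\<exists>p. ?P x p" if "x \<in> vb_base E" for x
    using that vector_bundle_cover[OF E] vector_bundle_cover[OF F] base by (metis fst_conv snd_conv)
  have sel: "fst (sel x) \<in> vb_idx E" "x \<in> chart E (fst (sel x))" "snd (sel x) \<in> vb_idx F" "x \<in> chart F (snd (sel x))"
    if "x \<in> vb_base E" for x
    using someI_ex[OF ex[OF that]] unfolding sel_def by auto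
  define H where "H x = \<Psi> (snd (sel x)) x * h (snd (sel x)) (fst (sel x)) x * minv ?e (\<Phi> (fst (sel x)) x)" for x
  have Hc: "H x \<in> carrier_mat ?f ?e" if "x \<in> vb_base E" for x
    unfolding H_def using sel[OF that] by (intro mult_carrier_mat)
      (rule vb_morphism_carrier[OF h] invm_carrier[OF vb_frame_invm[OF \<Psi>]]
        minv_carrier[OF vb_frame_invm[OF \<Phi>]], assumption+)+
  have eq: "\<Psi> j' x * h j' i' x = H x * \<Phi> i' x"
    if ij: "i' \<in> vb_idx E" "j' \<in> vb_idx F" and x: "x \<in> chart E i'" "x \<in> chart F j'" for i' j' x
  proof -
    have xb: "x \<in> vb_base E" using vector_bundle_chart_subset[OF E] ij x by blast
    define i where "i = fst (sel x)"
    define j where "j = snd (sel x)"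
    have s: "i \<in> vb_idx E" "x \<in> chart E i" "j \<in> vb_idx F" "x \<in> chart F j"
      using sel[OF xb] unfolding i_def j_def by auto
    have c: "trans F j' j x \<in> carrier_mat ?f ?f" "trans E i i' x \<in> carrier_mat ?e ?e"
      "h j i x \<in> carrier_mat ?f ?e" "\<Psi> j' x \<in> carrier_mat ?f ?f" "\<Psi> j x \<in> carrier_mat ?f ?f"
      "\<Phi> i x \<in> carrier_mat ?e ?e" "minv ?e (\<Phi> i x) \<in> carrier_mat ?e ?e"
      using x ij s invm_carrier[OF vb_frame_invm[OF \<Psi>]] vb_morphism_carrier[OF h]
        invm_carrier[OF vb_frame_invm[OF \<Phi>]] minv_carrier[OF vb_frame_invm[OF \<Phi>]]
      by (auto intro: vector_bundle_trans_carrier[OF E] vector_bundle_trans_carrier[OF F])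
    have "\<Psi> j' x * h j' i' x = \<Psi> j' x * (trans F j' j x * h j i x * trans E i i' x)"
      using vb_morphism_compat[OF h s(1) ij(1) s(3) ij(2)] x s by simp
    also have "\<dots> = H x * \<Phi> i' x"
    proof (rule frame_change[OF c(1-4,6) Hc[OF xb] vb_frame_trans[OF \<Psi> ij(2) s(3) x(2) s(4)] _
          vb_frame_trans[OF \<Phi> s(1) ij(1) s(2) x(1)]])
      show "\<Psi> j x * h j i x = H x * \<Phi> i x"
        using minv_cancel_right(2)[OF vb_frame_invm[OF \<Phi> s(1,2)], of "\<Psi> j x * h j i x" ?f] c
        unfolding H_def i_def[symmetric] j_def[symmetric] by simp
    qed
    finally show ?thesis .
  qed
  have "framed_map E \<Phi> F \<Psi> H"
  proof (rule framed_mapI)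
    fix x assume x: "x \<in> vb_base E"
    let ?i = "fst (sel x)" and ?j = "snd (sel x)"
    show "framed_at E \<Phi> F \<Psi> H x"
      using sel[OF x] vb_morphism_regular[OF h, of ?i ?j] eq
      by (intro framed_atI[where i = ?i and j = ?j and U = UNIV and N = "h ?j ?i"]) (auto intro: zariski_open_UNIV)
  qed (use base Hc in auto)
  then show thesis using eq by (rule that)
qed

text \<open>In frames composition is the matrix product. For regularity the factors are joined in
  one chart \<open>j\<close> of the middle bundle, on the open set \<open>W\<close> that cuts out
  this chart.\<close>

lemma framed_map_comp:
  assumes E: "vector_bundle E" and F: "vector_bundle F" and G: "vector_bundle G"
    and \<Phi>: "vb_frame E \<Phi>" and \<Psi>: "vb_frame F \<Psi>" and \<Theta>: "vb_frame G \<Theta>"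
    and H: "framed_map E \<Phi> F \<Psi> H" and K: "framed_map F \<Psi> G \<Theta> K"
  shows "framed_map E \<Phi> G \<Theta> (\<lambda>x. K x * H x)"
proof -
  let ?e = "vb_rank E" and ?f = "vb_rank F" and ?g = "vb_rank G"
  have base: "vb_base F = vb_base E" "vb_base G = vb_base E" using framed_map_base[OF H] framed_map_base[OF K] by auto
  obtain h where h: "vb_morphism E F h" and hH: "\<And>i j x. i \<in> vb_idx E \<Longrightarrow> j \<in> vb_idx F \<Longrightarrow>
      x \<in> chart E i \<Longrightarrow> x \<in> chart F j \<Longrightarrow> \<Psi> j x * h j i x = H x * \<Phi> i x"
    using framed_map_morphism[OF E F \<Phi> \<Psi> H] by blast
  obtain k where k: "vb_morphism F G k" and kK: "\<And>i j x. i \<in> vb_idx F \<Longrightarrow> j \<in> vb_idx G \<Longrightarrow>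
      x \<in> chart F i \<Longrightarrow> x \<in> chart G j \<Longrightarrow> \<Theta> j x * k j i x = K x * \<Psi> i x"
    using framed_map_morphism[OF F G \<Psi> \<Theta> K] by blast
  show ?thesis
  proof (rule framed_mapI)
    show "vb_base E = vb_base G" using base by simp
    fix x assume x: "x \<in> vb_base E"
    show "K x * H x \<in> carrier_mat ?g ?e"
      using framed_map_carrier[OF H] framed_map_carrier[OF K] x base by (metis mult_carrier_mat)
    obtain i where i: "i \<in> vb_idx E" "x \<in> chart E i" using vector_bundle_cover[OF E x] .
    obtain j where j: "j \<in> vb_idx F" "x \<in> chart F j" using vector_bundle_cover[OF F] x base by metis
    obtain l where l: "l \<in> vb_idx G" "x \<in> chart G l" using vector_bundle_cover[OF G] x base by metis
    obtain W where W: "zariski_open W" "chart F j = vb_base E \<inter> W"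
      using vector_bundle_chart[OF F j(1)] base by metis
    let ?N = "\<lambda>y. k l j y * h j i y"
    let ?T = "chart E i \<inter> chart G l \<inter> W"
    have T: "y \<in> chart E i" "y \<in> chart F j" "y \<in> chart G l" if "y \<in> ?T" for y
      using that W vector_bundle_chart_subset[OF E i(1)] by auto
    have "regular_mat_on ?T ?g ?e ?N"
    proof (rule regular_mat_on_mult)
      show "regular_mat_on ?T ?g ?f (k l j)"
        using T by (intro regular_mat_on_subset[OF vb_morphism_regular[OF k j(1) l(1)]]) blast
      show "regular_mat_on ?T ?f ?e (h j i)"
        using T by (intro regular_mat_on_subset[OF vb_morphism_regular[OF h i(1) j(1)]]) blast
    qed
    moreover have "\<Theta> l y * ?N y = K y * H y * \<Phi> i y" if y: "y \<in> ?T" for y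
    proof -
      note t = T[OF y]
      have c: "h j i y \<in> carrier_mat ?f ?e" "k l j y \<in> carrier_mat ?g ?f" "\<Theta> l y \<in> carrier_mat ?g ?g"
        "\<Psi> j y \<in> carrier_mat ?f ?f" "\<Phi> i y \<in> carrier_mat ?e ?e"
        using t i j l vb_morphism_carrier[OF h] vb_morphism_carrier[OF k] invm_carrier[OF vb_frame_invm[OF \<Psi>]]
          invm_carrier[OF vb_frame_invm[OF \<Phi>]] invm_carrier[OF vb_frame_invm[OF \<Theta>]] by auto
      have HK: "H y \<in> carrier_mat ?f ?e" "K y \<in> carrier_mat ?g ?f"
        using framed_map_carrier[OF H] framed_map_carrier[OF K] vector_bundle_chart_subset[OF E i(1) t(1)] base by auto
      have "\<Theta> l y * ?N y = \<Theta> l y * k l j y * h j i y" using c by simp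
      also have "\<dots> = K y * (\<Psi> j y * h j i y)" using kK[OF j(1) l(1) t(2,3)] c HK by simp
      also have "\<dots> = K y * H y * \<Phi> i y" using hH[OF i(1) j(1) t(1,2)] c HK by simp
      finally show ?thesis .
    qed
    ultimately show "framed_at E \<Phi> G \<Theta> (\<lambda>x. K x * H x) x"
      using W i j l by (intro framed_atI[where i = i and j = l and U = W and N = ?N]) auto
  qed
qed

text \<open>The frame \<open>A\<close> conjugates \<open>k * h\<close> into \<open>K * H\<close>,
  and conjugation preserves the identity. Exchanging the roles of the two bundles treats the other
  composite.\<close>

lemma framed_comp_one_iff:
  assumes A: "invm e A" and c: "B \<in> carrier_mat f f" "h \<in> carrier_mat f e" "k \<in> carrier_mat e f"
      "H \<in> carrier_mat f e" "K \<in> carrier_mat e f"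
    and h: "B * h = H * A" and k: "A * k = K * B"
  shows "k * h = 1\<^sub>m e \<longleftrightarrow> K * H = 1\<^sub>m e"
proof -
  note A' = invm_carrier[OF A]
  have kh: "k * h \<in> carrier_mat e e" and KH: "K * H \<in> carrier_mat e e" using c by auto
  have "A * (k * h) = A * k * h" by (rule assoc_mult_mat[OF A' c(3,2), symmetric])
  also have "\<dots> = K * (B * h)" unfolding k by (rule assoc_mult_mat[OF c(5,1,2)])
  also have "\<dots> = K * H * A" unfolding h by (rule assoc_mult_mat[OF c(5,4) A', symmetric])
  finally have eq: "A * (k * h) = K * H * A" .
  show ?thesis
  proof
    assume "k * h = 1\<^sub>m e"
    then have "K * H * A = 1\<^sub>m e * A" using eq A' by simp
    then show "K * H = 1\<^sub>m e" using invm_right_cancel[OF A KH] by simp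
  next
    assume "K * H = 1\<^sub>m e"
    then have "A * (k * h) = A * 1\<^sub>m e" using eq A' by simp
    then show "k * h = 1\<^sub>m e" using invm_left_cancel[OF A kh] by simp
  qed
qed

text \<open>The two covers disappear from the inverse relations: an isomorphism becomes a pair of
  matrix functions that are inverse to each other at every point.\<close>

lemma vb_iso_framed_iff:
  assumes E: "vector_bundle E" and F: "vector_bundle F" and \<Phi>: "vb_frame E \<Phi>" and \<Psi>: "vb_frame F \<Psi>"
  shows "vb_iso E F \<longleftrightarrow> (\<exists>H K. framed_map E \<Phi> F \<Psi> H \<and> framed_map F \<Psi> E \<Phi> K \<and>
    (\<forall>x\<in>vb_base E. K x * H x = 1\<^sub>m (vb_rank E) \<and> H x * K x = 1\<^sub>m (vb_rank F)))" (is "_ \<longleftrightarrow> ?R")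
proof -
  have inv_iff: "k i j x * h j i x = 1\<^sub>m (vb_rank E) \<longleftrightarrow> K x * H x = 1\<^sub>m (vb_rank E)"
    "h j i x * k i j x = 1\<^sub>m (vb_rank F) \<longleftrightarrow> H x * K x = 1\<^sub>m (vb_rank F)"
    if h: "vb_morphism E F h" and k: "vb_morphism F E k"
      and H: "framed_map E \<Phi> F \<Psi> H" and K: "framed_map F \<Psi> E \<Phi> K"
      and ij: "i \<in> vb_idx E" "j \<in> vb_idx F" "x \<in> chart E i" "x \<in> chart F j"
      and eq: "\<Psi> j x * h j i x = H x * \<Phi> i x" "\<Phi> i x * k i j x = K x * \<Psi> j x" for h k H K i j x
  proof -
    have x: "x \<in> vb_base E" "x \<in> vb_base F"
      using vector_bundle_chart_subset[OF E ij(1,3)] vector_bundle_chart_subset[OF F ij(2,4)] by auto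
    note A = vb_frame_invm[OF \<Phi> ij(1,3)] and B = vb_frame_invm[OF \<Psi> ij(2,4)]
    note c = vb_morphism_carrier[OF h ij] vb_morphism_carrier[OF k ij(2,1,4,3)]
      framed_map_carrier[OF H x(1)] framed_map_carrier[OF K x(2)]
    show "k i j x * h j i x = 1\<^sub>m (vb_rank E) \<longleftrightarrow> K x * H x = 1\<^sub>m (vb_rank E)"
      by (rule framed_comp_one_iff[OF A invm_carrier[OF B] c eq])
    show "h j i x * k i j x = 1\<^sub>m (vb_rank F) \<longleftrightarrow> H x * K x = 1\<^sub>m (vb_rank F)"
      by (rule framed_comp_one_iff[OF B invm_carrier[OF A] c(2,1,4,3) eq(2,1)])
  qed
  show ?thesis
  proof
    assume "vb_iso E F"
    then obtain h k where h: "vb_morphism E F h" and k: "vb_morphism F E k" and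
      hk: "\<And>i j x. i \<in> vb_idx E \<Longrightarrow> j \<in> vb_idx F \<Longrightarrow> x \<in> chart E i \<Longrightarrow> x \<in> chart F j \<Longrightarrow>
          k i j x * h j i x = 1\<^sub>m (vb_rank E) \<and> h j i x * k i j x = 1\<^sub>m (vb_rank F)"
      unfolding vb_iso_def by blast
    obtain H where H: "framed_map E \<Phi> F \<Psi> H" "\<And>i j x. i \<in> vb_idx E \<Longrightarrow> j \<in> vb_idx F \<Longrightarrow>
        x \<in> chart E i \<Longrightarrow> x \<in> chart F j \<Longrightarrow> \<Psi> j x * h j i x = H x * \<Phi> i x"
      using vb_morphism_framed_map[OF E F \<Phi> \<Psi> h] by blast
    obtain K where K: "framed_map F \<Psi> E \<Phi> K" "\<And>i j x. i \<in> vb_idx F \<Longrightarrow> j \<in> vb_idx E \<Longrightarrow>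
        x \<in> chart F i \<Longrightarrow> x \<in> chart E j \<Longrightarrow> \<Phi> j x * k j i x = K x * \<Psi> i x"
      using vb_morphism_framed_map[OF F E \<Psi> \<Phi> k] by blast
    have "K x * H x = 1\<^sub>m (vb_rank E) \<and> H x * K x = 1\<^sub>m (vb_rank F)" if x: "x \<in> vb_base E" for x
    proof -
      obtain i where i: "i \<in> vb_idx E" "x \<in> chart E i" using vector_bundle_cover[OF E x] .
      obtain j where j: "j \<in> vb_idx F" "x \<in> chart F j"
        using vector_bundle_cover[OF F] x framed_map_base[OF H(1)] by metis
      note ij = i(1) j(1) i(2) j(2)
      show ?thesis
        using inv_iff[OF h k H(1) K(1) ij H(2)[OF ij] K(2)[OF ij(2,1,4,3)]] hk[OF ij] by simp
    qed
    then show ?R using H(1) K(1) by blast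
  next
    assume ?R
    then obtain H K where H: "framed_map E \<Phi> F \<Psi> H" and K: "framed_map F \<Psi> E \<Phi> K" and
      HK: "\<And>x. x \<in> vb_base E \<Longrightarrow> K x * H x = 1\<^sub>m (vb_rank E) \<and> H x * K x = 1\<^sub>m (vb_rank F)" by blast
    obtain h where h: "vb_morphism E F h" "\<And>i j x. i \<in> vb_idx E \<Longrightarrow> j \<in> vb_idx F \<Longrightarrow>
        x \<in> chart E i \<Longrightarrow> x \<in> chart F j \<Longrightarrow> \<Psi> j x * h j i x = H x * \<Phi> i x"
      using framed_map_morphism[OF E F \<Phi> \<Psi> H] by blast
    obtain k where k: "vb_morphism F E k" "\<And>i j x. i \<in> vb_idx F \<Longrightarrow> j \<in> vb_idx E \<Longrightarrow>
        x \<in> chart F i \<Longrightarrow> x \<in> chart E j \<Longrightarrow> \<Phi> j x * k j i x = K x * \<Psi> i x"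
      using framed_map_morphism[OF F E \<Psi> \<Phi> K] by blast
    have "k i j x * h j i x = 1\<^sub>m (vb_rank E) \<and> h j i x * k i j x = 1\<^sub>m (vb_rank F)"
      if ij: "i \<in> vb_idx E" "j \<in> vb_idx F" "x \<in> chart E i" "x \<in> chart F j" for i j x
      using inv_iff[OF h(1) k(1) H K ij h(2)[OF ij] k(2)[OF ij(2,1,4,3)]]
        HK[OF vector_bundle_chart_subset[OF E ij(1,3)]] by simp
    then show "vb_iso E F" unfolding vb_iso_def using h(1) k(1) by blast
  qed
qed

lemma vb_iso_sym: "vb_iso E F \<Longrightarrow> vb_iso F E"
  unfolding vb_iso_def by (metis Int_commute)

text \<open>Chart matrices of the two isomorphisms meet only over the cover of \<open>F\<close>; in
  frames they are multiplied pointwise and that cover is no longer visible.\<close>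

lemma vb_iso_trans:
  assumes E: "vector_bundle E" and F: "vector_bundle F" and G: "vector_bundle G"
    and EF: "vb_iso E F" and FG: "vb_iso F G"
  shows "vb_iso E G"
proof -
  obtain \<Phi> \<Psi> \<Theta> where fr: "vb_frame E \<Phi>" "vb_frame F \<Psi>" "vb_frame G \<Theta>"
    using vb_frame_exists[OF E] vb_frame_exists[OF F] vb_frame_exists[OF G] by metis
  obtain H K where H: "framed_map E \<Phi> F \<Psi> H" "framed_map F \<Psi> E \<Phi> K"
    "\<And>x. x \<in> vb_base E \<Longrightarrow> K x * H x = 1\<^sub>m (vb_rank E) \<and> H x * K x = 1\<^sub>m (vb_rank F)"
    using EF unfolding vb_iso_framed_iff[OF E F fr(1,2)] by blast
  obtain H' K' where H': "framed_map F \<Psi> G \<Theta> H'" "framed_map G \<Theta> F \<Psi> K'"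
    "\<And>x. x \<in> vb_base F \<Longrightarrow> K' x * H' x = 1\<^sub>m (vb_rank F) \<and> H' x * K' x = 1\<^sub>m (vb_rank G)"
    using FG unfolding vb_iso_framed_iff[OF F G fr(2,3)] by blast
  have base: "vb_base F = vb_base E" "vb_base G = vb_base E" using framed_map_base[OF H(1)] framed_map_base[OF H'(1)] by auto
  have "(K x * K' x) * (H' x * H x) = 1\<^sub>m (vb_rank E) \<and> (H' x * H x) * (K x * K' x) = 1\<^sub>m (vb_rank G)"
    if x: "x \<in> vb_base E" for x
  proof -
    let ?e = "vb_rank E" and ?f = "vb_rank F" and ?g = "vb_rank G"
    have c: "H x \<in> carrier_mat ?f ?e" "K x \<in> carrier_mat ?e ?f" "H' x \<in> carrier_mat ?g ?f" "K' x \<in> carrier_mat ?f ?g"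
      using framed_map_carrier[OF H(1)] framed_map_carrier[OF H(2)] framed_map_carrier[OF H'(1)]
        framed_map_carrier[OF H'(2)] x base by auto
    have "(K x * K' x) * (H' x * H x) = K x * (K' x * H' x * H x)"
      using c by (simp add: assoc_mult_mat[of _ ?e ?f _ ?g _ ?e] assoc_mult_mat[of _ ?f ?g _ ?f _ ?e])
    moreover have "(H' x * H x) * (K x * K' x) = H' x * (H x * K x * K' x)"
      using c by (simp add: assoc_mult_mat[of _ ?g ?f _ ?e _ ?g] assoc_mult_mat[of _ ?f ?e _ ?f _ ?g])
    ultimately show ?thesis using H(3) H'(3) x base c by simp
  qed
  then show ?thesis
    unfolding vb_iso_framed_iff[OF E G fr(1,3)]
    using framed_map_comp[OF E F G fr H(1) H'(1)] framed_map_comp[OF G F E fr(3,2,1) H'(2) H(2)] by blast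
qed

text \<open>Between two charts of the same bundle the identity morphism is the transition
  matrix.\<close>

lemma vb_iso_refl:
  assumes E: "vector_bundle E" shows "vb_iso E E"
proof -
  have "vb_morphism E E (trans E)"
    unfolding vb_morphism_def
  proof (intro conjI ballI)
    fix i i' j j' x assume *: "i \<in> vb_idx E" "i' \<in> vb_idx E" "j \<in> vb_idx E" "j' \<in> vb_idx E"
      "x \<in> chart E i \<inter> chart E i' \<inter> chart E j \<inter> chart E j'"
    then show "trans E j' i' x = trans E j' j x * trans E j i x * trans E i i' x"
      using vector_bundle_cocycle[OF E] by simp
  next
    fix i j assume "i \<in> vb_idx E" "j \<in> vb_idx E"
    then show "regular_mat_on (chart E i \<inter> chart E j) (vb_rank E) (vb_rank E) (trans E j i)"
      using vector_bundle_trans_regular[OF E] by (metis Int_commute)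
  qed simp
  then show ?thesis
    unfolding vb_iso_def using E
    by (intro exI[of _ "trans E"]) (auto simp: vector_bundle_cocycle vector_bundle_trans_self)
qed

subsection \<open>Cokernels\<close>

lemma mat_eq_vecI:
  assumes A: "A \<in> carrier_mat m n" and B: "B \<in> carrier_mat m n"
    and eq: "\<And>v. v \<in> carrier_vec n \<Longrightarrow> A *\<^sub>v v = B *\<^sub>v v"
  shows "A = (B :: complex mat)"
proof (rule eq_matI)
  fix i j assume ij: "i < dim_row B" "j < dim_col B"
  have "(A *\<^sub>v unit_vec n j) $ i = (B *\<^sub>v unit_vec n j) $ i"
    using eq[of "unit_vec n j"] by simp
  then show "A $$ (i, j) = B $$ (i, j)"
    using A B ij by (auto simp: scalar_prod_right_unit)
qed (use A B in auto)

text \<open>\<open>S *\<^sub>v (G *\<^sub>v v) - v\<close> is killed by \<open>G\<close>, because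
  \<open>G * S = 1\<^sub>m c\<close>, hence by \<open>K\<close>.\<close>

lemma kernel_factor:
  assumes G: "G \<in> carrier_mat c b" and S: "S \<in> carrier_mat b c" and K: "K \<in> carrier_mat d b"
    and GS: "G * S = 1\<^sub>m c"
    and ker: "\<And>w. w \<in> carrier_vec b \<Longrightarrow> G *\<^sub>v w = 0\<^sub>v c \<Longrightarrow> K *\<^sub>v w = 0\<^sub>v d"
  shows "K * S * G = (K :: complex mat)"
proof (rule mat_eq_vecI[of _ d b])
  fix v :: "complex vec" assume v: "v \<in> carrier_vec b"
  define w where "w = S *\<^sub>v (G *\<^sub>v v) - v"
  have w: "w \<in> carrier_vec b" unfolding w_def using v G S by auto
  have Gv: "G *\<^sub>v v \<in> carrier_vec c" and SGv: "S *\<^sub>v (G *\<^sub>v v) \<in> carrier_vec b" using G S v by auto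
  have "G *\<^sub>v w = G *\<^sub>v (S *\<^sub>v (G *\<^sub>v v)) - G *\<^sub>v v"
    unfolding w_def by (rule mult_minus_distrib_mat_vec[OF G SGv v])
  also have "G *\<^sub>v (S *\<^sub>v (G *\<^sub>v v)) = G *\<^sub>v v"
    using assoc_mult_mat_vec[OF G S Gv] GS Gv by simp
  finally have "G *\<^sub>v w = 0\<^sub>v c" using Gv by simp
  then have "0\<^sub>v d = K *\<^sub>v w" using ker w by simp
  also have "\<dots> = K *\<^sub>v (S *\<^sub>v (G *\<^sub>v v)) - K *\<^sub>v v"
    unfolding w_def by (rule mult_minus_distrib_mat_vec[OF K SGv v])
  finally have 0: "K *\<^sub>v (S *\<^sub>v (G *\<^sub>v v)) - K *\<^sub>v v = 0\<^sub>v d" ..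
  have "K *\<^sub>v (S *\<^sub>v (G *\<^sub>v v)) = K *\<^sub>v v"
  proof (rule eq_vecI)
    fix i assume i: "i < dim_vec (K *\<^sub>v v)"
    from arg_cong[OF 0, of "\<lambda>u. u $ i"]
    show "(K *\<^sub>v (S *\<^sub>v (G *\<^sub>v v))) $ i = (K *\<^sub>v v) $ i" using i K by simp
  qed (use K in auto)
  then show "K * S * G *\<^sub>v v = K *\<^sub>v v"
    using assoc_mult_mat_vec[of "K * S" d c G b v] assoc_mult_mat_vec[OF K S Gv] K S G v by simp
qed (use assms in auto)

text \<open>Near a point a surjective morphism \<open>B \<rightarrow> C\<close> has the right inverse
  \<open>S\<^sub>0 (g S\<^sub>0)\<^sup>-\<^sup>1\<close> with a constant matrix \<open>S\<^sub>0\<close>, hence a factorisation through it is regular.\<close>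

lemma framed_map_factor:
  assumes B: "vector_bundle B" and C: "vector_bundle C" and D: "vector_bundle D"
    and \<Phi>: "vb_frame B \<Phi>" and \<Psi>: "vb_frame C \<Psi>" and \<Theta>: "vb_frame D \<Theta>"
    and G: "framed_map B \<Phi> C \<Psi> G" and K: "framed_map B \<Phi> D \<Theta> K"
    and surj: "\<And>x. x \<in> vb_base B \<Longrightarrow> \<exists>S\<in>carrier_mat (vb_rank B) (vb_rank C). G x * S = 1\<^sub>m (vb_rank C)"
    and M: "\<And>x. x \<in> vb_base B \<Longrightarrow> M x \<in> carrier_mat (vb_rank D) (vb_rank C)"
      "\<And>x. x \<in> vb_base B \<Longrightarrow> M x * G x = K x"
  shows "framed_map C \<Psi> D \<Theta> M"
proof (rule framed_mapI)
  let ?b = "vb_rank B" and ?c = "vb_rank C" and ?d = "vb_rank D"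
  have base: "vb_base C = vb_base B" "vb_base D = vb_base B"
    using framed_map_base[OF G] framed_map_base[OF K] by auto
  then show "vb_base C = vb_base D" by simp
  fix x assume "x \<in> vb_base C"
  then have x: "x \<in> vb_base B" using base by simp
  show "M x \<in> carrier_mat ?d ?c" using M x by simp
  obtain g where g: "vb_morphism B C g" and gG: "\<And>i j x. i \<in> vb_idx B \<Longrightarrow> j \<in> vb_idx C \<Longrightarrow>
      x \<in> chart B i \<Longrightarrow> x \<in> chart C j \<Longrightarrow> \<Psi> j x * g j i x = G x * \<Phi> i x"
    using framed_map_morphism[OF B C \<Phi> \<Psi> G] by blast
  obtain k where k: "vb_morphism B D k" and kK: "\<And>i j x. i \<in> vb_idx B \<Longrightarrow> j \<in> vb_idx D \<Longrightarrow>
      x \<in> chart B i \<Longrightarrow> x \<in> chart D j \<Longrightarrow> \<Theta> j x * k j i x = K x * \<Phi> i x"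
    using framed_map_morphism[OF B D \<Phi> \<Theta> K] by blast
  obtain i where i: "i \<in> vb_idx B" "x \<in> chart B i" using vector_bundle_cover[OF B x] .
  obtain j where j: "j \<in> vb_idx C" "x \<in> chart C j" using vector_bundle_cover[OF C] x base by metis
  obtain l where l: "l \<in> vb_idx D" "x \<in> chart D l" using vector_bundle_cover[OF D] x base by metis
  obtain W where W: "zariski_open W" "chart B i = vb_base B \<inter> W"
    using vector_bundle_chart[OF B i(1)] .
  obtain S where S: "S \<in> carrier_mat ?b ?c" "G x * S = 1\<^sub>m ?c" using surj x by blast
  \<comment> \<open>A right inverse of \<open>g j i\<close> at the single point \<open>x\<close>,
    read in charts. Frozen as a constant matrix it is regular, whereas the right inverses given at
    the individual points need not fit together.\<close>
  define S0 where "S0 = minv ?b (\<Phi> i x) * (S * \<Psi> j x)"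
  have carr: "g j i y \<in> carrier_mat ?c ?b" "k l i y \<in> carrier_mat ?d ?b" "\<Psi> j y \<in> carrier_mat ?c ?c"
      "\<Phi> i y \<in> carrier_mat ?b ?b" "\<Theta> l y \<in> carrier_mat ?d ?d" "G y \<in> carrier_mat ?c ?b" "K y \<in> carrier_mat ?d ?b"
      "M y \<in> carrier_mat ?d ?c" "y \<in> vb_base B"
    if "y \<in> chart B i" "y \<in> chart C j" "y \<in> chart D l" for y
    using that vb_morphism_carrier[OF g i(1) j(1)] vb_morphism_carrier[OF k i(1) l(1)]
      invm_carrier[OF vb_frame_invm[OF \<Psi> j(1)]] invm_carrier[OF vb_frame_invm[OF \<Phi> i(1)]]
      invm_carrier[OF vb_frame_invm[OF \<Theta> l(1)]] vector_bundle_chart_subset[OF B i(1)] M(1)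
      framed_map_carrier[OF G] framed_map_carrier[OF K] by auto
  note cx = carr[OF i(2) j(2) l(2)]
  have S0: "S0 \<in> carrier_mat ?b ?c"
    unfolding S0_def using minv_carrier[OF vb_frame_invm[OF \<Phi> i]] S cx by auto
  have \<Phi>S0: "\<Phi> i x * S0 = S * \<Psi> j x"
    unfolding S0_def by (rule minv_cancel_left(2)[OF vb_frame_invm[OF \<Phi> i]]) (use S cx in auto)
  have "g j i x * S0 = 1\<^sub>m ?c"
  proof (rule invm_left_cancel[OF vb_frame_invm[OF \<Psi> j]])
    have "\<Psi> j x * (g j i x * S0) = G x * \<Phi> i x * S0"
      using gG[OF i(1) j(1) i(2) j(2)] cx S0 by (metis assoc_mult_mat)
    also have "\<dots> = G x * (S * \<Psi> j x)" using cx S0 S \<Phi>S0 by simp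
    also have "\<dots> = G x * S * \<Psi> j x" using cx S by (metis assoc_mult_mat)
    finally show "\<Psi> j x * (g j i x * S0) = \<Psi> j x * 1\<^sub>m ?c" using S cx by simp
  qed (use cx S0 in auto)
  then have detx: "det (g j i x * S0) \<noteq> 0"
    by simp
  let ?T = "chart B i \<inter> chart C j \<inter> chart D l"
  have reg: "regular_mat_on ?T ?c ?c (\<lambda>y. g j i y * S0)"
    by (rule regular_mat_on_mult[OF regular_mat_on_subset[OF vb_morphism_regular[OF g i(1) j(1)]] regular_mat_on_const[OF S0]])
      auto
  obtain V where V: "zariski_open V" "x \<in> V" "\<And>y. y \<in> ?T \<inter> V \<Longrightarrow> det (g j i y * S0) \<noteq> 0"
    using regular_on_nonzero_nbhd[OF regular_on_det[OF reg], of x] detx i j l by blast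
  have reg_V: "regular_mat_on (?T \<inter> V) ?c ?c (\<lambda>y. g j i y * S0)"
    by (rule regular_mat_on_subset[OF reg]) auto
  obtain R where R: "regular_mat_on (?T \<inter> V) ?c ?c R" "\<And>y. y \<in> ?T \<inter> V \<Longrightarrow> g j i y * S0 * R y = 1\<^sub>m ?c"
    "\<And>y. y \<in> ?T \<inter> V \<Longrightarrow> R y * (g j i y * S0) = 1\<^sub>m ?c"
    by (rule regular_mat_on_inverse[OF reg_V V(3)]) (assumption, erule that, simp_all)
  \<comment> \<open>The test for \<open>M\<close> may mention only charts of \<open>C\<close> and
    \<open>D\<close>, so the chart \<open>i\<close> of \<open>B\<close> is traded for the open set
    \<open>W\<close> that defines it.\<close>
  let ?Q = "chart C j \<inter> chart D l \<inter> (V \<inter> W)"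
  have Q: "?Q \<subseteq> ?T \<inter> V" using W vector_bundle_chart_subset[OF C j(1)] base by auto
  let ?N = "\<lambda>y. k l i y * (S0 * R y)"
  have "regular_mat_on ?Q ?d ?c ?N"
    by (rule regular_mat_on_mult[OF regular_mat_on_subset[OF vb_morphism_regular[OF k i(1) l(1)]]
          regular_mat_on_mult[OF regular_mat_on_const[OF S0] regular_mat_on_subset[OF R(1) Q]]]) (use Q in auto)
  moreover have "\<Theta> l y * ?N y = M y * \<Psi> j y" if y: "y \<in> ?Q" for y
  proof -
    have yT: "y \<in> chart B i" "y \<in> chart C j" "y \<in> chart D l" "y \<in> ?T \<inter> V" using y Q by auto
    note c = carr[OF yT(1-3)]
    have Ry: "R y \<in> carrier_mat ?c ?c" using regular_mat_on_carrier[OF R(1) yT(4)] .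
    have SR: "S0 * R y \<in> carrier_mat ?b ?c" using S0 Ry by simp
    have "\<Theta> l y * ?N y = \<Theta> l y * k l i y * (S0 * R y)"
      by (rule assoc_mult_mat[OF c(5) c(2) SR, symmetric])
    also have "\<dots> = M y * G y * \<Phi> i y * (S0 * R y)"
      using kK[OF i(1) l(1) yT(1,3)] M(2)[OF c(9)] by simp
    also have "M y * G y * \<Phi> i y = M y * (\<Psi> j y * g j i y)"
      using gG[OF i(1) j(1) yT(1,2)] c by simp
    also have "\<dots> * (S0 * R y) = M y * (\<Psi> j y * (g j i y * S0 * R y))"
      using c S0 Ry SR by (simp add: assoc_mult_mat[of _ ?d ?c _ ?b _ ?c] assoc_mult_mat[of _ ?c ?c _ ?b _ ?c]
          assoc_mult_mat[of _ ?c ?b _ ?c _ ?c])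
    also have "\<dots> = M y * \<Psi> j y" using R(2)[OF yT(4)] c by simp
    finally show ?thesis .
  qed
  ultimately show "framed_at C \<Psi> D \<Theta> M x"
    using V W i j l by (intro framed_atI[where i = j and j = l and U = "V \<inter> W" and N = ?N])
      (auto intro!: zariski_open_Int)
qed

text \<open>With pointwise right inverses \<open>S\<close> of \<open>G\<close> and \<open>T\<close>
  of \<open>K\<close>, equality of the kernels makes \<open>K * S\<close> and \<open>G * T\<close>
  inverse to each other. They are the factorisations of \<open>K\<close> through \<open>G\<close>
  and of \<open>G\<close> through \<open>K\<close>, so they are regular although \<open>S\<close>
  and \<open>T\<close> are chosen arbitrarily.\<close>

lemma framed_cokernel_iso:
  assumes B: "vector_bundle B" and C: "vector_bundle C" and D: "vector_bundle D"
    and \<Phi>: "vb_frame B \<Phi>" and \<Psi>: "vb_frame C \<Psi>" and \<Theta>: "vb_frame D \<Theta>"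
    and G: "framed_map B \<Phi> C \<Psi> G" and K: "framed_map B \<Phi> D \<Theta> K"
    and surjG: "\<And>x. x \<in> vb_base B \<Longrightarrow> \<exists>S\<in>carrier_mat (vb_rank B) (vb_rank C). G x * S = 1\<^sub>m (vb_rank C)"
    and surjK: "\<And>x. x \<in> vb_base B \<Longrightarrow> \<exists>S\<in>carrier_mat (vb_rank B) (vb_rank D). K x * S = 1\<^sub>m (vb_rank D)"
    and ker: "\<And>x w. x \<in> vb_base B \<Longrightarrow> w \<in> carrier_vec (vb_rank B) \<Longrightarrow>
       G x *\<^sub>v w = 0\<^sub>v (vb_rank C) \<longleftrightarrow> K x *\<^sub>v w = 0\<^sub>v (vb_rank D)"
  shows "vb_iso C D"
proof -
  let ?b = "vb_rank B" and ?c = "vb_rank C" and ?d = "vb_rank D"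
  have base: "vb_base C = vb_base B" "vb_base D = vb_base B"
    using framed_map_base[OF G] framed_map_base[OF K] by auto
  obtain S where S: "\<And>x. x \<in> vb_base B \<Longrightarrow> S x \<in> carrier_mat ?b ?c \<and> G x * S x = 1\<^sub>m ?c"
    using surjG by metis
  obtain T where T: "\<And>x. x \<in> vb_base B \<Longrightarrow> T x \<in> carrier_mat ?b ?d \<and> K x * T x = 1\<^sub>m ?d"
    using surjK by metis
  have GK: "G x \<in> carrier_mat ?c ?b" "K x \<in> carrier_mat ?d ?b" if "x \<in> vb_base B" for x
    using framed_map_carrier[OF G that] framed_map_carrier[OF K that] by auto
  have KSG: "K x * S x * G x = K x" if x: "x \<in> vb_base B" for x
    by (rule kernel_factor[of _ ?c ?b _ _ ?d]) (use GK[OF x] S[OF x] ker[OF x] in auto)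
  have GTK: "G x * T x * K x = G x" if x: "x \<in> vb_base B" for x
    by (rule kernel_factor[of _ ?d ?b _ _ ?c]) (use GK[OF x] T[OF x] ker[OF x] in auto)
  have c': "K x * S x \<in> carrier_mat ?d ?c" "G x * T x \<in> carrier_mat ?c ?d" if x: "x \<in> vb_base B" for x
    using mult_carrier_mat[OF GK(2)[OF x] conjunct1[OF S[OF x]]] mult_carrier_mat[OF GK(1)[OF x] conjunct1[OF T[OF x]]] .
  have M: "framed_map C \<Psi> D \<Theta> (\<lambda>x. K x * S x)"
    by (rule framed_map_factor[OF B C D \<Phi> \<Psi> \<Theta> G K surjG c'(1) KSG])
  have M': "framed_map D \<Theta> C \<Psi> (\<lambda>x. G x * T x)"
    by (rule framed_map_factor[OF B D C \<Phi> \<Theta> \<Psi> K G surjK c'(2) GTK])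
  have "(G x * T x) * (K x * S x) = 1\<^sub>m ?c \<and> (K x * S x) * (G x * T x) = 1\<^sub>m ?d" if x: "x \<in> vb_base B" for x
  proof -
    have c: "G x \<in> carrier_mat ?c ?b" "K x \<in> carrier_mat ?d ?b" "S x \<in> carrier_mat ?b ?c" "T x \<in> carrier_mat ?b ?d"
      using GK[OF x] S[OF x] T[OF x] by auto
    have "(G x * T x) * (K x * S x) = G x * T x * K x * S x"
      by (rule assoc_mult_mat[OF c'(2)[OF x] c(2,3), symmetric])
    moreover have "(K x * S x) * (G x * T x) = K x * S x * G x * T x"
      by (rule assoc_mult_mat[OF c'(1)[OF x] c(1,4), symmetric])
    ultimately show ?thesis using GTK[OF x] KSG[OF x] S[OF x] T[OF x] by simp
  qed
  then show ?thesis
    unfolding vb_iso_framed_iff[OF C D \<Psi> \<Theta>] using M M' base by auto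
qed

subsection \<open>Restriction and pullback along the torus action\<close>

lemma vb_restrict_simps [simp]:
  "vb_base (vb_restrict E Z) = vb_base E \<inter> Z" "vb_rank (vb_restrict E Z) = vb_rank E"
  "vb_idx (vb_restrict E Z) = vb_idx E" "chart (vb_restrict E Z) i = chart E i \<inter> Z"
  "trans (vb_restrict E Z) = trans E"
  unfolding vb_restrict_def by simp_all

lemma vector_bundle_restrict:
  assumes E: "vector_bundle E" shows "vector_bundle (vb_restrict E Z)"
  unfolding vector_bundle_def vb_restrict_simps
proof (intro conjI ballI)
  fix i assume "i \<in> vb_idx E"
  then obtain W where "zariski_open W" "chart E i = vb_base E \<inter> W" using vector_bundle_chart[OF E] by metis
  then show "\<exists>W. zariski_open W \<and> chart E i \<inter> Z = vb_base E \<inter> Z \<inter> W" by (intro exI[of _ W]) auto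
next
  show "vb_base E \<inter> Z = (\<Union>i\<in>vb_idx E. chart E i \<inter> Z)"
    using E unfolding vector_bundle_def by auto
next
  fix i j assume "i \<in> vb_idx E" "j \<in> vb_idx E"
  then show "regular_mat_on (chart E i \<inter> Z \<inter> (chart E j \<inter> Z)) (vb_rank E) (vb_rank E) (trans E i j)"
    by (rule regular_mat_on_subset[OF vector_bundle_trans_regular[OF E]]) auto
qed (use E in \<open>auto simp: vector_bundle_trans_self vector_bundle_cocycle\<close>)

lemma vb_morphism_restrict:
  assumes h: "vb_morphism E F h" shows "vb_morphism (vb_restrict E Z) (vb_restrict F Z) h"
  unfolding vb_morphism_def vb_restrict_simps
proof (intro conjI ballI)
  show "vb_base E \<inter> Z = vb_base F \<inter> Z" using h unfolding vb_morphism_def by simp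
  fix i j assume ij: "i \<in> vb_idx E" "j \<in> vb_idx F"
  show "regular_mat_on (chart E i \<inter> Z \<inter> (chart F j \<inter> Z)) (vb_rank F) (vb_rank E) (h j i)"
    by (rule regular_mat_on_subset[OF vb_morphism_regular[OF h ij]]) auto
qed (use vb_morphism_compat[OF h] in blast)

lemma vb_iso_restrict: "vb_iso E F \<Longrightarrow> vb_iso (vb_restrict E Z) (vb_restrict F Z)"
  unfolding vb_iso_def by (elim exE conjE, intro exI conjI) (auto intro: vb_morphism_restrict)

lemma vb_frame_restrict: "vb_frame E \<Phi> \<Longrightarrow> vb_frame (vb_restrict E Z) \<Phi>"
  unfolding vb_frame_def by auto

lemma framed_map_restrict:
  assumes H: "framed_map E \<Phi> F \<Psi> H"
  shows "framed_map (vb_restrict E Z) \<Phi> (vb_restrict F Z) \<Psi> H"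
proof (rule framed_mapI, unfold vb_restrict_simps)
  show "vb_base E \<inter> Z = vb_base F \<inter> Z" using framed_map_base[OF H] by simp
  fix x assume x: "x \<in> vb_base E \<inter> Z"
  then show "H x \<in> carrier_mat (vb_rank F) (vb_rank E)" using framed_map_carrier[OF H] by simp
  obtain i j U N where *: "i \<in> vb_idx E" "j \<in> vb_idx F" "zariski_open U" "x \<in> U" "x \<in> chart E i" "x \<in> chart F j"
    "regular_mat_on (chart E i \<inter> chart F j \<inter> U) (vb_rank F) (vb_rank E) N"
    "\<forall>y\<in>chart E i \<inter> chart F j \<inter> U. \<Psi> j y * N y = H y * \<Phi> i y"
    using framed_mapE[OF H, of x] x by blast
  moreover have "regular_mat_on (chart E i \<inter> Z \<inter> (chart F j \<inter> Z) \<inter> U) (vb_rank F) (vb_rank E) N"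
    by (rule regular_mat_on_subset[OF *(7)]) auto
  ultimately show "framed_at (vb_restrict E Z) \<Phi> (vb_restrict F Z) \<Psi> H x"
    using x by (intro framed_atI[where i = i and j = j and U = U and N = N]) auto
qed

lemma vb_pullback_simps [simp]:
  "vb_base (vb_pullback f E) = f -` vb_base E" "vb_rank (vb_pullback f E) = vb_rank E"
  "vb_idx (vb_pullback f E) = vb_idx E" "chart (vb_pullback f E) i = f -` chart E i"
  "trans (vb_pullback f E) i j x = trans E i j (f x)"
  unfolding vb_pullback_def by simp_all

lemma vector_bundle_pullback:
  assumes t: "t \<in> torus" and E: "vector_bundle E"
  shows "vector_bundle (vb_pullback (torus_act t) E)"
  unfolding vector_bundle_def vb_pullback_simps
proof (intro conjI ballI)
  fix i assume "i \<in> vb_idx E"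
  then obtain W where "zariski_open W" "chart E i = vb_base E \<inter> W" using vector_bundle_chart[OF E] by metis
  then show "\<exists>W. zariski_open W \<and> torus_act t -` chart E i = torus_act t -` vb_base E \<inter> W"
    using zariski_open_torus[OF t] by (intro exI[of _ "torus_act t -` W"]) auto
next
  show "torus_act t -` vb_base E = (\<Union>i\<in>vb_idx E. torus_act t -` chart E i)"
    using E unfolding vector_bundle_def by auto
next
  fix i j assume ij: "i \<in> vb_idx E" "j \<in> vb_idx E"
  show "regular_mat_on (torus_act t -` chart E i \<inter> torus_act t -` chart E j) (vb_rank E) (vb_rank E)
      (\<lambda>x. trans E i j (torus_act t x))"
    using regular_mat_on_torus[OF t vector_bundle_trans_regular[OF E ij]] by simp
qed (use E in \<open>auto simp: vector_bundle_trans_self vector_bundle_cocycle\<close>)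

lemma vb_frame_pullback:
  "vb_frame E \<Phi> \<Longrightarrow> vb_frame (vb_pullback f E) (\<lambda>i x. \<Phi> i (f x))"
  unfolding vb_frame_def by auto

lemma framed_map_pullback:
  assumes t: "t \<in> torus" and H: "framed_map E \<Phi> F \<Psi> H"
    and \<tau>_def: "\<tau> = torus_act t"
  shows "framed_map (vb_pullback \<tau> E) (\<lambda>i x. \<Phi> i (\<tau> x)) (vb_pullback \<tau> F) (\<lambda>i x. \<Psi> i (\<tau> x)) (\<lambda>x. H (\<tau> x))"
proof (rule framed_mapI, unfold vb_pullback_simps)
  show "\<tau> -` vb_base E = \<tau> -` vb_base F" using framed_map_base[OF H] by simp
  fix x assume x: "x \<in> \<tau> -` vb_base E"
  then show "H (\<tau> x) \<in> carrier_mat (vb_rank F) (vb_rank E)" using framed_map_carrier[OF H] by simp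
  obtain i j U N where *: "i \<in> vb_idx E" "j \<in> vb_idx F" "zariski_open U" "\<tau> x \<in> U" "\<tau> x \<in> chart E i" "\<tau> x \<in> chart F j"
    "regular_mat_on (chart E i \<inter> chart F j \<inter> U) (vb_rank F) (vb_rank E) N"
    "\<forall>y\<in>chart E i \<inter> chart F j \<inter> U. \<Psi> j y * N y = H y * \<Phi> i y"
    using framed_mapE[OF H, of "\<tau> x"] x by blast
  then have "regular_mat_on (\<tau> -` chart E i \<inter> \<tau> -` chart F j \<inter> \<tau> -` U) (vb_rank F) (vb_rank E) (\<lambda>x. N (\<tau> x))"
    using regular_mat_on_torus[OF t *(7)] unfolding \<tau>_def by simp
  moreover have "zariski_open (\<tau> -` U)" using zariski_open_torus[OF t] * unfolding \<tau>_def by blast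
  ultimately show "framed_at (vb_pullback \<tau> E) (\<lambda>i x. \<Phi> i (\<tau> x)) (vb_pullback \<tau> F) (\<lambda>i x. \<Psi> i (\<tau> x)) (\<lambda>x. H (\<tau> x)) x"
    using * by (intro framed_atI[where i = i and j = j and U = "\<tau> -` U" and N = "\<lambda>x. N (\<tau> x)"]) auto
qed

subsection \<open>Direct sums and twists by line bundles\<close>

abbreviation left_idx :: "nat \<Rightarrow> nat" where "left_idx i \<equiv> fst (prod_decode i)"
abbreviation right_idx :: "nat \<Rightarrow> nat" where "right_idx i \<equiv> snd (prod_decode i)"

lemma prod_idx_iff: "i \<in> prod_encode ` (A \<times> B) \<longleftrightarrow> left_idx i \<in> A \<and> right_idx i \<in> B"
proof
  assume "left_idx i \<in> A \<and> right_idx i \<in> B"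
  then have "prod_decode i \<in> A \<times> B" by (simp add: mem_Times_iff)
  then show "i \<in> prod_encode ` (A \<times> B)" by (metis image_eqI prod_decode_inverse)
qed auto

text \<open>The common pattern of \<open>\<oplus>\<close> and \<open>\<otimes>\<close>: \<open>mop\<close> is a bifunctor on matrices, where \<open>mop m n m' n' A B\<close>
  combines an \<open>m \<times> n\<close> matrix \<open>A\<close> and an \<open>m' \<times> n'\<close> matrix \<open>B\<close>. The predicate \<open>ok\<close> restricts
  the rank of the second factor.\<close>

locale vb_bifunctor =
  fixes op :: "vbundle \<Rightarrow> vbundle \<Rightarrow> vbundle" and rk :: "nat \<Rightarrow> nat \<Rightarrow> nat"
    and mop :: "nat \<Rightarrow> nat \<Rightarrow> nat \<Rightarrow> nat \<Rightarrow> complex mat \<Rightarrow> complex mat \<Rightarrow> complex mat"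
    and ok :: "nat \<Rightarrow> bool"
  assumes simps: "vb_base (op E F) = vb_base E \<inter> vb_base F" "vb_rank (op E F) = rk (vb_rank E) (vb_rank F)"
      "vb_idx (op E F) = prod_encode ` (vb_idx E \<times> vb_idx F)"
      "chart (op E F) i = chart E (left_idx i) \<inter> chart F (right_idx i)"
      "trans (op E F) i j x = mop (vb_rank E) (vb_rank E) (vb_rank F) (vb_rank F)
         (trans E (left_idx i) (left_idx j) x) (trans F (right_idx i) (right_idx j) x)"
    and mop_regular: "ok m' \<Longrightarrow> ok n' \<Longrightarrow> regular_mat_on S m n P \<Longrightarrow> regular_mat_on S m' n' Q \<Longrightarrow>
      regular_mat_on S (rk m m') (rk n n') (\<lambda>x. mop m n m' n' (P x) (Q x))"
    and mop_mult: "ok m' \<Longrightarrow> ok n' \<Longrightarrow> ok k' \<Longrightarrow> A \<in> carrier_mat m n \<Longrightarrow> B \<in> carrier_mat n k \<Longrightarrow>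
      C \<in> carrier_mat m' n' \<Longrightarrow> D \<in> carrier_mat n' k' \<Longrightarrow>
      mop m n m' n' A C * mop n k n' k' B D = mop m k m' k' (A * B) (C * D)"
    and mop_one: "ok r' \<Longrightarrow> mop r r r' r' (1\<^sub>m r) (1\<^sub>m r') = 1\<^sub>m (rk r r')"
begin

lemma idx_iff: "i \<in> vb_idx (op E F) \<longleftrightarrow> left_idx i \<in> vb_idx E \<and> right_idx i \<in> vb_idx F"
  unfolding simps prod_idx_iff ..

lemma chart_iff: "x \<in> chart (op E F) i \<longleftrightarrow> x \<in> chart E (left_idx i) \<and> x \<in> chart F (right_idx i)"
  unfolding simps by simp

lemma vector_bundle:
  assumes E: "vector_bundle E" and F: "vector_bundle F" and ok: "ok (vb_rank F)"
  shows "vector_bundle (op E F)"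
  unfolding vector_bundle_def
proof (intro conjI ballI)
  fix i assume "i \<in> vb_idx (op E F)"
  then obtain V W where "zariski_open V" "chart E (left_idx i) = vb_base E \<inter> V"
    "zariski_open W" "chart F (right_idx i) = vb_base F \<inter> W"
    unfolding idx_iff using vector_bundle_chart[OF E] vector_bundle_chart[OF F] by metis
  then show "\<exists>W. zariski_open W \<and> chart (op E F) i = vb_base (op E F) \<inter> W"
    unfolding simps by (intro exI[of _ "V \<inter> W"]) (auto intro: zariski_open_Int)
next
  show "vb_base (op E F) = (\<Union>i\<in>vb_idx (op E F). chart (op E F) i)"
    using E F unfolding vector_bundle_def simps by auto
next
  fix i j assume i: "i \<in> vb_idx (op E F)" and j: "j \<in> vb_idx (op E F)"
  show "regular_mat_on (chart (op E F) i \<inter> chart (op E F) j) (vb_rank (op E F)) (vb_rank (op E F)) (trans (op E F) i j)"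
    unfolding simps using i j
    by (intro mop_regular ok regular_mat_on_subset[OF vector_bundle_trans_regular[OF E]]
        regular_mat_on_subset[OF vector_bundle_trans_regular[OF F]]) (auto simp: idx_iff)
next
  fix i x assume "i \<in> vb_idx (op E F)" "x \<in> chart (op E F) i"
  then show "trans (op E F) i i x = 1\<^sub>m (vb_rank (op E F))"
    unfolding idx_iff chart_iff simps(2,5)
    by (simp add: vector_bundle_trans_self[OF E] vector_bundle_trans_self[OF F] mop_one[OF ok])
next
  fix i j k x assume "i \<in> vb_idx (op E F)" "j \<in> vb_idx (op E F)" "k \<in> vb_idx (op E F)"
    "x \<in> chart (op E F) i \<inter> chart (op E F) j \<inter> chart (op E F) k"
  then show "trans (op E F) i j x * trans (op E F) j k x = trans (op E F) i k x"
    unfolding idx_iff Int_iff chart_iff simps(5)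
    by (subst mop_mult[OF ok ok ok]) (auto simp: vector_bundle_cocycle[OF E] vector_bundle_cocycle[OF F]
        intro: vector_bundle_trans_carrier[OF E] vector_bundle_trans_carrier[OF F])
qed

lemma morphism:
  assumes E: "vector_bundle E" and F: "vector_bundle F" and E': "vector_bundle E'" and F': "vector_bundle F'"
    and ok: "ok (vb_rank F)" "ok (vb_rank F')"
    and h: "vb_morphism E E' h" and k: "vb_morphism F F' k"
  shows "vb_morphism (op E F) (op E' F') (\<lambda>j i x. mop (vb_rank E') (vb_rank E) (vb_rank F') (vb_rank F)
    (h (left_idx j) (left_idx i) x) (k (right_idx j) (right_idx i) x))"
  unfolding vb_morphism_def
proof (intro conjI ballI)
  show "vb_base (op E F) = vb_base (op E' F')" using h k unfolding vb_morphism_def simps by simp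
next
  fix i j assume i: "i \<in> vb_idx (op E F)" and j: "j \<in> vb_idx (op E' F')"
  show "regular_mat_on (chart (op E F) i \<inter> chart (op E' F') j) (vb_rank (op E' F')) (vb_rank (op E F))
     (\<lambda>x. mop (vb_rank E') (vb_rank E) (vb_rank F') (vb_rank F)
        (h (left_idx j) (left_idx i) x) (k (right_idx j) (right_idx i) x))"
    unfolding simps using i j
    by (intro mop_regular ok regular_mat_on_subset[OF vb_morphism_regular[OF h]]
        regular_mat_on_subset[OF vb_morphism_regular[OF k]]) (auto simp: idx_iff)
next
  fix i i' j j' x
  assume *: "i \<in> vb_idx (op E F)" "i' \<in> vb_idx (op E F)" "j \<in> vb_idx (op E' F')" "j' \<in> vb_idx (op E' F')"
    "x \<in> chart (op E F) i \<inter> chart (op E F) i' \<inter> chart (op E' F') j \<inter> chart (op E' F') j'"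
  let ?A = "trans E' (left_idx j') (left_idx j) x" and ?A' = "trans F' (right_idx j') (right_idx j) x"
    and ?B = "h (left_idx j) (left_idx i) x" and ?B' = "k (right_idx j) (right_idx i) x"
    and ?C = "trans E (left_idx i) (left_idx i') x" and ?C' = "trans F (right_idx i) (right_idx i') x"
  have eq: "h (left_idx j') (left_idx i') x = ?A * ?B * ?C" "k (right_idx j') (right_idx i') x = ?A' * ?B' * ?C'"
    using * unfolding idx_iff Int_iff chart_iff
    by (auto intro: vb_morphism_compat[OF h] vb_morphism_compat[OF k])
  have c: "?A \<in> carrier_mat (vb_rank E') (vb_rank E')" "?B \<in> carrier_mat (vb_rank E') (vb_rank E)"
    "?A' \<in> carrier_mat (vb_rank F') (vb_rank F')" "?B' \<in> carrier_mat (vb_rank F') (vb_rank F)"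
    and c': "?C \<in> carrier_mat (vb_rank E) (vb_rank E)" "?C' \<in> carrier_mat (vb_rank F) (vb_rank F)"
    using * unfolding idx_iff Int_iff chart_iff
    by (auto intro: vector_bundle_trans_carrier[OF E'] vector_bundle_trans_carrier[OF F']
        vb_morphism_carrier[OF h] vb_morphism_carrier[OF k]
        vector_bundle_trans_carrier[OF E] vector_bundle_trans_carrier[OF F])
  show "mop (vb_rank E') (vb_rank E) (vb_rank F') (vb_rank F)
      (h (left_idx j') (left_idx i') x) (k (right_idx j') (right_idx i') x) =
     trans (op E' F') j' j x * mop (vb_rank E') (vb_rank E) (vb_rank F') (vb_rank F) ?B ?B' * trans (op E F) i i' x"
    unfolding simps(5) mop_mult[OF ok(2,2,1) c]
      mop_mult[OF ok(2,1,1) mult_carrier_mat[OF c(1,2)] c'(1) mult_carrier_mat[OF c(3,4)] c'(2)] eq ..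
qed

text \<open>The interchange law \<open>mop_mult\<close> combines two pairs of inverse matrices into
  one such pair.\<close>

lemma iso:
  assumes E: "vector_bundle E" and F: "vector_bundle F" and E': "vector_bundle E'" and F': "vector_bundle F'"
    and ok: "ok (vb_rank F)" "ok (vb_rank F')"
    and EE': "vb_iso E E'" and FF': "vb_iso F F'"
  shows "vb_iso (op E F) (op E' F')"
proof -
  obtain h h' where h: "vb_morphism E E' h" "vb_morphism E' E h'"
    "\<And>i j x. i \<in> vb_idx E \<Longrightarrow> j \<in> vb_idx E' \<Longrightarrow> x \<in> chart E i \<Longrightarrow> x \<in> chart E' j \<Longrightarrow>
        h' i j x * h j i x = 1\<^sub>m (vb_rank E) \<and> h j i x * h' i j x = 1\<^sub>m (vb_rank E')"
    using EE' unfolding vb_iso_def by blast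
  obtain k k' where k: "vb_morphism F F' k" "vb_morphism F' F k'"
    "\<And>i j x. i \<in> vb_idx F \<Longrightarrow> j \<in> vb_idx F' \<Longrightarrow> x \<in> chart F i \<Longrightarrow> x \<in> chart F' j \<Longrightarrow>
        k' i j x * k j i x = 1\<^sub>m (vb_rank F) \<and> k j i x * k' i j x = 1\<^sub>m (vb_rank F')"
    using FF' unfolding vb_iso_def by blast
  note carr = vb_morphism_carrier[OF h(1)] vb_morphism_carrier[OF h(2)]
    vb_morphism_carrier[OF k(1)] vb_morphism_carrier[OF k(2)]
  show ?thesis
    unfolding vb_iso_def
  proof (intro exI conjI ballI, rule morphism[OF E F E' F' ok h(1) k(1)],
      rule morphism[OF E' F' E F ok(2,1) h(2) k(2)], goal_cases)
    case (1 i j x)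
    then show ?case
      unfolding idx_iff Int_iff chart_iff simps(2)
      by (subst mop_mult[OF ok(1,2,1)]) (auto simp: h(3) k(3) mop_one[OF ok(1)] intro: carr)
  next
    case (2 i j x)
    then show ?case
      unfolding idx_iff Int_iff chart_iff simps(2)
      by (subst mop_mult[OF ok(2,1,2)]) (auto simp: h(3) k(3) mop_one[OF ok(2)] intro: carr)
  qed
qed

end

lemma vb_sum_simps:
  "vb_base (vb_sum E F) = vb_base E \<inter> vb_base F" "vb_rank (vb_sum E F) = vb_rank E + vb_rank F"
  "vb_idx (vb_sum E F) = prod_encode ` (vb_idx E \<times> vb_idx F)"
  "chart (vb_sum E F) i = chart E (left_idx i) \<inter> chart F (right_idx i)"
  "trans (vb_sum E F) i j x = four_block_mat
       (trans E (left_idx i) (left_idx j) x) (0\<^sub>m (vb_rank E) (vb_rank F))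
       (0\<^sub>m (vb_rank F) (vb_rank E)) (trans F (right_idx i) (right_idx j) x)"
  unfolding vb_sum_def vb_common_chart_def by simp_all

interpretation vb_sum: vb_bifunctor vb_sum "(+)"
  "\<lambda>m n m' n' A B. four_block_mat A (0\<^sub>m m n') (0\<^sub>m m' n) B" "\<lambda>_. True"
proof
  fix m n k m' n' k' and A B C D :: "complex mat"
  assume c: "A \<in> carrier_mat m n" "B \<in> carrier_mat n k" "C \<in> carrier_mat m' n'" "D \<in> carrier_mat n' k'"
  then have "A * B \<in> carrier_mat m k" "C * D \<in> carrier_mat m' k'" by auto
  then show "four_block_mat A (0\<^sub>m m n') (0\<^sub>m m' n) C * four_block_mat B (0\<^sub>m n k') (0\<^sub>m n' k) D =
      four_block_mat (A * B) (0\<^sub>m m k') (0\<^sub>m m' k) (C * D)"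
    using c by (subst mult_four_block_mat[of _ m n _ n' _ m' _ _ k _ k']) auto
qed (simp_all add: vb_sum_simps regular_mat_on_four_block_diag)

lemma kronecker_mat_line:
  assumes "B \<in> carrier_mat 1 1"
  shows "kronecker_mat A B = B $$ (0, 0) \<cdot>\<^sub>m A"
  using assms unfolding kronecker_mat_def by (intro eq_matI) auto

lemma vb_tensor_simps:
  "vb_base (vb_tensor E F) = vb_base E \<inter> vb_base F" "vb_rank (vb_tensor E F) = vb_rank E * vb_rank F"
  "vb_idx (vb_tensor E F) = prod_encode ` (vb_idx E \<times> vb_idx F)"
  "chart (vb_tensor E F) i = chart E (left_idx i) \<inter> chart F (right_idx i)"
  "trans (vb_tensor E F) i j x = kronecker_mat
       (trans E (left_idx i) (left_idx j) x) (trans F (right_idx i) (right_idx j) x)"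
  unfolding vb_tensor_def vb_common_chart_def by simp_all

lemma smult_mat_mult_smult:
  assumes "A \<in> carrier_mat m n" "B \<in> carrier_mat n k"
  shows "(a \<cdot>\<^sub>m A) * (b \<cdot>\<^sub>m B) = (a * b) \<cdot>\<^sub>m (A * (B :: complex mat))"
  using assms
  by (simp add: mult_smult_distrib[of _ m n] mult_smult_assoc_mat[of _ m n])
    (intro eq_matI, auto)

text \<open>The second factor is always a line bundle here. Its matrices are scalars, the Kronecker
  product is scalar multiplication, and the interchange law becomes commutation of scalars with
  matrices.\<close>

interpretation vb_twist: vb_bifunctor vb_tensor "(*)" "\<lambda>_ _ _ _. kronecker_mat" "\<lambda>r. r = 1"
proof
  fix m n k m' n' k' :: nat and A B C D :: "complex mat"
  assume "m' = 1" "n' = 1" "k' = 1" and c: "A \<in> carrier_mat m n" "B \<in> carrier_mat n k"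
    and "C \<in> carrier_mat m' n'" "D \<in> carrier_mat n' k'"
  then have CD: "C \<in> carrier_mat 1 1" "D \<in> carrier_mat 1 1" by simp_all
  then have "(C * D) $$ (0, 0) = C $$ (0, 0) * D $$ (0, 0)" by (simp add: scalar_prod_def)
  then show "kronecker_mat A C * kronecker_mat B D = kronecker_mat (A * B) (C * D)"
    unfolding kronecker_mat_line[OF CD(1)] kronecker_mat_line[OF CD(2)]
      kronecker_mat_line[OF mult_carrier_mat[OF CD]] smult_mat_mult_smult[OF c] by simp
next
  fix m n m' n' :: nat and S and A B :: "cp2 \<Rightarrow> complex mat"
  assume "m' = 1" "n' = 1" and A: "regular_mat_on S m n A" and "regular_mat_on S m' n' B"
  then have mn: "m' = 1" "n' = 1" and B: "regular_mat_on S 1 1 B" by simp_all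
  show "regular_mat_on S (m * m') (n * n') (\<lambda>x. kronecker_mat (A x) (B x))"
    unfolding mn mult_1_right
    by (rule regular_mat_on_cong[OF regular_mat_on_smult[OF regular_mat_on_entry[OF B, of 0 0] A]])
      (use kronecker_mat_line regular_mat_on_carrier[OF B] in auto)
next
  fix r r' :: nat assume "r' = 1"
  then show "kronecker_mat (1\<^sub>m r) (1\<^sub>m r') = 1\<^sub>m (r * r')"
    by (simp add: kronecker_mat_line) (intro eq_matI, auto)
qed (simp_all add: vb_tensor_simps)

subsection \<open>Sums of the line bundles \<open>O(k)\<close>\<close>

lemma O_bundle_simps [simp]:
  "vb_base (O_bundle k) = UNIV" "vb_rank (O_bundle k) = 1" "vb_idx (O_bundle k) = {..<3}"
  "chart (O_bundle k) i = {x. coords x $ i \<noteq> 0}"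
  "trans (O_bundle k) i j x = mat 1 1 (\<lambda>_. (coords x $ j / coords x $ i) powi k)"
  unfolding O_bundle_def by simp_all

lemma mat_1_1_mult: "mat 1 1 (\<lambda>_. a) * mat 1 1 (\<lambda>_. b) = mat 1 1 (\<lambda>_. a * b :: complex)"
  by (intro eq_matI) (auto simp: scalar_prod_def)

lemma vector_bundle_O: "vector_bundle (O_bundle k)"
  unfolding vector_bundle_def O_bundle_simps
proof (intro conjI ballI)
  show "UNIV = (\<Union>i\<in>{..<3}. {x. coords x $ i \<noteq> 0})"
  proof (intro equalityI subsetI UNIV_I)
    fix x show "x \<in> (\<Union>i\<in>{..<3}. {x. coords x $ i \<noteq> 0})"
      by (rule coords_nonzero_entry[of x]) auto
  qed
next
  fix i assume "i \<in> {..<3::nat}"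
  then show "\<exists>W. zariski_open W \<and> {x. coords x $ i \<noteq> 0} = UNIV \<inter> W"
    using zariski_open_coord by auto
next
  fix i j assume "i \<in> {..<3::nat}" "j \<in> {..<3::nat}"
  then show "regular_mat_on ({x. coords x $ i \<noteq> 0} \<inter> {x. coords x $ j \<noteq> 0}) 1 1
      (\<lambda>x. mat 1 1 (\<lambda>_. (coords x $ j / coords x $ i) powi k))"
    by (intro regular_mat_onI) (auto intro!: regular_on_powi regular_on_coord_ratio)
next
  fix i j l x assume "x \<in> {x. coords x $ i \<noteq> 0} \<inter> {x. coords x $ j \<noteq> 0} \<inter> {x. coords x $ l \<noteq> 0}"
  then show "mat 1 1 (\<lambda>_. (coords x $ j / coords x $ i) powi k) * mat 1 1 (\<lambda>_. (coords x $ l / coords x $ j) powi k) =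
      mat 1 1 (\<lambda>_. (coords x $ l / coords x $ i) powi k)"
    unfolding mat_1_1_mult by (simp flip: power_int_mult_distrib)
qed (auto intro!: eq_matI)

lemma vector_bundle_zero: "vector_bundle (vb_zero UNIV)"
  unfolding vector_bundle_def vb_zero_def
  by (auto intro!: zariski_open_UNIV regular_mat_onI)

lemma vector_bundle_sum_list:
  "(\<And>E. E \<in> set Es \<Longrightarrow> vector_bundle E) \<Longrightarrow> vector_bundle (vb_sum_list Es)"
  unfolding vb_sum_list_def by (induction Es) (auto intro: vector_bundle_zero vb_sum.vector_bundle)

definition O_sum :: "int list \<Rightarrow> vbundle" where
  "O_sum ks = vb_sum_list (map O_bundle ks)"

text \<open>A chart of a sum of line bundles encodes a list of charts of the summands; \<open>nth_chart l i\<close> is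
  its \<open>l\<close>-th entry and \<open>const_chart r m\<close> encodes \<open>m, \<dots>, m\<close> (\<open>r\<close> times).\<close>

primrec nth_chart :: "nat \<Rightarrow> nat \<Rightarrow> nat" where
  "nth_chart 0 i = left_idx i"
| "nth_chart (Suc l) i = nth_chart l (right_idx i)"

primrec const_chart :: "nat \<Rightarrow> nat \<Rightarrow> nat" where
  "const_chart 0 m = 0"
| "const_chart (Suc r) m = prod_encode (m, const_chart r m)"

lemma nth_chart_const [simp]: "l < r \<Longrightarrow> nth_chart l (const_chart r m) = m"
  by (induction r arbitrary: l) (auto simp: less_Suc_eq_0_disj)

lemma vector_bundle_O_sum: "vector_bundle (O_sum ks)"
  unfolding O_sum_def by (intro vector_bundle_sum_list) (auto intro: vector_bundle_O)

lemma O_sum_simps: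
  "O_sum [] = vb_zero UNIV" "O_sum (k # ks) = vb_sum (O_bundle k) (O_sum ks)"
  unfolding O_sum_def vb_sum_list_def by simp_all

lemma O_sum_base [simp]: "vb_base (O_sum ks) = UNIV"
  by (induction ks) (simp_all add: O_sum_simps vb_sum_simps vb_zero_def)

lemma O_sum_rank [simp]: "vb_rank (O_sum ks) = length ks"
  by (induction ks) (simp_all add: O_sum_simps vb_sum_simps vb_zero_def)

lemma O_sum_idx: "i \<in> vb_idx (O_sum ks) \<Longrightarrow> l < length ks \<Longrightarrow> nth_chart l i < 3"
  by (induction ks arbitrary: i l)
    (auto simp: O_sum_simps vb_sum_simps less_Suc_eq_0_disj)

lemma O_sum_idx_const: "m < 3 \<Longrightarrow> const_chart (length ks) m \<in> vb_idx (O_sum ks)"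
  by (induction ks) (simp_all add: O_sum_simps vb_sum_simps vb_zero_def)

lemma O_sum_chart: "x \<in> chart (O_sum ks) i \<longleftrightarrow> (\<forall>l<length ks. coords x $ nth_chart l i \<noteq> 0)"
  by (induction ks arbitrary: i)
    (auto simp: O_sum_simps vb_sum_simps vb_zero_def less_Suc_eq_0_disj)

lemma mat_diag_Suc:
  "mat_diag (Suc n) f = four_block_mat (mat 1 1 (\<lambda>_. f 0)) (0\<^sub>m 1 n) (0\<^sub>m n 1) (mat_diag n (\<lambda>l. f (Suc l)))"
  unfolding mat_diag_def by (intro eq_matI) auto

lemma O_sum_trans:
  "trans (O_sum ks) i j x =
    mat_diag (length ks) (\<lambda>l. (coords x $ nth_chart l j / coords x $ nth_chart l i) powi (ks ! l))"
proof (induction ks arbitrary: i j)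
  case Nil
  then show ?case by (simp add: O_sum_simps vb_zero_def mat_diag_def) (intro eq_matI, auto)
next
  case (Cons k ks)
  then show ?case by (simp add: O_sum_simps vb_sum_simps mat_diag_Suc)
qed

text \<open>In chart \<open>m\<close> a form \<open>F\<close> of degree \<open>k\<close> is the
  function \<open>F / u_m ^ k\<close>. Multiplying by \<open>u_m ^ k\<close> returns the value of
  \<open>F\<close> at the chosen representative \<open>coords x\<close>, so in this frame sections
  of sums of \<open>O(k)\<close> are plain vectors of forms.\<close>

definition O_frame :: "int list \<Rightarrow> nat \<Rightarrow> cp2 \<Rightarrow> complex mat" where
  "O_frame ks i x = mat_diag (length ks) (\<lambda>l. (coords x $ nth_chart l i) powi (ks ! l))"

lemma mat_diag_cong: "(\<And>l. l < n \<Longrightarrow> f l = g l) \<Longrightarrow> mat_diag n f = mat_diag n g"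
  unfolding mat_diag_def by (intro eq_matI) auto

lemma invm_mat_diag:
  assumes "\<And>l. l < n \<Longrightarrow> f l \<noteq> 0"
  shows "invm n (mat_diag n f)"
proof -
  have "mat_diag n (\<lambda>l. f l * inverse (f l)) = mat_diag n (\<lambda>_. 1)"
    "mat_diag n (\<lambda>l. inverse (f l) * f l) = mat_diag n (\<lambda>_. 1)"
    by (rule mat_diag_cong, simp add: assms)+
  then show ?thesis
    unfolding invm_def by (intro conjI bexI[of _ "mat_diag n (\<lambda>l. inverse (f l))"]) simp_all
qed

lemma vb_frame_O_sum: "vb_frame (O_sum ks) (O_frame ks)"
  unfolding vb_frame_def
proof (intro conjI ballI)
  fix i x assume "i \<in> vb_idx (O_sum ks)" "x \<in> chart (O_sum ks) i"
  then show "invm (vb_rank (O_sum ks)) (O_frame ks i x)"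
    unfolding O_frame_def by (auto intro!: invm_mat_diag simp: O_sum_chart)
next
  fix i j x assume "x \<in> chart (O_sum ks) i \<inter> chart (O_sum ks) j"
  then show "O_frame ks i x * trans (O_sum ks) i j x = O_frame ks j x"
    unfolding O_frame_def O_sum_trans
    by (auto intro!: mat_diag_cong simp: O_sum_chart simp flip: power_int_mult_distrib)
qed

text \<open>An entry \<open>O(k) \<rightarrow> O(l)\<close> is multiplication by a form of degree
  \<open>l - k\<close>, and in these frames it is the value of that form. The alternative of a zero
  entry covers the case \<open>l < k\<close>, where no degree \<open>d\<close> exists.\<close>

lemma framed_map_O_sum:
  assumes P: "\<And>p q. p < length ls \<Longrightarrow> q < length ks \<Longrightarrow>
      (P p q = (\<lambda>_. 0)) \<or> (\<exists>d. hom_poly d (P p q) \<and> ls ! p = ks ! q + int d)"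
  shows "framed_map (O_sum ks) (O_frame ks) (O_sum ls) (O_frame ls)
    (\<lambda>x. mat (length ls) (length ks) (\<lambda>(p, q). P p q (coords x)))"
proof (rule framed_mapI)
  fix x assume "x \<in> vb_base (O_sum ks)"
  obtain m where m: "m < 3" "coords x $ m \<noteq> 0" by (rule coords_nonzero_entry)
  let ?i = "const_chart (length ks) m" and ?j = "const_chart (length ls) m"
  let ?U = "{y. coords y $ m \<noteq> 0}"
  \<comment> \<open>The exponent is minus the degree of the entry: in chart \<open>m\<close> the
    form is divided by that power of \<open>u_m\<close>.\<close>
  let ?N = "\<lambda>y. mat (length ls) (length ks) (\<lambda>(p, q). P p q (coords y) * (coords y $ m) powi (ks ! q - ls ! p))"
  have "regular_mat_on (chart (O_sum ks) ?i \<inter> chart (O_sum ls) ?j \<inter> ?U) (length ls) (length ks) ?N" (is "regular_mat_on ?S _ _ _")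
  proof (rule regular_mat_onI)
    fix p q assume pq: "p < length ls" "q < length ks"
    have "regular_on ?S (\<lambda>y. P p q (coords y) * (coords y $ m) powi (ks ! q - ls ! p))"
      using P[OF pq]
    proof
      assume "\<exists>d. hom_poly d (P p q) \<and> ls ! p = ks ! q + int d"
      then obtain d where d: "hom_poly d (P p q)" and e: "ks ! q - ls ! p = - int d" by auto
      show ?thesis
        unfolding e
        by (rule regular_on_ratio[OF d hom_poly_coord_power[OF m(1)]]) (auto simp: power_int_minus divide_inverse)
    qed (simp add: regular_on_const)
    then show "regular_on ?S (\<lambda>y. ?N y $$ (p, q))" using pq by simp
  qed simp
  moreover have "O_frame ls ?j y * ?N y = mat (length ls) (length ks) (\<lambda>(p, q). P p q (coords y)) * O_frame ks ?i y"
    if "coords y $ m \<noteq> 0" for y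
    unfolding O_frame_def
    by (subst mat_diag_mult_left[of _ _ "length ks"], simp, subst mat_diag_mult_right[of _ "length ls"], simp)
      (intro eq_matI, auto simp: that power_int_diff)
  ultimately show "framed_at (O_sum ks) (O_frame ks) (O_sum ls) (O_frame ls)
      (\<lambda>x. mat (length ls) (length ks) (\<lambda>(p, q). P p q (coords x))) x"
    using m O_sum_idx_const[OF m(1)] zariski_open_coord[OF m(1)]
    by (intro framed_atI[where i = ?i and j = ?j and U = ?U and N = ?N]) (auto simp: O_sum_chart)
qed simp_all

section \<open>Twists of sums of line bundles and torus pullbacks of line bundles\<close>

lemma vb_frame_tensor_O:
  assumes \<Phi>: "vb_frame E \<Phi>" and E: "vector_bundle E"
  shows "vb_frame (vb_tensor E (O_bundle n))
    (\<lambda>i x. (coords x $ right_idx i) powi n \<cdot>\<^sub>m \<Phi> (left_idx i) x)"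
  unfolding vb_frame_def vb_tensor_simps O_bundle_simps mult_1_right
proof (intro conjI ballI, unfold prod_idx_iff)
  fix i x
  assume *: "left_idx i \<in> vb_idx E \<and> right_idx i \<in> {..<3}"
    "x \<in> chart E (left_idx i) \<inter> {x. coords x $ right_idx i \<noteq> 0}"
  let ?r = "vb_rank E" and ?A = "\<Phi> (left_idx i) x" and ?a = "(coords x $ right_idx i) powi n"
  have A: "invm ?r ?A" using vb_frame_invm[OF \<Phi>] * by blast
  have "?a \<noteq> 0" using * by simp
  then show "invm ?r (?a \<cdot>\<^sub>m ?A)"
    unfolding invm_def
    by (intro conjI bexI[of _ "inverse ?a \<cdot>\<^sub>m minv ?r ?A"])
      (use invm_carrier[OF A] minv_carrier[OF A] minv_left[OF A] minv_right[OF A]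
        smult_mat_mult_smult[of _ ?r ?r _ ?r] in \<open>auto intro!: eq_matI simp del: index_mult_mat\<close>)
next
  fix i j x
  let ?i = "left_idx i" and ?i1 = "right_idx i"
    and ?j = "left_idx j" and ?j1 = "right_idx j"
  assume *: "?i \<in> vb_idx E \<and> ?i1 \<in> {..<3}" "?j \<in> vb_idx E \<and> ?j1 \<in> {..<3}"
    "x \<in> chart E ?i \<inter> {x. coords x $ ?i1 \<noteq> 0} \<inter> (chart E ?j \<inter> {x. coords x $ ?j1 \<noteq> 0})"
  have c: "\<Phi> ?i x \<in> carrier_mat (vb_rank E) (vb_rank E)" "trans E ?i ?j x \<in> carrier_mat (vb_rank E) (vb_rank E)"
    using * invm_carrier[OF vb_frame_invm[OF \<Phi>]] vector_bundle_trans_carrier[OF E] by auto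
  have "(coords x $ ?i1) powi n * (coords x $ ?j1 / coords x $ ?i1) powi n = (coords x $ ?j1) powi n"
    using * by (simp flip: power_int_mult_distrib)
  then show "(coords x $ ?i1) powi n \<cdot>\<^sub>m \<Phi> ?i x *
      kronecker_mat (trans E ?i ?j x) (mat 1 1 (\<lambda>_. (coords x $ ?j1 / coords x $ ?i1) powi n)) =
      (coords x $ ?j1) powi n \<cdot>\<^sub>m \<Phi> ?j x"
    using * vb_frame_trans[OF \<Phi>, of ?i ?j x] by (simp add: kronecker_mat_line smult_mat_mult_smult[OF c])
qed

lemma framed_map_one:
  assumes E: "vb_frame E \<Phi>" and base: "vb_base E = vb_base F" "vb_rank E = vb_rank F"
    and "\<And>x. x \<in> vb_base E \<Longrightarrow> \<exists>i\<in>vb_idx E. \<exists>j\<in>vb_idx F. x \<in> chart E i \<and> x \<in> chart F j \<and>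
       (\<forall>y\<in>chart E i \<inter> chart F j. \<Phi> i y = \<Psi> j y)"
  shows "framed_map E \<Phi> F \<Psi> (\<lambda>_. 1\<^sub>m (vb_rank E))"
proof (rule framed_mapI)
  fix x assume "x \<in> vb_base E"
  from assms(4)[OF this] obtain i j where *: "i \<in> vb_idx E" "j \<in> vb_idx F" "x \<in> chart E i" "x \<in> chart F j"
    "\<forall>y\<in>chart E i \<inter> chart F j. \<Phi> i y = \<Psi> j y" by blast
  then have "\<Psi> j y * 1\<^sub>m (vb_rank E) = 1\<^sub>m (vb_rank E) * \<Phi> i y" if "y \<in> chart E i \<inter> chart F j" for y
    using invm_carrier[OF vb_frame_invm[OF E, of i y]] that by simp
  then show "framed_at E \<Phi> F \<Psi> (\<lambda>_. 1\<^sub>m (vb_rank E)) x"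
    using * base by (intro framed_atI[where i = i and j = j and U = UNIV and N = "\<lambda>_. 1\<^sub>m (vb_rank E)"])
      (auto intro!: zariski_open_UNIV regular_mat_on_const)
qed (use base in auto)

text \<open>With the same coordinate \<open>u_m\<close> in all factors,
  \<open>u_m powi k * u_m powi n = u_m powi (k + n)\<close> makes the two frames coincide, and the
  identity matrix is the isomorphism.\<close>

lemma vb_iso_O_sum_tensor:
  "vb_iso (vb_tensor (O_sum ks) (O_bundle n)) (O_sum (map (\<lambda>k. k + n) ks))"
proof -
  let ?E = "vb_tensor (O_sum ks) (O_bundle n)" and ?F = "O_sum (map (\<lambda>k. k + n) ks)"
  let ?\<Phi> = "\<lambda>i x. (coords x $ right_idx i) powi n \<cdot>\<^sub>m O_frame ks (left_idx i) x"
  let ?\<Psi> = "O_frame (map (\<lambda>k. k + n) ks)"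
  have E: "vector_bundle ?E" by (intro vb_twist.vector_bundle vector_bundle_O_sum vector_bundle_O) simp
  have fr: "vb_frame ?E ?\<Phi>" "vb_frame ?F ?\<Psi>"
    by (rule vb_frame_tensor_O[OF vb_frame_O_sum vector_bundle_O_sum], rule vb_frame_O_sum)
  have base: "vb_base ?E = vb_base ?F" "vb_rank ?E = vb_rank ?F" by (simp_all add: vb_tensor_simps)
  have ex: "\<exists>i\<in>vb_idx ?E. \<exists>j\<in>vb_idx ?F. x \<in> chart ?E i \<and> x \<in> chart ?F j \<and> (\<forall>y\<in>chart ?E i \<inter> chart ?F j. ?\<Phi> i y = ?\<Psi> j y)" for x
  proof -
    obtain m where m: "m < 3" "coords x $ m \<noteq> 0" by (rule coords_nonzero_entry)
    let ?j = "const_chart (length ks) m"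
    have "?\<Phi> (prod_encode (?j, m)) y = ?\<Psi> ?j y" if "y \<in> chart ?E (prod_encode (?j, m))" for y
    proof -
      have "coords y $ m \<noteq> 0" using that by (simp add: vb_tensor_simps)
      then show ?thesis
        unfolding O_frame_def mat_diag_def by (intro eq_matI) (auto simp: power_int_add)
    qed
    moreover have "prod_encode (?j, m) \<in> vb_idx ?E" "?j \<in> vb_idx ?F"
      using m(1) O_sum_idx_const[OF m(1), of ks] O_sum_idx_const[OF m(1), of "map (\<lambda>k. k + n) ks"]
      by (simp_all add: vb_tensor_simps)
    moreover have "x \<in> chart ?E (prod_encode (?j, m))" "x \<in> chart ?F ?j"
      using m(2) by (simp_all add: vb_tensor_simps O_sum_chart)
    ultimately show ?thesis by blast
  qed
  have 1: "framed_map ?E ?\<Phi> ?F ?\<Psi> (\<lambda>_. 1\<^sub>m (vb_rank ?E))"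
    by (rule framed_map_one[OF fr(1) base ex])
  have 2: "framed_map ?F ?\<Psi> ?E ?\<Phi> (\<lambda>_. 1\<^sub>m (vb_rank ?F))"
  proof (rule framed_map_one[OF fr(2) base[symmetric]])
    fix x
    obtain i j where "i \<in> vb_idx ?E" "j \<in> vb_idx ?F" "x \<in> chart ?E i" "x \<in> chart ?F j"
      "\<forall>y\<in>chart ?E i \<inter> chart ?F j. ?\<Phi> i y = ?\<Psi> j y" using ex[of x] by blast
    then show "\<exists>j\<in>vb_idx ?F. \<exists>i\<in>vb_idx ?E. x \<in> chart ?F j \<and> x \<in> chart ?E i \<and> (\<forall>y\<in>chart ?F j \<inter> chart ?E i. ?\<Psi> j y = ?\<Phi> i y)"
      by (intro bexI[of _ j] bexI[of _ i]) auto
  qed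
  show ?thesis
    unfolding vb_iso_framed_iff[OF E vector_bundle_O_sum fr]
    by (intro exI conjI, rule 1, rule 2) (simp add: vb_tensor_simps)
qed

text \<open>The pulled-back frame is \<open>(torus_scale t x * (t $ m * u_m)) powi k\<close>.
  \<open>H\<close> and \<open>K\<close> only remove or restore the arbitrary scale, so that the
  matrices left in chart \<open>m\<close> are the constants \<open>(t $ m) powi k\<close> and
  \<open>(t $ m) powi (- k)\<close>.\<close>

lemma equivariant_O: "equivariant (O_bundle k)"
  unfolding equivariant_def
proof
  fix t assume t: "t \<in> torus"
  let ?P = "vb_pullback (torus_act t) (O_bundle k)"
  let ?\<Phi> = "\<lambda>i x. mat 1 1 (\<lambda>_. (coords x $ i) powi k)"
  let ?\<Phi>' = "\<lambda>i x. ?\<Phi> i (torus_act t x)"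
  let ?H = "\<lambda>x. mat 1 1 (\<lambda>_. torus_scale t x powi (- k))" and ?K = "\<lambda>x. mat 1 1 (\<lambda>_. torus_scale t x powi k)"
  have one: "mat 1 1 (\<lambda>_. 1) = (1\<^sub>m 1 :: complex mat)" by (intro eq_matI) auto
  have \<Phi>: "vb_frame (O_bundle k) ?\<Phi>"
    unfolding vb_frame_def O_bundle_simps
  proof (intro conjI ballI)
    fix i x assume "x \<in> {x. coords x $ i \<noteq> 0}"
    then show "invm 1 (?\<Phi> i x)"
      unfolding invm_def by (intro conjI bexI[of _ "mat 1 1 (\<lambda>_. inverse ((coords x $ i) powi k))"])
        (auto simp: mat_1_1_mult[simplified] intro!: eq_matI)
  next
    fix i j x assume "x \<in> {x. coords x $ i \<noteq> 0} \<inter> {x. coords x $ j \<noteq> 0}"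
    then show "?\<Phi> i x * mat 1 1 (\<lambda>_. (coords x $ j / coords x $ i) powi k) = ?\<Phi> j x"
      unfolding mat_1_1_mult by (simp flip: power_int_mult_distrib)
  qed
  have \<Phi>': "vb_frame ?P ?\<Phi>'" by (rule vb_frame_pullback[OF \<Phi>])
  have "framed_at ?P ?\<Phi>' (O_bundle k) ?\<Phi> ?H x \<and> framed_at (O_bundle k) ?\<Phi> ?P ?\<Phi>' ?K x" for x
  proof -
    obtain m where m: "m < 3" "coords x $ m \<noteq> 0" by (rule coords_nonzero_entry)
    have tm: "t $ m \<noteq> 0" using t m unfolding torus_def by simp
    have ts: "torus_scale t y \<noteq> 0" "coords (torus_act t y) $ m = torus_scale t y * (t $ m * coords y $ m)" for y
      using torus_scale[OF t] m by auto
    have N: "?\<Phi> m y * mat 1 1 (\<lambda>_. (t $ m) powi k) = ?H y * ?\<Phi>' m y"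
      "?\<Phi>' m y * mat 1 1 (\<lambda>_. (t $ m) powi (- k)) = ?K y * ?\<Phi> m y" for y
      unfolding mat_1_1_mult using ts[of y] tm by (simp_all add: power_int_mult_distrib power_int_minus field_simps)
    have x: "m \<in> vb_idx ?P" "m \<in> vb_idx (O_bundle k)" "x \<in> chart ?P m" "x \<in> chart (O_bundle k) m"
      using m tm ts by simp_all
    have reg: "regular_mat_on S (vb_rank E) (vb_rank F) (\<lambda>_. mat 1 1 (\<lambda>_. c))" if "vb_rank E = 1" "vb_rank F = 1" for S c E F
      unfolding that by (intro regular_mat_on_const) simp
    show ?thesis
    proof
      show "framed_at ?P ?\<Phi>' (O_bundle k) ?\<Phi> ?H x"
        by (rule framed_atI[OF x(1,2) zariski_open_UNIV UNIV_I x(3,4)]) (rule reg, simp, simp, rule N(1))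
      show "framed_at (O_bundle k) ?\<Phi> ?P ?\<Phi>' ?K x"
        by (rule framed_atI[OF x(2,1) zariski_open_UNIV UNIV_I x(4,3)]) (rule reg, simp, simp, rule N(2))
    qed
  qed
  then have "framed_map ?P ?\<Phi>' (O_bundle k) ?\<Phi> ?H" "framed_map (O_bundle k) ?\<Phi> ?P ?\<Phi>' ?K"
    by (auto intro!: framed_mapI)
  moreover have "?K x * ?H x = 1\<^sub>m 1" "?H x * ?K x = 1\<^sub>m 1" for x
    unfolding mat_1_1_mult one[symmetric] using torus_scale(1)[OF t, of x] by (simp_all add: power_int_minus)
  ultimately show "vb_iso ?P (O_bundle k)"
    unfolding vb_iso_framed_iff[OF vector_bundle_pullback[OF t vector_bundle_O] vector_bundle_O \<Phi>' \<Phi>]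
      vb_pullback_simps O_bundle_simps by blast
qed

section \<open>The bundles \<open>E(a, b, c)\<close>\<close>

text \<open>The defining section of the sum in the frame \<open>O_frame\<close>, that is, its three
  forms evaluated at the chosen coordinates.\<close>

definition power_vec :: "nat list \<Rightarrow> cp2 \<Rightarrow> complex vec" where
  "power_vec ws x = vec 3 (\<lambda>l. (coords x $ l) ^ (ws ! l))"

lemma power_vec_nonzero: "power_vec ws x \<noteq> 0\<^sub>v 3"
proof
  assume 0: "power_vec ws x = 0\<^sub>v 3"
  obtain m where m: "m < 3" "coords x $ m \<noteq> 0" by (rule coords_nonzero_entry)
  show False
    using arg_cong[OF 0, of "\<lambda>u. u $ m"] m unfolding power_vec_def by simp
qed

lemma power_map_nth:
  "power_map a b c j i x = mat 3 1 (\<lambda>(l, _). (coords x $ l / coords x $ nth_chart l j) ^ ([a, b, c] ! l))"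
  unfolding power_map_def Let_def
  by (intro eq_matI) (auto split: prod.splits simp: less_Suc_eq numeral_3_eq_3 numeral_2_eq_2)

text \<open>The frame clears the denominators of \<open>power_map\<close>, so the image of
  \<open>O\<close> no longer depends on the charts.\<close>

lemma O_frame_power_map:
  assumes "x \<in> chart (O_sum [int a, int b, int c]) j" "v \<in> carrier_vec 1"
  shows "O_frame [int a, int b, int c] j x *\<^sub>v (power_map a b c j i x *\<^sub>v v) = (v $ 0) \<cdot>\<^sub>v power_vec [a, b, c] x"
proof -
  have nz: "coords x $ nth_chart l j \<noteq> 0" if "l < 3" for l
    using assms(1) that by (simp add: O_sum_chart)
  have "power_map a b c j i x *\<^sub>v v =
      vec 3 (\<lambda>l. (coords x $ l / coords x $ nth_chart l j) ^ ([a, b, c] ! l) * v $ 0)"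
    unfolding power_map_nth using assms(2)
    by (intro eq_vecI) (auto simp: scalar_prod_def)
  moreover have "mat_diag 3 f *\<^sub>v vec 3 g = vec 3 (\<lambda>l. f l * g l :: complex)" for f g
    unfolding mat_diag_def
    by (intro eq_vecI) (auto simp: scalar_prod_def if_distrib[of "\<lambda>z. z * _"] cong: if_cong)
  moreover have "[int a, int b, int c] ! l = int ([a, b, c] ! l)" if "l < 3" for l
    using that by (auto simp: less_Suc_eq numeral_3_eq_3)
  moreover have "O_frame [int a, int b, int c] j x =
      mat_diag 3 (\<lambda>l. (coords x $ nth_chart l j) powi ([int a, int b, int c] ! l))"
    unfolding O_frame_def by (simp add: numeral_3_eq_3)
  ultimately show ?thesis
    unfolding power_vec_def using nz
    by (intro eq_vecI) (auto simp: power_divide)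
qed

section \<open>Rank and fibrewise description of the cokernel\<close>

lemma mult_mat_zero_vec: "A \<in> carrier_mat m n \<Longrightarrow> A *\<^sub>v 0\<^sub>v n = (0\<^sub>v m :: complex vec)"
  by (intro eq_vecI) auto

lemma trace_comm_mat:
  assumes "A \<in> carrier_mat m n" "B \<in> carrier_mat n m"
  shows "(\<Sum>i<m. (A * B) $$ (i, i)) = (\<Sum>k<n. (B * A) $$ (k, k) :: complex)"
proof -
  have "(\<Sum>i<m. (A * B) $$ (i, i)) = (\<Sum>i<m. \<Sum>k<n. A $$ (i, k) * B $$ (k, i))"
    using assms by (intro sum.cong refl) (auto simp: scalar_prod_def atLeast0LessThan)
  also have "\<dots> = (\<Sum>k<n. \<Sum>i<m. B $$ (k, i) * A $$ (i, k))"
    by (subst sum.swap) (simp add: mult.commute)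
  also have "\<dots> = (\<Sum>k<n. (B * A) $$ (k, k))"
    using assms by (intro sum.cong refl) (auto simp: scalar_prod_def atLeast0LessThan)
  finally show ?thesis .
qed

text \<open>The projection \<open>1 - S G\<close> onto the kernel of \<open>G\<close> has trace 1, and \<open>S G\<close> has trace \<open>r\<close>.\<close>

lemma surjective_rank_one_kernel:
  assumes G: "G \<in> carrier_mat r n" and S: "S \<in> carrier_mat n r" and GS: "G * S = 1\<^sub>m r"
    and v: "v \<in> carrier_vec n" "v \<noteq> 0\<^sub>v n"
    and ker: "\<And>w. w \<in> carrier_vec n \<Longrightarrow> G *\<^sub>v w = 0\<^sub>v r \<longleftrightarrow> (\<exists>c. w = c \<cdot>\<^sub>v (v :: complex vec))"
  shows "n = r + 1"
proof -
  define Q where "Q = 1\<^sub>m n - S * G"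
  have Q: "Q \<in> carrier_mat n n" unfolding Q_def using S G by auto
  have SG: "S * G \<in> carrier_mat n n" using S G by simp
  have GQ: "G * Q = 0\<^sub>m r n"
    unfolding Q_def using G S GS
    by (simp add: mult_minus_distrib_mat[of _ r n _ n] assoc_mult_mat[of G r n S r G n, symmetric])
  have "\<exists>c. col Q q = c \<cdot>\<^sub>v v" if "q < n" for q
  proof -
    have "G *\<^sub>v col Q q = col (G * Q) q" using col_mult2[OF G Q that] by simp
    also have "\<dots> = 0\<^sub>v r" unfolding GQ using that by simp
    finally show ?thesis using ker[of "col Q q"] Q by (metis carrier_matD(1) col_dim)
  qed
  \<comment> \<open>Thus \<open>Q\<close> has the form \<open>v c^T\<close>. Its trace is the sum of
    all \<open>c q * v $ q\<close>, and \<open>Q *\<^sub>v v = v\<close> forces this sum to be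
    1.\<close>
  then obtain c where c: "\<And>q. q < n \<Longrightarrow> col Q q = c q \<cdot>\<^sub>v v" by metis
  have Qe: "Q $$ (p, q) = c q * v $ p" if "p < n" "q < n" for p q
    using arg_cong[OF c[OF that(2)], of "\<lambda>u. u $ p"] Q v that by auto
  obtain p where p: "p < n" "v $ p \<noteq> 0" using v by (metis carrier_vecD eq_vecI index_zero_vec)
  have "G *\<^sub>v v = 0\<^sub>v r" using ker[OF v(1)] by (metis one_smult_vec)
  then have "Q *\<^sub>v v = v"
    unfolding Q_def using v(1) G S
    by (simp add: minus_mult_distrib_mat_vec[of _ n n] assoc_mult_mat_vec[of S n r G n v] mult_mat_zero_vec[of _ n r])
  then have "v $ p = (\<Sum>q<n. Q $$ (p, q) * v $ q)"
    using Q v(1) p by (metis (no_types, lifting) atLeast0LessThan carrier_matD carrier_vecD index_mult_mat_vec index_row(1) scalar_prod_def sum.cong lessThan_iff)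
  also have "\<dots> = (\<Sum>q<n. c q * v $ q) * v $ p"
    unfolding sum_distrib_right using p by (intro sum.cong refl) (simp add: Qe)
  finally have "(\<Sum>q<n. Q $$ (q, q)) = 1" using p by (simp add: Qe)
  moreover have "(\<Sum>q<n. Q $$ (q, q)) = of_nat n - (\<Sum>q<n. (S * G) $$ (q, q))"
  proof -
    have "(\<Sum>q<n. Q $$ (q, q)) = (\<Sum>q<n. 1 - (S * G) $$ (q, q))"
      unfolding Q_def using carrier_matD[OF SG] by (intro sum.cong refl) (simp del: index_mult_mat)
    then show ?thesis by (simp add: sum_subtractf)
  qed
  moreover have "(\<Sum>q<n. (S * G) $$ (q, q)) = of_nat r"
    unfolding trace_comm_mat[OF S G] GS by simp
  ultimately have "of_nat n = (of_nat (r + 1) :: complex)" by (simp add: diff_eq_eq)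
  then show ?thesis unfolding of_nat_eq_iff .
qed

lemma right_inverse_of_surj:
  assumes G: "G \<in> carrier_mat r n"
    and surj: "(\<lambda>w. G *\<^sub>v w) ` carrier_vec n = carrier_vec r"
  obtains S where "S \<in> carrier_mat n r" "G * S = (1\<^sub>m r :: complex mat)"
proof -
  have "\<exists>w\<in>carrier_vec n. G *\<^sub>v w = unit_vec r q" for q
    using surj unit_vec_carrier by (metis imageE)
  then obtain w where w: "\<And>q. w q \<in> carrier_vec n" "\<And>q. G *\<^sub>v w q = unit_vec r q" by metis
  define S where "S = mat n r (\<lambda>(p, q). w q $ p)"
  have S: "S \<in> carrier_mat n r" unfolding S_def by simp
  have "col S q = w q" if "q < r" for q
    using that w(1)[of q] unfolding S_def by (intro eq_vecI) auto
  then have "(G * S) $$ (p, q) = (1\<^sub>m r) $$ (p, q)" if "p < r" "q < r" for p q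
    using arg_cong[OF w(2)[of q], of "\<lambda>u. u $ p"] that G S by simp
  then have "G * S = 1\<^sub>m r" using G S by (intro eq_matI) auto
  with S show thesis by (rule that)
qed

text \<open>Translates \<open>is_E_bundle\<close> into the only data used afterwards: a fibrewise
  surjection \<open>G\<close> whose kernel is the line through \<open>power_vec\<close>. The choice
  of charts and of the map \<open>g\<close> is hidden.\<close>

lemma E_bundle_framed:
  assumes "is_E_bundle a b c E"
  obtains \<Phi> G where "vector_bundle E" "vb_base E = UNIV" "vb_rank E = 2" "vb_frame E \<Phi>"
    "framed_map (O_sum [int a, int b, int c]) (O_frame [int a, int b, int c]) E \<Phi> G"
    "\<And>x. \<exists>S\<in>carrier_mat 3 2. G x * S = 1\<^sub>m 2"
    "\<And>x w. w \<in> carrier_vec 3 \<Longrightarrow> G x *\<^sub>v w = 0\<^sub>v 2 \<longleftrightarrow> (\<exists>s. w = s \<cdot>\<^sub>v power_vec [a, b, c] x)"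
proof -
  let ?B = "O_sum [int a, int b, int c]" and ?\<Psi> = "O_frame [int a, int b, int c]" and ?r = "vb_rank E"
  let ?f = "power_map a b c"
  obtain g where E: "vector_bundle E" and ex: "vb_short_exact (O_bundle 0) ?B E ?f g"
    using assms unfolding is_E_bundle_def by (auto simp: O_sum_def)
  have g: "vb_morphism ?B E g" using ex unfolding vb_short_exact_def by simp
  have base: "vb_base E = UNIV" using conjunct1[OF g[unfolded vb_morphism_def]] by simp
  obtain \<Phi> where \<Phi>: "vb_frame E \<Phi>" using vb_frame_exists[OF E] .
  obtain G where G: "framed_map ?B ?\<Psi> E \<Phi> G" and Gg: "\<And>i j x. i \<in> vb_idx ?B \<Longrightarrow> j \<in> vb_idx E \<Longrightarrow>
      x \<in> chart ?B i \<Longrightarrow> x \<in> chart E j \<Longrightarrow> \<Phi> j x * g j i x = G x * ?\<Psi> i x"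
    using vb_morphism_framed_map[OF vector_bundle_O_sum E vb_frame_O_sum \<Phi> g] by blast
  have rk: "vb_rank ?B = 3" by (simp add: numeral_3_eq_3)
  have Gc: "G x \<in> carrier_mat ?r 3" for x using framed_map_carrier[OF G, of x] unfolding rk by simp
  have key: "(\<exists>S\<in>carrier_mat 3 ?r. G x * S = 1\<^sub>m ?r) \<and>
      (\<forall>w\<in>carrier_vec 3. G x *\<^sub>v w = 0\<^sub>v ?r \<longleftrightarrow> (\<exists>s. w = s \<cdot>\<^sub>v power_vec [a, b, c] x))" for x
  proof -
    obtain m where m: "m < 3" "coords x $ m \<noteq> 0" by (rule coords_nonzero_entry)
    \<comment> \<open>One nonvanishing coordinate serves all three summands, which exhibits a chart
      of the sum around \<open>x\<close>.\<close>
    let ?j = "const_chart 3 m"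
    have j1: "?j \<in> vb_idx ?B"
      using O_sum_idx_const[OF m(1), of "[int a, int b, int c]"] by (simp add: numeral_3_eq_3)
    have j2: "x \<in> chart ?B ?j" using m by (auto simp: O_sum_chart)
    note j = j1 j2
    obtain k where k: "k \<in> vb_idx E" "x \<in> chart E k"
      using vector_bundle_cover[OF E] base by (metis UNIV_I)
    have m': "m \<in> vb_idx (O_bundle 0)" "x \<in> chart (O_bundle 0) m" using m by simp_all
    note fibre = bspec[OF bspec[OF bspec[OF bspec[OF conjunct2[OF conjunct2[OF ex[unfolded vb_short_exact_def]]]
      m'(1)] j(1)] k(1)] IntI[OF IntI[OF m'(2) j(2)] k(2)], unfolded rk O_bundle_simps]
    have im: "(\<lambda>v. ?f ?j m x *\<^sub>v v) ` carrier_vec 1 = {w \<in> carrier_vec 3. g k ?j x *\<^sub>v w = 0\<^sub>v ?r}"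
      and surj: "(\<lambda>w. g k ?j x *\<^sub>v w) ` carrier_vec 3 = carrier_vec ?r"
      using fibre by (blast, blast)
    have gc: "g k ?j x \<in> carrier_mat ?r 3" using vb_morphism_carrier[OF g j(1) k(1) j(2) k(2)] unfolding rk .
    have \<Psi>i: "invm 3 (?\<Psi> ?j x)" using vb_frame_invm[OF vb_frame_O_sum j] unfolding rk .
    note \<Phi>i = vb_frame_invm[OF \<Phi> k]
    note c = gc invm_carrier[OF \<Psi>i] minv_carrier[OF \<Psi>i] invm_carrier[OF \<Phi>i] minv_carrier[OF \<Phi>i] Gc[of x]
    have Gg': "\<Phi> k x * g k ?j x = G x * ?\<Psi> ?j x" by (rule Gg[OF j(1) k(1) j(2) k(2)])
    obtain S where S: "S \<in> carrier_mat 3 ?r" "g k ?j x * S = 1\<^sub>m ?r"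
      using right_inverse_of_surj[OF gc surj] .
    have "G x * (?\<Psi> ?j x * S * minv ?r (\<Phi> k x)) = G x * ?\<Psi> ?j x * S * minv ?r (\<Phi> k x)"
      using c S by (simp add: assoc_mult_mat[of _ ?r 3 _ 3 _ ?r] assoc_mult_mat[of _ 3 3 _ ?r _ ?r] assoc_mult_mat[of _ ?r 3 _ ?r _ ?r])
    also have "\<dots> = \<Phi> k x * (g k ?j x * S) * minv ?r (\<Phi> k x)"
      unfolding Gg'[symmetric] using c S by simp
    also have "\<dots> = 1\<^sub>m ?r" using S c minv_right[OF \<Phi>i] by simp
    finally have 1: "\<exists>S\<in>carrier_mat 3 ?r. G x * S = 1\<^sub>m ?r"
      using c S by (intro bexI[of _ "?\<Psi> ?j x * S * minv ?r (\<Phi> k x)"]) auto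
    have "G x *\<^sub>v w = 0\<^sub>v ?r \<longleftrightarrow> (\<exists>s. w = s \<cdot>\<^sub>v power_vec [a, b, c] x)" if w: "w \<in> carrier_vec 3" for w
    proof -
      define w' where "w' = minv 3 (?\<Psi> ?j x) *\<^sub>v w"
      have w': "w' \<in> carrier_vec 3" unfolding w'_def using c w by auto
      have ww': "w = ?\<Psi> ?j x *\<^sub>v w'"
        unfolding w'_def using c w minv_right[OF \<Psi>i] by (simp add: assoc_mult_mat_vec[of _ 3 3 _ 3, symmetric])
      have gw: "g k ?j x *\<^sub>v w' \<in> carrier_vec ?r" using c w' by auto
      have "G x *\<^sub>v w = G x * ?\<Psi> ?j x *\<^sub>v w'"
        unfolding ww' using c w' by (simp add: assoc_mult_mat_vec[of _ ?r 3 _ 3])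
      also have "\<dots> = \<Phi> k x *\<^sub>v (g k ?j x *\<^sub>v w')"
        unfolding Gg'[symmetric] using c w' by (simp add: assoc_mult_mat_vec[of _ ?r ?r _ 3])
      finally have Gw: "G x *\<^sub>v w = \<Phi> k x *\<^sub>v (g k ?j x *\<^sub>v w')" .
      have "g k ?j x *\<^sub>v w' = minv ?r (\<Phi> k x) *\<^sub>v (G x *\<^sub>v w)"
        unfolding Gw using c gw minv_left[OF \<Phi>i] by (simp add: assoc_mult_mat_vec[of _ ?r ?r _ ?r, symmetric])
      then have "G x *\<^sub>v w = 0\<^sub>v ?r \<longleftrightarrow> g k ?j x *\<^sub>v w' = 0\<^sub>v ?r"
        using Gw mult_mat_zero_vec[OF c(4)] mult_mat_zero_vec[OF c(5)] by metis
      also have "\<dots> \<longleftrightarrow> (\<exists>v\<in>carrier_vec 1. w' = ?f ?j m x *\<^sub>v v)"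
        using im w' by blast
      also have "\<dots> \<longleftrightarrow> (\<exists>v\<in>carrier_vec 1. w = (v $ 0) \<cdot>\<^sub>v power_vec [a, b, c] x)"
      proof (intro bex_cong refl)
        fix v :: "complex vec" assume v: "v \<in> carrier_vec 1"
        have fv: "?f ?j m x *\<^sub>v v \<in> carrier_vec 3" using im v by blast
        have "?\<Psi> ?j x *\<^sub>v (?f ?j m x *\<^sub>v v) = (v $ 0) \<cdot>\<^sub>v power_vec [a, b, c] x"
          by (rule O_frame_power_map[OF j(2) v])
        moreover have "minv 3 (?\<Psi> ?j x) *\<^sub>v (?\<Psi> ?j x *\<^sub>v (?f ?j m x *\<^sub>v v)) = ?f ?j m x *\<^sub>v v"
          using c fv minv_left[OF \<Psi>i] by (simp add: assoc_mult_mat_vec[of _ 3 3 _ 3, symmetric])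
        ultimately show "w' = ?f ?j m x *\<^sub>v v \<longleftrightarrow> w = (v $ 0) \<cdot>\<^sub>v power_vec [a, b, c] x"
          using ww' w'_def by metis
      qed
      also have "\<dots> \<longleftrightarrow> (\<exists>s. w = s \<cdot>\<^sub>v power_vec [a, b, c] x)"
      proof
        assume "\<exists>s. w = s \<cdot>\<^sub>v power_vec [a, b, c] x"
        then obtain s where "w = s \<cdot>\<^sub>v power_vec [a, b, c] x" ..
        then show "\<exists>v\<in>carrier_vec 1. w = (v $ 0) \<cdot>\<^sub>v power_vec [a, b, c] x"
          by (intro bexI[of _ "vec 1 (\<lambda>_. s)"]) auto
      qed blast
      finally show ?thesis .
    qed
    with 1 show ?thesis by blast
  qed
  \<comment> \<open>\<open>is_E_bundle\<close> does not state the rank; exactness in the fibre over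
    a single point forces it.\<close>
  have r: "?r = 2"
  proof -
    obtain x :: cp2 where "x \<in> UNIV" by blast
    obtain S where "S \<in> carrier_mat 3 ?r" "G x * S = 1\<^sub>m ?r" using key[of x] by blast
    then have "3 = ?r + 1"
      by (rule surjective_rank_one_kernel[OF Gc[of x], of S "power_vec [a, b, c] x"])
        (use key[of x] power_vec_nonzero in \<open>auto simp: power_vec_def\<close>)
    then show ?thesis by simp
  qed
  show thesis
    by (rule that[OF E base r \<Phi> G]) (use key r in auto)
qed

subsection \<open>Equivariance\<close>

lemma mat_diag_mult_vec:
  "v \<in> carrier_vec n \<Longrightarrow> mat_diag n f *\<^sub>v v = vec n (\<lambda>l. f l * v $ l :: complex)"
  unfolding mat_diag_def
  by (intro eq_vecI) (auto simp: scalar_prod_def if_distrib[of "\<lambda>z. z * _"] cong: if_cong)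

text \<open>A diagonal of arbitrary constants \<open>e l\<close> becomes regular once the powers of
  \<open>torus_scale\<close> are removed. In chart \<open>m\<close> it is the constant diagonal with
  entries \<open>e l * (t $ m) powi (ks ! l)\<close>.\<close>

lemma framed_map_O_sum_pullback:
  assumes t: "t \<in> torus"
  shows "framed_map (vb_pullback (torus_act t) (O_sum ks)) (\<lambda>i x. O_frame ks i (torus_act t x))
    (O_sum ks) (O_frame ks) (\<lambda>x. mat_diag (length ks) (\<lambda>l. e l * torus_scale t x powi (- (ks ! l))))"
    (is "framed_map ?E ?\<Phi> ?F ?\<Psi> ?H")
proof (rule framed_mapI)
  fix x
  obtain m where m: "m < 3" "coords x $ m \<noteq> 0" by (rule coords_nonzero_entry)
  let ?j = "const_chart (length ks) m"
  let ?N = "\<lambda>_. mat_diag (length ks) (\<lambda>l. e l * (t $ m) powi (ks ! l))"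
  have tm: "t $ m \<noteq> 0" using t m unfolding torus_def by simp
  have ts: "torus_scale t y \<noteq> 0" "coords (torus_act t y) $ m = torus_scale t y * (t $ m * coords y $ m)" for y
    using torus_scale[OF t] m by auto
  have "?\<Psi> ?j y * ?N y = ?H y * ?\<Phi> ?j y" for y
    unfolding O_frame_def mat_diag_diag using ts[of y]
    by (intro mat_diag_cong) (simp add: power_int_mult_distrib power_int_minus field_simps)
  moreover have "?j \<in> vb_idx ?F" "?j \<in> vb_idx ?E" "x \<in> chart ?E ?j" "x \<in> chart ?F ?j"
    using m tm ts O_sum_idx_const[OF m(1)] by (simp_all add: O_sum_chart)
  ultimately show "framed_at ?E ?\<Phi> ?F ?\<Psi> ?H x"
    by (intro framed_atI[where i = ?j and j = ?j and U = UNIV and N = ?N])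
      (auto intro!: zariski_open_UNIV regular_mat_on_const)
qed simp_all

text \<open>On the pulled-back sum there are two surjections: the pulled-back projection, and
  \<open>H\<close> followed by the projection of \<open>E\<close>. As \<open>H\<close> carries the
  section at the moved point to the section at \<open>x\<close>, their kernels agree, and
  \<open>framed_cokernel_iso\<close> applies.\<close>

lemma E_bundle_pullback_iso:
  assumes "is_E_bundle a b c E" and t: "t \<in> torus"
  shows "vb_iso (vb_pullback (torus_act t) E) E"
proof -
  let ?ks = "[int a, int b, int c]" and ?F = "power_vec [a, b, c]" and ?\<tau> = "torus_act t"
  obtain \<Phi> G where E: "vector_bundle E" "vb_base E = UNIV" "vb_rank E = 2" "vb_frame E \<Phi>"
    and G: "framed_map (O_sum ?ks) (O_frame ?ks) E \<Phi> G"
    and surj: "\<And>x. \<exists>S\<in>carrier_mat 3 2. G x * S = 1\<^sub>m 2"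
    and ker: "\<And>x w. w \<in> carrier_vec 3 \<Longrightarrow> G x *\<^sub>v w = 0\<^sub>v 2 \<longleftrightarrow> (\<exists>s. w = s \<cdot>\<^sub>v ?F x)"
    using E_bundle_framed[OF assms(1)] by metis
  have rk: "vb_rank (O_sum ?ks) = 3" by (simp add: numeral_3_eq_3)
  have Gc: "G x \<in> carrier_mat 2 3" for x using framed_map_carrier[OF G, of x] E(3) unfolding rk by simp
  \<comment> \<open>The two factors undo the powers of \<open>t $ l\<close> and of
    \<open>torus_scale t x\<close> that the \<open>l\<close>-th entry of the section acquires at the
    moved point.\<close>
  define H where "H x = mat_diag 3 (\<lambda>l. (t $ l) powi (- (?ks ! l)) * torus_scale t x powi (- (?ks ! l)))" for x
  have tnz: "t $ l \<noteq> 0" if "l < 3" for l using t that unfolding torus_def by simp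
  have inv: "invm 3 (H x)" for x
    unfolding H_def using tnz torus_scale(1)[OF t] by (intro invm_mat_diag) simp
  note Hc = invm_carrier[OF inv] minv_carrier[OF inv]
  have F: "?F x \<in> carrier_vec 3" for x unfolding power_vec_def by simp
  have HF: "H x *\<^sub>v ?F (?\<tau> x) = ?F x" for x
  proof -
    have "?ks ! l = int ([a, b, c] ! l)" if "l < 3" for l
      using that by (auto simp: less_Suc_eq numeral_3_eq_3)
    then show ?thesis
      unfolding H_def mat_diag_mult_vec[OF F] using tnz torus_scale(1)[OF t, of x] torus_scale(2)[OF t, of _ x]
      by (intro eq_vecI) (auto simp: power_vec_def power_int_minus power_mult_distrib field_simps)
  qed
  have "framed_map (vb_pullback ?\<tau> (O_sum ?ks)) (\<lambda>i x. O_frame ?ks i (?\<tau> x)) (O_sum ?ks) (O_frame ?ks) H"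
    using framed_map_O_sum_pullback[OF t, of ?ks "\<lambda>l. (t $ l) powi (- (?ks ! l))"]
    unfolding H_def by (simp add: numeral_3_eq_3)
  then have K: "framed_map (vb_pullback ?\<tau> (O_sum ?ks)) (\<lambda>i x. O_frame ?ks i (?\<tau> x)) E \<Phi> (\<lambda>x. G x * H x)"
    by (rule framed_map_comp[OF vector_bundle_pullback[OF t vector_bundle_O_sum] vector_bundle_O_sum E(1)
          vb_frame_pullback[OF vb_frame_O_sum] vb_frame_O_sum E(4) _ G])
  have ker_iff: "G (?\<tau> x) *\<^sub>v w = 0\<^sub>v 2 \<longleftrightarrow> G x * H x *\<^sub>v w = 0\<^sub>v 2" if w: "w \<in> carrier_vec 3" for x w
  proof -
    have Hw: "H x *\<^sub>v w \<in> carrier_vec 3" by (rule mult_mat_vec_carrier[OF Hc(1) w])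
    have "G x * H x *\<^sub>v w = 0\<^sub>v 2 \<longleftrightarrow> (\<exists>s. H x *\<^sub>v w = s \<cdot>\<^sub>v ?F x)"
      using ker[OF Hw, of x] assoc_mult_mat_vec[OF Gc Hc(1) w] by simp
    also have "\<dots> \<longleftrightarrow> (\<exists>s. H x *\<^sub>v w = H x *\<^sub>v (s \<cdot>\<^sub>v ?F (?\<tau> x)))"
      using mult_mat_vec[OF Hc(1) F] HF by simp
    also have "\<dots> \<longleftrightarrow> (\<exists>s. w = s \<cdot>\<^sub>v ?F (?\<tau> x))"
    proof -
      have "H x *\<^sub>v w = H x *\<^sub>v v \<longleftrightarrow> w = v" if v: "v \<in> carrier_vec 3" for v
        using assoc_mult_mat_vec[OF Hc(2) Hc(1) w] assoc_mult_mat_vec[OF Hc(2) Hc(1) v] minv_left[OF inv] v w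
        by (metis one_mult_mat_vec)
      then show ?thesis using F by (metis smult_carrier_vec)
    qed
    finally show ?thesis using ker[OF w] by blast
  qed
  show ?thesis
  proof (rule framed_cokernel_iso[OF vector_bundle_pullback[OF t vector_bundle_O_sum] vector_bundle_pullback[OF t E(1)] E(1)
        vb_frame_pullback[OF vb_frame_O_sum] vb_frame_pullback[OF E(4)] E(4) framed_map_pullback[OF t G refl] K],
      unfold vb_pullback_simps rk E(3))
    fix x
    show "\<exists>S\<in>carrier_mat 3 2. G (?\<tau> x) * S = 1\<^sub>m 2" by (rule surj)
    obtain S where S: "S \<in> carrier_mat 3 2" "G x * S = 1\<^sub>m 2" using surj by blast
    have "G x * H x * (minv 3 (H x) * S) = G x * S"
      using assoc_mult_mat[OF Gc[of x] Hc(1)[of x] mult_carrier_mat[OF Hc(2)[of x] S(1)]]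
        minv_cancel_left(2)[OF inv S(1), of x] by simp
    then show "\<exists>S\<in>carrier_mat 3 2. G x * H x * S = 1\<^sub>m 2"
      using S(2) by (intro bexI[OF _ mult_carrier_mat[OF Hc(2)[of x] S(1)]]) simp
    show "G (?\<tau> x) *\<^sub>v w = 0\<^sub>v 2 \<longleftrightarrow> G x * H x *\<^sub>v w = 0\<^sub>v 2" if "w \<in> carrier_vec 3" for w
      by (rule ker_iff[OF that])
  qed
qed

subsection \<open>Restriction to the coordinate lines\<close>

text \<open>The comparison map \<open>D\<close> is defined by forms on the whole plane, but off the
  line its kernel differs from that of the projection, since the \<open>i\<close>-th entry of the
  section is nonzero there. Both maps are therefore restricted before
  \<open>framed_cokernel_iso\<close> is applied.\<close>

lemma E_bundle_restrict_iso:
  assumes "is_E_bundle a b c E"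
    and ijk: "i < 3" "j < 3" "k < 3" "i \<noteq> j" "i \<noteq> k" "j \<noteq> k" and pos: "[a, b, c] ! i > 0"
  shows "vb_iso (vb_restrict E (coord_line i))
    (vb_restrict (O_sum [int ([a, b, c] ! j) + int ([a, b, c] ! k), int ([a, b, c] ! i)]) (coord_line i))"
proof -
  let ?ks = "[int a, int b, int c]" and ?F = "power_vec [a, b, c]" and ?w = "\<lambda>l. [a, b, c] ! l"
  let ?Z = "coord_line i" and ?ls = "[int (?w j) + int (?w k), int (?w i)]"
  obtain \<Phi> G where E: "vector_bundle E" "vb_base E = UNIV" "vb_rank E = 2" "vb_frame E \<Phi>"
    and G: "framed_map (O_sum ?ks) (O_frame ?ks) E \<Phi> G"
    and surj: "\<And>x. \<exists>S\<in>carrier_mat 3 2. G x * S = 1\<^sub>m 2"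
    and ker: "\<And>x w. w \<in> carrier_vec 3 \<Longrightarrow> G x *\<^sub>v w = 0\<^sub>v 2 \<longleftrightarrow> (\<exists>s. w = s \<cdot>\<^sub>v ?F x)"
    using E_bundle_framed[OF assms(1)] by metis
  have rk: "vb_rank (O_sum ?ks) = 3" "vb_rank (O_sum ?ls) = 2" by (simp_all add: numeral_3_eq_3)
  have ksw: "?ks ! l = int (?w l)" if "l < 3" for l
    using that by (auto simp: less_Suc_eq numeral_3_eq_3)
  have l3: "l = i \<or> l = j \<or> l = k" if "l < 3" for l using ijk that by linarith
  have set3: "{0..<3} = {i, j, k}" using ijk l3 by auto
  \<comment> \<open>Row 0 maps \<open>O(w_j)\<close> and \<open>O(w_k)\<close> to
    \<open>O(w_j + w_k)\<close> by forms of degrees \<open>w_k\<close> and \<open>w_j\<close>; row 1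
    is the identity of \<open>O(w_i)\<close>.\<close>
  define P :: "nat \<Rightarrow> nat \<Rightarrow> complex vec \<Rightarrow> complex" where
    "P p q = (if p = 0 then if q = j then (\<lambda>u. u $ k ^ ?w k) else if q = k then (\<lambda>u. - 1 * (u $ j ^ ?w j)) else (\<lambda>_. 0)
      else if q = i then (\<lambda>_. 1) else (\<lambda>_. 0))" for p q
  define D where "D x = mat 2 3 (\<lambda>(p, q). P p q (coords x))" for x
  have "framed_map (O_sum ?ks) (O_frame ?ks) (O_sum ?ls) (O_frame ?ls)
      (\<lambda>x. mat (length ?ls) (length ?ks) (\<lambda>(p, q). P p q (coords x)))"
  proof (rule framed_map_O_sum)
    fix p q assume pq: "p < length ?ls" "q < length ?ks"
    then have "q = i \<or> q = j \<or> q = k" using l3 by simp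
    moreover have "p = 0 \<or> p = 1" using pq by auto
    ultimately show "P p q = (\<lambda>_. 0) \<or> (\<exists>d. hom_poly d (P p q) \<and> ?ls ! p = ?ks ! q + int d)"
      using ijk ksw[of j] ksw[of k] ksw[of i] hom_poly_coord_power[OF ijk(3), of "?w k"]
        hom_poly_cmult[OF hom_poly_coord_power[OF ijk(2), of "?w j"], of "-1"] hom_poly_const[of 1]
      unfolding P_def by (elim disjE) fastforce+
  qed
  then have D: "framed_map (O_sum ?ks) (O_frame ?ks) (O_sum ?ls) (O_frame ?ls) D"
    unfolding D_def by (simp add: numeral_3_eq_3 numeral_2_eq_2)
  have Dw: "D x *\<^sub>v w = vec 2 (\<lambda>p. if p = 0 then coords x $ k ^ ?w k * w $ j - coords x $ j ^ ?w j * w $ k else w $ i)"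
    if "w \<in> carrier_vec 3" for x w
    using that ijk unfolding D_def P_def
    by (intro eq_vecI) (auto simp: scalar_prod_def set3)
  have line: "coords x $ i = 0" "coords x $ j \<noteq> 0 \<or> coords x $ k \<noteq> 0" if "x \<in> ?Z" for x
    using that coords_nonzero_entry[of x] l3 unfolding coord_line_def by auto
  show ?thesis
  proof (rule framed_cokernel_iso[OF vector_bundle_restrict[OF vector_bundle_O_sum] vector_bundle_restrict[OF E(1)]
        vector_bundle_restrict[OF vector_bundle_O_sum] vb_frame_restrict[OF vb_frame_O_sum] vb_frame_restrict[OF E(4)]
        vb_frame_restrict[OF vb_frame_O_sum] framed_map_restrict[OF G] framed_map_restrict[OF D]],
      unfold vb_restrict_simps rk E(3) O_sum_base)
    fix x assume "x \<in> UNIV \<inter> ?Z"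
    then have x: "x \<in> ?Z" by simp
    show "\<exists>S\<in>carrier_mat 3 2. G x * S = 1\<^sub>m 2" by (rule surj)
    let ?uj = "coords x $ j ^ ?w j" and ?uk = "coords x $ k ^ ?w k"
    \<comment> \<open>Row 0 of \<open>D\<close> is inverted through \<open>u_k\<close> when it is
      nonzero and otherwise through \<open>u_j\<close>; they have no common zero on the line. The
      sign matches the entry \<open>- u_j ^ w_j\<close>.\<close>
    let ?S = "mat 3 2 (\<lambda>(l, q). if q = 0 then
        if coords x $ k \<noteq> 0 then if l = j then inverse ?uk else 0 else if l = k then - inverse ?uj else 0
        else if l = i then 1 else 0)"
    have "D x * ?S = 1\<^sub>m 2"
    proof (rule eq_matI)
      fix p q assume pq: "p < dim_row (1\<^sub>m 2 :: complex mat)" "q < dim_col (1\<^sub>m 2 :: complex mat)"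
      have "(D x * ?S) $$ (p, q) = (D x *\<^sub>v col ?S q) $ p"
        using pq unfolding D_def by simp
      also have "\<dots> = (1\<^sub>m 2) $$ (p, q)"
        using pq ijk line[OF x] by (subst Dw) (auto simp: less_2_cases_iff)
      finally show "(D x * ?S) $$ (p, q) = (1\<^sub>m 2) $$ (p, q)" .
    qed (auto simp: D_def)
    then show "\<exists>S\<in>carrier_mat 3 2. D x * S = 1\<^sub>m 2" by (intro bexI[of _ ?S]) auto
    fix w :: "complex vec" assume w: "w \<in> carrier_vec 3"
    \<comment> \<open>\<open>pos\<close> is what makes the \<open>i\<close>-th entry vanish: with
      exponent 0 it would be 1.\<close>
    have Fi: "?F x $ i = 0" "?F x $ j = ?uj" "?F x $ k = ?uk"
      using line(1)[OF x] pos ijk unfolding power_vec_def by auto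
    have "D x *\<^sub>v w = 0\<^sub>v 2 \<longleftrightarrow> ?uk * w $ j - ?uj * w $ k = 0 \<and> w $ i = 0" (is "?L = ?R")
    proof
      assume L: ?L
      show ?R using arg_cong[OF L, of "\<lambda>v. v $ 0"] arg_cong[OF L, of "\<lambda>v. v $ 1"] unfolding Dw[OF w] by simp
    next
      assume ?R then show ?L unfolding Dw[OF w] by (intro eq_vecI) auto
    qed
    also have "\<dots> \<longleftrightarrow> (\<exists>s. w = s \<cdot>\<^sub>v ?F x)"
    proof
      assume R: ?R
      define s where "s = (if coords x $ k \<noteq> 0 then w $ k / ?uk else w $ j / ?uj)"
      have "w $ j = s * ?uj" "w $ k = s * ?uk"
        using R line(2)[OF x] unfolding s_def by (auto simp: field_simps)
      then have "w $ l = s * ?F x $ l" if "l < 3" for l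
        using l3[OF that] Fi R by auto
      then have "w = s \<cdot>\<^sub>v ?F x"
        using w by (intro eq_vecI) (auto simp: power_vec_def)
      then show "\<exists>s. w = s \<cdot>\<^sub>v ?F x" ..
    next
      assume "\<exists>s. w = s \<cdot>\<^sub>v ?F x"
      then obtain s where s: "w = s \<cdot>\<^sub>v ?F x" ..
      have "w $ l = s * ?F x $ l" if "l < 3" for l
        using that unfolding s by (simp add: power_vec_def)
      then show ?R using Fi ijk by simp
    qed
    finally show "G x *\<^sub>v w = 0\<^sub>v 2 \<longleftrightarrow> D x *\<^sub>v w = 0\<^sub>v 2" using ker[OF w] by blast
  qed
qed

subsection \<open>A model of \<open>E(a, b, c)\<close>\<close>

text \<open>On \<open>u\<^sub>i \<noteq> 0\<close> the \<open>i\<close>-th entry of the section is invertible, so the cokernel is trivialised by the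
  two other coordinates, listed by \<open>skip i\<close>: \<open>quot_mat\<close> is the projection along the section and
  \<open>lift_mat\<close> its constant right inverse.\<close>

definition skip :: "nat \<Rightarrow> nat \<Rightarrow> nat" where
  "skip i p = (if p < i then p else p + 1)"

definition quot_mat :: "nat list \<Rightarrow> nat \<Rightarrow> cp2 \<Rightarrow> complex mat" where
  "quot_mat ws i x = mat 2 3 (\<lambda>(p, l). if l = skip i p then 1
     else if l = i then - ((coords x $ skip i p / coords x $ i) ^ (ws ! skip i p)) else 0)"

definition lift_mat :: "nat \<Rightarrow> complex mat" where
  "lift_mat i = mat 3 2 (\<lambda>(l, p). if l = skip i p then 1 else 0)"

text \<open>The defining section in chart \<open>j\<close> of the sum, before any frame is applied;
  it is the single column of \<open>power_map\<close>.\<close>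

definition chart_vec :: "nat list \<Rightarrow> nat \<Rightarrow> cp2 \<Rightarrow> complex vec" where
  "chart_vec ws j x = vec 3 (\<lambda>l. (coords x $ l / coords x $ nth_chart l j) ^ (ws ! l))"

text \<open>A transition lifts a class from chart \<open>j\<close> to the sum, changes the
  trivialisation there, and projects in chart \<open>i\<close>. The lift is only defined modulo the
  section, which the projection kills.\<close>

definition E_model :: "nat list \<Rightarrow> vbundle" where
  "E_model ws = \<lparr>vb_base = UNIV, vb_rank = 2, vb_idx = {..<3}, chart = (\<lambda>i. {x. coords x $ i \<noteq> 0}),
     trans = (\<lambda>i j x. quot_mat ws i x * trans (O_sum (map int ws)) (const_chart 3 i) (const_chart 3 j) x * lift_mat j)\<rparr>"

lemma skip_less: "i < 3 \<Longrightarrow> p < 2 \<Longrightarrow> skip i p < 3"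
  and skip_neq: "skip i p \<noteq> i"
  and skip_eq_iff: "skip i p = skip i q \<longleftrightarrow> p = q"
  unfolding skip_def by auto

lemma skip_cases:
  assumes "i < 3" "l < 3" "l \<noteq> i" obtains p where "p < 2" "l = skip i p"
proof (cases "l < i")
  case True
  then show thesis using that[of l] assms unfolding skip_def by simp
next
  case False
  then show thesis using that[of "l - 1"] assms unfolding skip_def by simp
qed

lemma quot_mat_carrier [simp]: "quot_mat ws i x \<in> carrier_mat 2 3"
  and lift_mat_carrier [simp]: "lift_mat i \<in> carrier_mat 3 2"
  and chart_vec_carrier [simp]: "chart_vec ws j x \<in> carrier_vec 3"
  unfolding quot_mat_def lift_mat_def chart_vec_def by simp_all

lemma quot_mat_mult_vec:
  assumes "i < 3" "w \<in> carrier_vec 3"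
  shows "quot_mat ws i x *\<^sub>v w =
    vec 2 (\<lambda>p. w $ skip i p - (coords x $ skip i p / coords x $ i) ^ (ws ! skip i p) * w $ i)"
proof (rule eq_vecI)
  fix p assume "p < dim_vec (vec 2 (\<lambda>p. w $ skip i p - (coords x $ skip i p / coords x $ i) ^ (ws ! skip i p) * w $ i))"
  then have p: "p < 2" by simp
  let ?s = "skip i p" and ?r = "(coords x $ skip i p / coords x $ i) ^ (ws ! skip i p)"
  have "(quot_mat ws i x *\<^sub>v w) $ p = (\<Sum>l\<in>{0..<3}. (if l = ?s then 1 else if l = i then - ?r else 0) * w $ l)"
    using p assms(2) unfolding quot_mat_def by (simp add: scalar_prod_def)
  also have "\<dots> = (\<Sum>l\<in>{?s, i}. (if l = ?s then 1 else if l = i then - ?r else 0) * w $ l)"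
    using skip_less[OF assms(1) p] assms(1) by (intro sum.mono_neutral_right) auto
  also have "\<dots> = w $ ?s - ?r * w $ i" using skip_neq[of i p] by simp
  finally show "(quot_mat ws i x *\<^sub>v w) $ p =
      vec 2 (\<lambda>p. w $ skip i p - (coords x $ skip i p / coords x $ i) ^ (ws ! skip i p) * w $ i) $ p"
    using p by simp
qed (simp add: quot_mat_def)

lemma quot_lift: assumes "i < 3" shows "quot_mat ws i x * lift_mat i = 1\<^sub>m 2"
proof (rule eq_matI)
  fix p q assume "p < dim_row (1\<^sub>m 2 :: complex mat)" "q < dim_col (1\<^sub>m 2 :: complex mat)"
  then have pq: "p < 2" "q < 2" by auto
  have "(quot_mat ws i x * lift_mat i) $$ (p, q) = (quot_mat ws i x *\<^sub>v col (lift_mat i) q) $ p"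
    using pq by (simp add: quot_mat_def lift_mat_def)
  also have "\<dots> = (1\<^sub>m 2) $$ (p, q)"
    using pq assms skip_less[OF assms] skip_neq[of i q]
    by (subst quot_mat_mult_vec) (auto simp: lift_mat_def skip_eq_iff)
  finally show "(quot_mat ws i x * lift_mat i) $$ (p, q) = (1\<^sub>m 2) $$ (p, q)" .
qed (simp_all add: quot_mat_def lift_mat_def)

text \<open>In the chart \<open>const_chart 3 i\<close> the \<open>i\<close>-th entry of the section
  is 1, so the multiplier can only be \<open>w $ i\<close>; the other coordinates say that
  \<open>w\<close> is this multiple.\<close>

lemma quot_mat_kernel:
  assumes i: "i < 3" "coords x $ i \<noteq> 0" and w: "w \<in> carrier_vec 3"
  shows "quot_mat ws i x *\<^sub>v w = 0\<^sub>v 2 \<longleftrightarrow> (\<exists>s. w = s \<cdot>\<^sub>v chart_vec ws (const_chart 3 i) x)"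
proof
  let ?f = "chart_vec ws (const_chart 3 i) x"
  have f: "?f $ l = (coords x $ l / coords x $ i) ^ (ws ! l)" if "l < 3" for l
    using that unfolding chart_vec_def by simp
  {
    assume 0: "quot_mat ws i x *\<^sub>v w = 0\<^sub>v 2"
    have "w $ l = w $ i * ?f $ l" if l: "l < 3" for l
    proof (cases "l = i")
      case False
      obtain p where p: "p < 2" "l = skip i p" using skip_cases[OF i(1) l False] .
      show ?thesis
        using arg_cong[OF 0, of "\<lambda>v. v $ p"] p f[OF l] unfolding quot_mat_mult_vec[OF i(1) w] by simp
    qed (use f[OF i(1)] i in simp)
    then have "w = (w $ i) \<cdot>\<^sub>v ?f" using w by (intro eq_vecI) (auto simp: chart_vec_def)
    then show "\<exists>s. w = s \<cdot>\<^sub>v ?f" ..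
  }
  assume "\<exists>s. w = s \<cdot>\<^sub>v ?f"
  then obtain s where s: "w = s \<cdot>\<^sub>v ?f" ..
  have wl: "w $ l = s * (coords x $ l / coords x $ i) ^ (ws ! l)" if "l < 3" for l
    using f[OF that] that unfolding s by (simp add: chart_vec_def)
  show "quot_mat ws i x *\<^sub>v w = 0\<^sub>v 2"
    unfolding quot_mat_mult_vec[OF i(1) w] using wl[OF i(1)] wl[OF skip_less[OF i(1)]] i(2)
    by (intro eq_vecI) auto
qed

lemma regular_quot_mat:
  assumes "i < 3" "\<And>x. x \<in> S \<Longrightarrow> coords x $ i \<noteq> 0"
  shows "regular_mat_on S 2 3 (quot_mat ws i)"
proof (rule regular_mat_onI)
  fix p q :: nat assume pq: "p < 2" "q < 3"
  have "regular_on S (\<lambda>x. - 1 * (coords x $ skip i p / coords x $ i) ^ (ws ! skip i p))"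
    by (intro regular_on_mult regular_on_const regular_on_power regular_on_coord_ratio skip_less assms pq)
  then have "regular_on S (\<lambda>x. if q = skip i p then 1 else if q = i then - 1 * (coords x $ skip i p / coords x $ i) ^ (ws ! skip i p) else 0)"
    by (cases "q = skip i p"; cases "q = i") (simp_all add: regular_on_const)
  then show "regular_on S (\<lambda>x. quot_mat ws i x $$ (p, q))"
    by (rule regular_on_cong) (use pq in \<open>simp add: quot_mat_def\<close>)
qed simp

text \<open>The local expressions of the section glue, because the transition matrix only replaces
  the denominators.\<close>

lemma O_sum_trans_chart_vec:
  assumes "length ws = 3" "x \<in> chart (O_sum (map int ws)) i" "x \<in> chart (O_sum (map int ws)) j"
  shows "trans (O_sum (map int ws)) i j x *\<^sub>v chart_vec ws j x = chart_vec ws i x"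
proof -
  have "coords x $ nth_chart l i \<noteq> 0" "coords x $ nth_chart l j \<noteq> 0" if "l < 3" for l
    using assms that by (simp_all add: O_sum_chart)
  then show ?thesis
    unfolding O_sum_trans length_map assms(1) mat_diag_mult_vec[OF chart_vec_carrier]
    using assms(1) by (intro eq_vecI) (auto simp: chart_vec_def simp flip: power_mult_distrib)
qed

lemma E_model_simps [simp]:
  "vb_base (E_model ws) = UNIV" "vb_rank (E_model ws) = 2" "vb_idx (E_model ws) = {..<3}"
  "chart (E_model ws) i = {x. coords x $ i \<noteq> 0}"
  unfolding E_model_def by simp_all

context
  fixes ws :: "nat list"
  assumes ws: "length ws = 3"
begin

private abbreviation "B \<equiv> O_sum (map int ws)"
private abbreviation "cc \<equiv> const_chart 3"

private lemma E_model_trans: "trans (E_model ws) i j x = quot_mat ws i x * trans B (cc i) (cc j) x * lift_mat j"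
  unfolding E_model_def by simp

private lemma cc_idx: "i < 3 \<Longrightarrow> cc i \<in> vb_idx B"
  using O_sum_idx_const[of i "map int ws"] ws by simp

private lemma cc_chart: "x \<in> chart B (cc i) \<longleftrightarrow> coords x $ i \<noteq> 0"
  using ws exI[of "\<lambda>l::nat. l < 3" 0] by (auto simp: O_sum_chart)

private lemma B_trans_carrier [simp]: "trans B i j x \<in> carrier_mat 3 3"
  unfolding O_sum_trans using ws by simp

private lemma B_trans_regular:
  assumes "i \<in> vb_idx B" "j \<in> vb_idx B" "\<And>x. x \<in> S \<Longrightarrow> x \<in> chart B i" "\<And>x. x \<in> S \<Longrightarrow> x \<in> chart B j"
  shows "regular_mat_on S 3 3 (trans B i j)"
  using vector_bundle_trans_regular[OF vector_bundle_O_sum assms(1,2)] unfolding O_sum_rank length_map ws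
  by (rule regular_mat_on_subset) (use assms in auto)

text \<open>Projecting in chart \<open>j\<close> and lifting again changes a vector by a multiple of
  the section. The transition carries this to a multiple of the section in chart \<open>i\<close>,
  where the projection kills it.\<close>

private lemma quot_trans_kernel:
  assumes "i < 3" "j < 3" "coords x $ i \<noteq> 0" "coords x $ j \<noteq> 0"
  shows "quot_mat ws i x * trans B (cc i) (cc j) x * lift_mat j * quot_mat ws j x = quot_mat ws i x * trans B (cc i) (cc j) x"
proof (rule kernel_factor[of _ 2 3 _ _ 2])
  fix w :: "complex vec" assume w: "w \<in> carrier_vec 3" "quot_mat ws j x *\<^sub>v w = 0\<^sub>v 2"
  then obtain s where s: "w = s \<cdot>\<^sub>v chart_vec ws (cc j) x" using quot_mat_kernel[OF assms(2,4)] by blast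
  have "trans B (cc i) (cc j) x *\<^sub>v w = s \<cdot>\<^sub>v chart_vec ws (cc i) x"
    unfolding s mult_mat_vec[OF B_trans_carrier chart_vec_carrier]
    using O_sum_trans_chart_vec[OF ws] assms cc_chart by simp
  then show "quot_mat ws i x * trans B (cc i) (cc j) x *\<^sub>v w = 0\<^sub>v 2"
    using quot_mat_kernel[OF assms(1,3), of "s \<cdot>\<^sub>v chart_vec ws (cc i) x" ws]
      assoc_mult_mat_vec[OF quot_mat_carrier B_trans_carrier w(1)] by auto
qed (rule quot_mat_carrier lift_mat_carrier mult_carrier_mat[OF quot_mat_carrier B_trans_carrier] quot_lift[OF assms(2)])+

text \<open>The projections intertwine the transitions of the sum and of the quotient. This one
  identity yields both the cocycle condition of the model and the compatibility of the projection
  morphism.\<close>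

private lemma E_model_trans_quot:
  assumes "i < 3" "j < 3" "coords x $ i \<noteq> 0" "coords x $ j \<noteq> 0" "k \<in> vb_idx B" "x \<in> chart B k"
  shows "trans (E_model ws) i j x * (quot_mat ws j x * trans B (cc j) k x) = quot_mat ws i x * trans B (cc i) k x"
proof -
  let ?A = "quot_mat ws i x * trans B (cc i) (cc j) x"
  have A: "?A \<in> carrier_mat 2 3" by (rule mult_carrier_mat[OF quot_mat_carrier B_trans_carrier])
  have "trans (E_model ws) i j x * (quot_mat ws j x * trans B (cc j) k x) =
      ?A * lift_mat j * quot_mat ws j x * trans B (cc j) k x"
    unfolding E_model_trans
    by (rule assoc_mult_mat[OF mult_carrier_mat[OF A lift_mat_carrier] quot_mat_carrier B_trans_carrier, symmetric])
  also have "\<dots> = quot_mat ws i x * (trans B (cc i) (cc j) x * trans B (cc j) k x)"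
    unfolding quot_trans_kernel[OF assms(1-4)]
    by (rule assoc_mult_mat[OF quot_mat_carrier B_trans_carrier B_trans_carrier])
  also have "trans B (cc i) (cc j) x * trans B (cc j) k x = trans B (cc i) k x"
    using assms by (intro vector_bundle_cocycle[OF vector_bundle_O_sum] cc_idx) (auto simp: cc_chart)
  finally show ?thesis .
qed

lemma vector_bundle_E_model: "vector_bundle (E_model ws)"
  unfolding vector_bundle_def
proof (intro conjI ballI)
  show "vb_base (E_model ws) = (\<Union>i\<in>vb_idx (E_model ws). chart (E_model ws) i)"
    \<comment> \<open>The charts are those of \<open>O_bundle 0\<close>, so its covering property is
      reused.\<close>
    using vector_bundle_O[of 0] unfolding vector_bundle_def by simp
next
  fix i assume "i \<in> vb_idx (E_model ws)"
  then show "\<exists>W. zariski_open W \<and> chart (E_model ws) i = vb_base (E_model ws) \<inter> W"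
    using zariski_open_coord by auto
next
  fix i j assume "i \<in> vb_idx (E_model ws)" "j \<in> vb_idx (E_model ws)"
  then have ij: "i < 3" "j < 3" by auto
  let ?S = "chart (E_model ws) i \<inter> chart (E_model ws) j"
  have "regular_mat_on ?S 2 2 (\<lambda>x. quot_mat ws i x * trans B (cc i) (cc j) x * lift_mat j)"
  proof (rule regular_mat_on_mult[OF regular_mat_on_mult regular_mat_on_const[OF lift_mat_carrier]])
    show "regular_mat_on ?S 2 3 (quot_mat ws i)" by (rule regular_quot_mat[OF ij(1)]) simp
    show "regular_mat_on ?S 3 3 (trans B (cc i) (cc j))"
      by (rule B_trans_regular[OF cc_idx[OF ij(1)] cc_idx[OF ij(2)]]) (simp_all add: cc_chart)
  qed
  then show "regular_mat_on ?S (vb_rank (E_model ws)) (vb_rank (E_model ws)) (trans (E_model ws) i j)"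
    unfolding E_model_simps by (rule regular_mat_on_cong) (rule E_model_trans)
next
  fix i x assume "i \<in> vb_idx (E_model ws)" and x: "x \<in> chart (E_model ws) i"
  then have i: "i < 3" "coords x $ i \<noteq> 0" by auto
  have "trans B (cc i) (cc i) x = 1\<^sub>m 3"
    using vector_bundle_trans_self[OF vector_bundle_O_sum cc_idx[OF i(1)]] i ws by (simp add: cc_chart)
  then show "trans (E_model ws) i i x = 1\<^sub>m (vb_rank (E_model ws))"
    unfolding E_model_trans using quot_lift[OF i(1)] by (simp add: right_mult_one_mat[OF quot_mat_carrier])
next
  fix i j k x assume "i \<in> vb_idx (E_model ws)" "j \<in> vb_idx (E_model ws)" "k \<in> vb_idx (E_model ws)"
    and x: "x \<in> chart (E_model ws) i \<inter> chart (E_model ws) j \<inter> chart (E_model ws) k"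
  then have i: "i < 3" "j < 3" "k < 3" "coords x $ i \<noteq> 0" "coords x $ j \<noteq> 0" "coords x $ k \<noteq> 0" by auto
  have c: "trans (E_model ws) i j x \<in> carrier_mat 2 2"
    unfolding E_model_trans by (intro mult_carrier_mat[OF mult_carrier_mat[OF quot_mat_carrier B_trans_carrier]]) simp
  have "trans (E_model ws) i j x * trans (E_model ws) j k x =
      trans (E_model ws) i j x * (quot_mat ws j x * trans B (cc j) (cc k) x) * lift_mat k"
    unfolding E_model_trans[of j k]
    by (rule assoc_mult_mat[OF c mult_carrier_mat[OF quot_mat_carrier B_trans_carrier] lift_mat_carrier, symmetric])
  also have "\<dots> = trans (E_model ws) i k x"
    using E_model_trans_quot[OF i(1,2,4,5) cc_idx[OF i(3)]] i(6) unfolding E_model_trans[of i k] by (simp add: cc_chart)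
  finally show "trans (E_model ws) i j x * trans (E_model ws) j k x = trans (E_model ws) i k x" .
qed

lemma vb_morphism_E_model:
  "vb_morphism B (E_model ws) (\<lambda>k i x. quot_mat ws k x * trans B (cc k) i x)"
  unfolding vb_morphism_def
proof (intro conjI ballI)
  fix i k assume i: "i \<in> vb_idx B" and "k \<in> vb_idx (E_model ws)"
  then have k: "k < 3" by simp
  have "regular_mat_on (chart B i \<inter> chart (E_model ws) k) 2 3 (\<lambda>x. quot_mat ws k x * trans B (cc k) i x)"
    by (rule regular_mat_on_mult[OF regular_quot_mat[OF k] B_trans_regular[OF cc_idx[OF k] i]]) (simp_all add: cc_chart)
  then show "regular_mat_on (chart B i \<inter> chart (E_model ws) k) (vb_rank (E_model ws)) (vb_rank B)
      (\<lambda>x. quot_mat ws k x * trans B (cc k) i x)"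
    using ws by simp
next
  fix i i' k k' x assume i: "i \<in> vb_idx B" "i' \<in> vb_idx B" and "k \<in> vb_idx (E_model ws)" "k' \<in> vb_idx (E_model ws)"
    and x: "x \<in> chart B i \<inter> chart B i' \<inter> chart (E_model ws) k \<inter> chart (E_model ws) k'"
  then have k: "k < 3" "k' < 3" "coords x $ k \<noteq> 0" "coords x $ k' \<noteq> 0" by auto
  have "trans (E_model ws) k' k x * (quot_mat ws k x * trans B (cc k) i x) * trans B i i' x =
      quot_mat ws k' x * (trans B (cc k') i x * trans B i i' x)"
    unfolding E_model_trans_quot[OF k(2,1,4,3) i(1), OF IntD1[OF IntD1[OF IntD1[OF x]]]]
    by (rule assoc_mult_mat[OF quot_mat_carrier B_trans_carrier B_trans_carrier])
  also have "trans B (cc k') i x * trans B i i' x = trans B (cc k') i' x"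
    using i x k by (intro vector_bundle_cocycle[OF vector_bundle_O_sum] cc_idx) (auto simp: cc_chart)
  finally show "quot_mat ws k' x * trans B (cc k') i' x =
      trans (E_model ws) k' k x * (quot_mat ws k x * trans B (cc k) i x) * trans B i i' x" ..
qed simp

end

section \<open>The exact sequence that defines the model\<close>

lemma power_map_mult_vec:
  "v \<in> carrier_vec 1 \<Longrightarrow> power_map a b c j i x *\<^sub>v v = (v $ 0) \<cdot>\<^sub>v chart_vec [a, b, c] j x"
  unfolding power_map_nth chart_vec_def by (intro eq_vecI) (auto simp: scalar_prod_def)

lemma vb_morphism_power_map:
  "vb_morphism (O_bundle 0) (O_sum (map int [a, b, c])) (power_map a b c)"
  unfolding vb_morphism_def
proof (intro conjI ballI)
  let ?B = "O_sum (map int [a, b, c])"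
  fix i j assume "i \<in> vb_idx (O_bundle 0)" and j: "j \<in> vb_idx ?B"
  have "regular_mat_on (chart (O_bundle 0) i \<inter> chart ?B j) 3 1 (power_map a b c j i)" (is "regular_mat_on ?S _ _ _")
  proof (rule regular_mat_onI)
    fix p q :: nat assume pq: "p < 3" "q < 1"
    have "regular_on ?S (\<lambda>x. (coords x $ p / coords x $ nth_chart p j) ^ ([a, b, c] ! p))"
      using pq O_sum_idx[OF j, of p]
      by (intro regular_on_power regular_on_coord_ratio) (auto simp: O_sum_chart)
    then show "regular_on ?S (\<lambda>x. power_map a b c j i x $$ (p, q))"
      by (rule regular_on_cong) (use pq in \<open>simp add: power_map_nth\<close>)
  qed (simp add: power_map_nth)
  then show "regular_mat_on ?S (vb_rank ?B) (vb_rank (O_bundle 0)) (power_map a b c j i)"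
    by (simp add: numeral_3_eq_3)
next
  let ?B = "O_sum (map int [a, b, c])"
  fix i i' j j' x assume "x \<in> chart (O_bundle 0) i \<inter> chart (O_bundle 0) i' \<inter> chart ?B j \<inter> chart ?B j'"
  then have x: "x \<in> chart ?B j" "x \<in> chart ?B j'" by auto
  have T: "trans ?B j' j x \<in> carrier_mat 3 3" unfolding O_sum_trans by (simp add: numeral_3_eq_3)
  have P: "power_map a b c j i x \<in> carrier_mat 3 1" for j i unfolding power_map_nth by simp
  have "trans (O_bundle 0) i i' x = 1\<^sub>m 1" by (intro eq_matI) auto
  then have "trans ?B j' j x * power_map a b c j i x * trans (O_bundle 0) i i' x = trans ?B j' j x * power_map a b c j i x"
    using T P[of j i] by (metis mult_carrier_mat right_mult_one_mat)
  also have "\<dots> = power_map a b c j' i' x"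
  proof (rule mat_eq_vecI[of _ 3 1])
    fix v :: "complex vec" assume v: "v \<in> carrier_vec 1"
    have "trans ?B j' j x * power_map a b c j i x *\<^sub>v v = (v $ 0) \<cdot>\<^sub>v (trans ?B j' j x *\<^sub>v chart_vec [a, b, c] j x)"
      using mult_mat_vec[OF T chart_vec_carrier] assoc_mult_mat_vec[OF T P v] power_map_mult_vec[OF v] by simp
    also have "\<dots> = power_map a b c j' i' x *\<^sub>v v"
      using O_sum_trans_chart_vec[OF _ x(2,1)] power_map_mult_vec[OF v] by simp
    finally show "trans ?B j' j x * power_map a b c j i x *\<^sub>v v = power_map a b c j' i' x *\<^sub>v v" .
  qed (use T P in \<open>auto intro: mult_carrier_mat\<close>)
  finally show "power_map a b c j' i' x = trans ?B j' j x * power_map a b c j i x * trans (O_bundle 0) i i' x" ..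
qed simp

text \<open>Provides an actual cokernel, so that statements about all \<open>E\<close> with
  \<open>is_E_bundle a b c E\<close> have content. Exactness is checked after moving a vector from
  chart \<open>j\<close> of the sum to the chart \<open>?cc k\<close>, where
  \<open>quot_mat_kernel\<close> and \<open>quot_lift\<close> apply.\<close>

lemma E_model_is_E_bundle: "is_E_bundle a b c (E_model [a, b, c])"
proof -
  let ?ws = "[a, b, c]"
  let ?B = "O_sum (map int ?ws)" and ?E = "E_model ?ws" and ?cc = "const_chart 3"
  let ?g = "\<lambda>k i x. quot_mat ?ws k x * trans ?B (?cc k) i x"
  have ws: "length ?ws = 3" by simp
  have Tc: "trans ?B i j x \<in> carrier_mat 3 3" for i j x unfolding O_sum_trans by (simp add: numeral_3_eq_3)
  have "inj_on (\<lambda>v. power_map a b c j i x *\<^sub>v v) (carrier_vec 1) \<and>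
        (\<lambda>v. power_map a b c j i x *\<^sub>v v) ` carrier_vec 1 = {w \<in> carrier_vec 3. ?g k j x *\<^sub>v w = 0\<^sub>v 2} \<and>
        (\<lambda>w. ?g k j x *\<^sub>v w) ` carrier_vec 3 = carrier_vec 2"
    if i: "i < 3" "coords x $ i \<noteq> 0" and j: "j \<in> vb_idx ?B" "x \<in> chart ?B j" and k: "k < 3" "coords x $ k \<noteq> 0" for i j k x
  proof (intro conjI)
    let ?f = "chart_vec ?ws" and ?T = "trans ?B (?cc k) j x" and ?T' = "trans ?B j (?cc k) x"
    have ck: "?cc k \<in> vb_idx ?B" "x \<in> chart ?B (?cc k)"
      using O_sum_idx_const[OF k(1), of "map int ?ws"] k by (simp add: numeral_3_eq_3, auto simp: O_sum_chart)
    have TT: "?T' * ?T = 1\<^sub>m 3" "?T * ?T' = 1\<^sub>m 3"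
      using ck j by (simp_all add: vector_bundle_cocycle[OF vector_bundle_O_sum]
          vector_bundle_trans_self[OF vector_bundle_O_sum] numeral_3_eq_3)
    have T'Tw: "?T' *\<^sub>v (?T *\<^sub>v w) = w" "?T *\<^sub>v (?T' *\<^sub>v w) = w" if "w \<in> carrier_vec 3" for w
      using assoc_mult_mat_vec[OF Tc Tc that, symmetric] TT that by simp_all
    have Tf: "?T *\<^sub>v ?f j x = ?f (?cc k) x" "?T' *\<^sub>v ?f (?cc k) x = ?f j x"
      using O_sum_trans_chart_vec[OF ws] ck j by auto
    have "power_vec ?ws x \<noteq> 0\<^sub>v 3" by (rule power_vec_nonzero)
    \<comment> \<open>A nonzero entry of the section; comparing it recovers the scalar and gives
      injectivity of the first map.\<close>
    then obtain l where l: "l < 3" "coords x $ l ^ (?ws ! l) \<noteq> 0"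
      unfolding power_vec_def by (metis (mono_tags, lifting) dim_vec eq_vecI index_vec index_zero_vec(1) zero_vec_def)
    then have fl: "?f j x $ l \<noteq> 0"
      using j(2) l unfolding chart_vec_def O_sum_chart by (simp add: power_divide)
    show "inj_on (\<lambda>v. power_map a b c j i x *\<^sub>v v) (carrier_vec 1)"
    proof (rule inj_onI)
      fix v v' :: "complex vec" assume v: "v \<in> carrier_vec 1" "v' \<in> carrier_vec 1"
        and eq: "power_map a b c j i x *\<^sub>v v = power_map a b c j i x *\<^sub>v v'"
      have "v $ 0 * ?f j x $ l = v' $ 0 * ?f j x $ l"
        using arg_cong[OF eq, of "\<lambda>u. u $ l"] l unfolding power_map_mult_vec[OF v(1)] power_map_mult_vec[OF v(2)]
        by (simp add: chart_vec_def)
      then show "v = v'" using fl v by (intro eq_vecI) auto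
    qed
    have gw: "?g k j x *\<^sub>v w = quot_mat ?ws k x *\<^sub>v (?T *\<^sub>v w)" if "w \<in> carrier_vec 3" for w
      by (rule assoc_mult_mat_vec[OF quot_mat_carrier Tc that])
    show "(\<lambda>v. power_map a b c j i x *\<^sub>v v) ` carrier_vec 1 = {w \<in> carrier_vec 3. ?g k j x *\<^sub>v w = 0\<^sub>v 2}"
    proof (intro equalityI subsetI)
      fix w assume "w \<in> (\<lambda>v. power_map a b c j i x *\<^sub>v v) ` carrier_vec 1"
      then obtain s where s: "w = s \<cdot>\<^sub>v ?f j x" using power_map_mult_vec by auto
      have w: "w \<in> carrier_vec 3" unfolding s by simp
      have "?T *\<^sub>v w = s \<cdot>\<^sub>v ?f (?cc k) x" unfolding s mult_mat_vec[OF Tc chart_vec_carrier] Tf ..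
      then have "?g k j x *\<^sub>v w = 0\<^sub>v 2"
        unfolding gw[OF w] using quot_mat_kernel[OF k, of "?T *\<^sub>v w" ?ws] mult_mat_vec_carrier[OF Tc w] by blast
      with w show "w \<in> {w \<in> carrier_vec 3. ?g k j x *\<^sub>v w = 0\<^sub>v 2}" by simp
    next
      fix w assume "w \<in> {w \<in> carrier_vec 3. ?g k j x *\<^sub>v w = 0\<^sub>v 2}"
      then have w: "w \<in> carrier_vec 3" "quot_mat ?ws k x *\<^sub>v (?T *\<^sub>v w) = 0\<^sub>v 2" using gw by auto
      then obtain s where s: "?T *\<^sub>v w = s \<cdot>\<^sub>v ?f (?cc k) x"
        using quot_mat_kernel[OF k mult_mat_vec_carrier[OF Tc w(1)]] by blast
      have "w = s \<cdot>\<^sub>v ?f j x"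
        using T'Tw(1)[OF w(1)] unfolding s mult_mat_vec[OF Tc chart_vec_carrier] Tf by simp
      then have "w = power_map a b c j i x *\<^sub>v vec 1 (\<lambda>_. s)" by (subst power_map_mult_vec) auto
      then show "w \<in> (\<lambda>v. power_map a b c j i x *\<^sub>v v) ` carrier_vec 1" by auto
    qed
    show "(\<lambda>w. ?g k j x *\<^sub>v w) ` carrier_vec 3 = carrier_vec 2"
    proof (intro equalityI subsetI)
      fix v :: "complex vec" assume v: "v \<in> carrier_vec 2"
      have lv: "lift_mat k *\<^sub>v v \<in> carrier_vec 3" by (rule mult_mat_vec_carrier[OF lift_mat_carrier v])
      have T'lv: "?T' *\<^sub>v (lift_mat k *\<^sub>v v) \<in> carrier_vec 3" by (rule mult_mat_vec_carrier[OF Tc lv])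
      \<comment> \<open>The preimage of \<open>v\<close> is its constant lift in the chart
        \<open>?cc k\<close>, moved back to chart \<open>j\<close>.\<close>
      have "?g k j x *\<^sub>v (?T' *\<^sub>v (lift_mat k *\<^sub>v v)) = v"
        unfolding gw[OF T'lv] T'Tw(2)[OF lv] assoc_mult_mat_vec[OF quot_mat_carrier lift_mat_carrier v, symmetric]
          quot_lift[OF k(1)] using v by simp
      then show "v \<in> (\<lambda>w. ?g k j x *\<^sub>v w) ` carrier_vec 3" using T'lv by (metis image_eqI)
    next
      fix v assume "v \<in> (\<lambda>w. ?g k j x *\<^sub>v w) ` carrier_vec 3"
      then show "v \<in> carrier_vec 2"
        using mult_mat_vec_carrier[OF mult_carrier_mat[OF quot_mat_carrier Tc]] by auto
    qed
  qed
  then have "vb_short_exact (O_bundle 0) ?B ?E (power_map a b c) ?g"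
    unfolding vb_short_exact_def using vb_morphism_power_map vb_morphism_E_model[OF ws]
    by (simp add: numeral_3_eq_3[symmetric])
  then show ?thesis
    unfolding is_E_bundle_def using vector_bundle_E_model[OF ws] by (auto simp: O_sum_def)
qed

section \<open>Splitting types\<close>

subsection \<open>Sums of line bundles on a coordinate line\<close>

text \<open>The affine coordinate \<open>t\<close> around the \<open>p\<close>-th coordinate point
  on the line joining it to the \<open>q\<close>-th one. Exchanging \<open>p\<close> and
  \<open>q\<close> gives the affine coordinate at the other end, with \<open>t\<close> replaced by
  \<open>inverse t\<close>.\<close>

definition line_point :: "nat \<Rightarrow> nat \<Rightarrow> complex \<Rightarrow> cp2" where
  "line_point p q t = abs_cp2 (vec 3 (\<lambda>l. if l = p then 1 else if l = q then t else 0))"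

lemma coords_line_point:
  assumes "p < 3"
  obtains s where "s \<noteq> 0"
    "coords (line_point p q t) = s \<cdot>\<^sub>v vec 3 (\<lambda>l. if l = p then 1 else if l = q then t else 0)"
proof -
  let ?v = "vec 3 (\<lambda>l. if l = p then 1 else if l = q then t else 0) :: complex vec"
  have "?v $ p \<noteq> 0" using assms by simp
  then have "?v \<noteq> 0\<^sub>v 3" using assms by (metis index_zero_vec(1))
  then show thesis using coords_abs[of ?v] that unfolding line_point_def by auto
qed

lemma line_point_swap:
  assumes "p < 3" "q < 3" "p \<noteq> q" "t \<noteq> 0"
  shows "line_point p q t = line_point q p (inverse t)"
proof -
  let ?v = "vec 3 (\<lambda>l. if l = p then 1 else if l = q then t else 0) :: complex vec"
  have "?v $ p \<noteq> 0" using assms by simp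
  then have "?v \<noteq> 0\<^sub>v 3" using assms by (metis index_zero_vec(1))
  moreover have "vec 3 (\<lambda>l. if l = q then 1 else if l = p then inverse t else 0) = inverse t \<cdot>\<^sub>v ?v"
    using assms by (intro eq_vecI) auto
  ultimately have "proj_rel ?v (vec 3 (\<lambda>l. if l = q then 1 else if l = p then inverse t else 0))"
    unfolding proj_rel_def using assms by (intro conjI exI[of _ "inverse t"]) auto
  then show ?thesis
    unfolding line_point_def by (rule Quotient3_rel_abs[OF Quotient3_cp2])
qed

lemma hom_poly_line_holomorphic:
  assumes "hom_poly d P"
  shows "(\<lambda>t. P (vec 3 (\<lambda>l. if l = p then 1 else if l = q then t else 0))) holomorphic_on UNIV"
proof -
  obtain \<alpha> where P: "P = form d \<alpha>" by (rule hom_polyE[OF assms(1)])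
  have hol: "(\<lambda>t. if l = p then 1 else if l = q then t else 0 :: complex) holomorphic_on UNIV" for l
    by (cases "l = p"; cases "l = q") (auto intro!: holomorphic_intros)
  show ?thesis
    unfolding P by (simp, intro holomorphic_intros) (use hol[of 0] hol[of "Suc 0"] hol[of 2] in simp_all)
qed

text \<open>The passage from algebra to analysis: locally \<open>f\<close> is a fraction of forms of
  equal degree, so the scaling of representatives cancels and a quotient of polynomials in
  \<open>t\<close> remains.\<close>

lemma regular_line_holomorphic:
  assumes f: "regular_on S f" and p: "p < 3" and S: "\<And>t. line_point p q t \<in> S"
  shows "(\<lambda>t. f (line_point p q t)) holomorphic_on UNIV"
  unfolding holomorphic_on_def
proof
  fix t0 :: complex
  let ?v = "\<lambda>t. vec 3 (\<lambda>l. if l = p then 1 else if l = q then t else 0) :: complex vec"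
  obtain U d P Q where U: "zariski_open U" "line_point p q t0 \<in> U" and PQ: "hom_poly d P" "hom_poly d Q"
    "\<forall>y\<in>S \<inter> U. Q (coords y) \<noteq> 0 \<and> f y = P (coords y) / Q (coords y)"
    using f S[of t0] by (auto elim!: regular_onE)
  obtain F where F: "\<forall>R\<in>F. \<exists>d. hom_poly d R" "U = {x. \<exists>R\<in>F. R (coords x) \<noteq> 0}"
    using U(1) unfolding zariski_open_def by blast
  then obtain R e where R: "R \<in> F" "hom_poly e R" "R (coords (line_point p q t0)) \<noteq> 0" using U(2) by auto
  \<comment> \<open>The single form \<open>R\<close> certifies that \<open>line_point p q t0\<close>
    lies in \<open>U\<close>; its nonvanishing cuts out an open set of parameters in the usual
    topology of the complex numbers.\<close>
  define V where "V = {t. R (?v t) \<noteq> 0}"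
  have hom: "\<exists>s. s \<noteq> 0 \<and> (\<forall>d P. hom_poly d P \<longrightarrow> P (coords (line_point p q t)) = s ^ d * P (?v t))" for t
  proof -
    obtain s where "s \<noteq> 0" "coords (line_point p q t) = s \<cdot>\<^sub>v ?v t" by (rule coords_line_point[OF p])
    then show ?thesis using hom_poly_smult[where u = "?v t" and s = s] by auto
  qed
  have "continuous_on UNIV (\<lambda>t. R (?v t))"
    by (rule holomorphic_on_imp_continuous_on[OF hom_poly_line_holomorphic[OF R(2)]])
  then have V: "open V" unfolding V_def by (rule open_Collect_neq) (rule continuous_on_const)
  obtain s0 where "\<forall>d P. hom_poly d P \<longrightarrow> P (coords (line_point p q t0)) = s0 ^ d * P (?v t0)" using hom by blast
  then have "R (coords (line_point p q t0)) = s0 ^ e * R (?v t0)" using R(2) by blast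
  then have t0: "t0 \<in> V" unfolding V_def using R(3) by auto
  have VU: "line_point p q t \<in> U" if "t \<in> V" for t
  proof -
    obtain s where "s \<noteq> 0" "\<forall>d P. hom_poly d P \<longrightarrow> P (coords (line_point p q t)) = s ^ d * P (?v t)" using hom by blast
    then have "R (coords (line_point p q t)) = s ^ e * R (?v t)" using R(2) by blast
    then have "R (coords (line_point p q t)) \<noteq> 0" using \<open>s \<noteq> 0\<close> that unfolding V_def by simp
    then show ?thesis using R(1) unfolding F(2) by blast
  qed
  have eq: "Q (?v t) \<noteq> 0" "f (line_point p q t) = P (?v t) / Q (?v t)" if "t \<in> V" for t
  proof -
    obtain s where s: "s \<noteq> 0" "\<forall>d P. hom_poly d P \<longrightarrow> P (coords (line_point p q t)) = s ^ d * P (?v t)"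
      using hom by blast
    then have *: "P (coords (line_point p q t)) = s ^ d * P (?v t)" "Q (coords (line_point p q t)) = s ^ d * Q (?v t)"
      using PQ by auto
    show "Q (?v t) \<noteq> 0" "f (line_point p q t) = P (?v t) / Q (?v t)"
      using bspec[OF PQ(3) IntI[OF S VU[OF that]]] s(1) unfolding * by auto
  qed
  have "(\<lambda>t. P (?v t) / Q (?v t)) holomorphic_on V"
    using eq(1) by (intro holomorphic_on_divide holomorphic_on_subset[OF hom_poly_line_holomorphic[OF PQ(1)]]
        holomorphic_on_subset[OF hom_poly_line_holomorphic[OF PQ(2)]]) auto
  then have "(\<lambda>t. f (line_point p q t)) holomorphic_on V"
    by (rule holomorphic_transform) (simp add: eq(2))
  then show "(\<lambda>t. f (line_point p q t)) field_differentiable at t0 within UNIV"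
    using holomorphic_on_imp_differentiable_at[OF _ V t0] by simp
qed

text \<open>\<open>F\<close> and \<open>G\<close> are the two affine expressions of a morphism \<open>O(k) \<rightarrow> O(l)\<close>, \<open>d = k - l\<close>: in the
  coordinate \<open>t\<close>, \<open>F\<close> is entire and tends to 0 at infinity, so Liouville's theorem applies.\<close>

lemma line_section_zero:
  assumes pq: "p < 3" "q < 3" "p \<noteq> q" and d: "d > 0"
    and F: "regular_on S F" "\<And>t. line_point p q t \<in> S"
    and G: "regular_on T G" "\<And>t. line_point q p t \<in> T"
    and FG: "\<And>t. t \<noteq> 0 \<Longrightarrow> F (line_point p q t) = inverse t ^ d * G (line_point p q t)"
  shows "F (line_point p q t) = 0"
proof -
  let ?F = "\<lambda>t. F (line_point p q t)" and ?G = "\<lambda>t. G (line_point q p t)"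
  have hF: "?F holomorphic_on UNIV" by (rule regular_line_holomorphic[OF F(1) pq(1) F(2)])
  have "?G holomorphic_on UNIV" by (rule regular_line_holomorphic[OF G(1) pq(2) G(2)])
  then have "isCont ?G 0"
    using holomorphic_on_imp_continuous_on continuous_on_eq_continuous_at[OF open_UNIV] by blast
  then have "((\<lambda>t. ?G (inverse t)) \<longlongrightarrow> ?G 0) at_infinity"
    by (rule isCont_tendsto_compose) (rule tendsto_inverse_0)
  moreover have "((\<lambda>t::complex. inverse t ^ d) \<longlongrightarrow> 0 ^ d) at_infinity"
    by (intro tendsto_power tendsto_inverse_0)
  ultimately have "((\<lambda>t. inverse t ^ d * ?G (inverse t)) \<longlongrightarrow> 0 ^ d * ?G 0) at_infinity"
    by (intro tendsto_mult)
  then have "((\<lambda>t. inverse t ^ d * ?G (inverse t)) \<longlongrightarrow> 0) at_infinity"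
    using zero_power[OF d, where 'a = complex] by simp
  moreover have "\<forall>\<^sub>F t in at_infinity. inverse t ^ d * ?G (inverse t) = ?F t"
    unfolding eventually_at_infinity
  proof (intro exI[of _ 1] allI impI)
    fix t :: complex assume "1 \<le> norm t"
    then have t: "t \<noteq> 0" by auto
    show "inverse t ^ d * ?G (inverse t) = ?F t" using FG[OF t] unfolding line_point_swap[OF pq t] by (rule sym)
  qed
  ultimately have "(?F \<longlongrightarrow> 0) at_infinity" by (rule Lim_transform_eventually)
  then show ?thesis by (rule Liouville_weak_0[OF hF])
qed

text \<open>Transitions of sums are diagonal, so the entries do not mix: entry \<open>(r, s)\<close>
  is itself a morphism from \<open>O(ks ! s)\<close> to \<open>O(ls ! r)\<close>, and
  \<open>lt\<close> makes its degree negative.\<close>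

lemma O_sum_morphism_line_zero:
  assumes h: "vb_morphism (vb_restrict (O_sum ks) (coord_line i)) (vb_restrict (O_sum ls) (coord_line i)) h"
    and ijk: "i < 3" "m < 3" "m' < 3" "i \<noteq> m" "i \<noteq> m'" "m \<noteq> m'"
    and rs: "r < length ls" "s < length ks" and lt: "ls ! r < ks ! s"
  shows "h (const_chart (length ls) m) (const_chart (length ks) m) (line_point m m' t) $$ (r, s) = 0"
proof -
  let ?E = "vb_restrict (O_sum ks) (coord_line i)" and ?F = "vb_restrict (O_sum ls) (coord_line i)"
  let ?i = "\<lambda>m. const_chart (length ks) m" and ?j = "\<lambda>m. const_chart (length ls) m"
  let ?S = "\<lambda>m. chart ?E (?i m) \<inter> chart ?F (?j m)"
  define d where "d = nat (ks ! s - ls ! r)"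
  have idx: "?i m \<in> vb_idx ?E" "?j m \<in> vb_idx ?F" if "m < 3" for m
    using O_sum_idx_const[OF that] by simp_all
  have reg: "regular_on (?S m) (\<lambda>x. h (?j m) (?i m) x $$ (r, s))" if "m < 3" for m
    using regular_mat_on_entry[OF vb_morphism_regular[OF h idx(1)[OF that] idx(2)[OF that]], of r s] rs by simp
  have co: "coords (line_point m m' t) $ i = 0" "coords (line_point m m' t) $ m \<noteq> 0"
    "coords (line_point m m' t) $ m' = t * coords (line_point m m' t) $ m"
    if "m < 3" "m' < 3" "m \<noteq> m'" "i \<noteq> m" "i \<noteq> m'" for m m' t
    by (rule coords_line_point[OF that(1), of m' t]; use that ijk(1) in simp)+
  have inS: "line_point m m' t \<in> ?S m" if "m < 3" "m' < 3" "m \<noteq> m'" "i \<noteq> m" "i \<noteq> m'" for m m' t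
    using co[OF that, of t] that by (auto simp: O_sum_chart coord_line_def)
  show ?thesis
  proof (rule line_section_zero[OF ijk(2,3,6), of d "?S m" "\<lambda>x. h (?j m) (?i m) x $$ (r, s)" "?S m'" "\<lambda>x. h (?j m') (?i m') x $$ (r, s)"])
    show "d > 0" using lt unfolding d_def by simp
    show "line_point m m' t \<in> ?S m" "line_point m' m t \<in> ?S m'" for t
      using inS ijk by auto
    fix t :: complex assume t: "t \<noteq> 0"
    let ?x = "line_point m m' t"
    let ?u = "coords ?x $ m" and ?u' = "coords ?x $ m'"
    have u: "?u \<noteq> 0" "?u' = t * ?u" using co[OF ijk(2,3,6,4,5)] by auto
    have x: "?x \<in> chart ?E (?i m)" "?x \<in> chart ?F (?j m)" using inS[OF ijk(2,3,6,4,5)] by auto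
    have x': "?x \<in> chart ?E (?i m')" "?x \<in> chart ?F (?j m')"
      using inS[OF ijk(3,2) ijk(6)[symmetric] ijk(5,4), of "inverse t"] line_point_swap[OF ijk(2,3,6) t] by auto
    \<comment> \<open>The expressions at the two ends of the line differ by
      \<open>t powi (ls ! r)\<close> from the target and \<open>inverse t powi (ks ! s)\<close> from
      the source; together these give \<open>inverse t ^ d\<close>.\<close>
    have "h (?j m) (?i m) ?x = trans ?F (?j m) (?j m') ?x * h (?j m') (?i m') ?x * trans ?E (?i m') (?i m) ?x"
      using ijk x x' by (intro vb_morphism_compat[OF h] idx) auto
    moreover have c: "h (?j m') (?i m') ?x \<in> carrier_mat (length ls) (length ks)"
      using vb_morphism_carrier[OF h idx(1)[OF ijk(3)] idx(2)[OF ijk(3)] x'] by simp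
    ultimately have "h (?j m) (?i m) ?x $$ (r, s) =
        (?u' / ?u) powi (ls ! r) * h (?j m') (?i m') ?x $$ (r, s) * (?u / ?u') powi (ks ! s)"
      using rs unfolding vb_restrict_simps O_sum_trans mat_diag_mult_left[OF c]
      by (subst (asm) mat_diag_mult_right[of _ "length ls"]) auto
    also have "\<dots> = t powi (ls ! r) * inverse t powi (ks ! s) * h (?j m') (?i m') ?x $$ (r, s)"
    proof -
      have "?u' / ?u = t" "?u / ?u' = inverse t" using u t by (simp_all add: field_simps)
      then show ?thesis by (simp only: mult_ac)
    qed
    also have "t powi (ls ! r) * inverse t powi (ks ! s) = inverse t powi (ks ! s - ls ! r)"
      using t by (simp add: power_int_diff power_int_inverse field_simps)
    also have "\<dots> = inverse t ^ d" using lt unfolding d_def power_int_def by simp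
    finally show "h (?j m) (?i m) ?x $$ (r, s) = inverse t ^ d * h (?j m') (?i m') ?x $$ (r, s)" .
  qed (use reg ijk in auto)
qed

text \<open>A diagonal entry of \<open>h' * h\<close> at one point is 1, so for some
  \<open>r\<close> both \<open>h\<close> at \<open>(r, s)\<close> and \<open>h'\<close> at
  \<open>(s, r)\<close> are nonzero. The first excludes \<open>ls ! r < ks ! s\<close>, the second
  \<open>ks ! s < ls ! r\<close>, hence the degrees agree.\<close>

lemma O_sum_line_degrees_subset:
  assumes iso: "vb_iso (vb_restrict (O_sum ks) (coord_line i)) (vb_restrict (O_sum ls) (coord_line i))"
    and i: "i < 3"
  shows "set ks \<subseteq> set ls"
proof
  fix k assume "k \<in> set ks"
  then obtain s where s: "s < length ks" "k = ks ! s" by (metis in_set_conv_nth)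
  let ?E = "vb_restrict (O_sum ks) (coord_line i)" and ?F = "vb_restrict (O_sum ls) (coord_line i)"
  define m where "m = (i + 1) mod 3"
  define m' where "m' = (i + 2) mod 3"
  have m: "m < 3" "m' < 3" "i \<noteq> m" "i \<noteq> m'" "m \<noteq> m'" unfolding m_def m'_def using i by presburger+
  \<comment> \<open>At parameter 0 the point \<open>?x\<close> is the \<open>m\<close>-th coordinate
    point, which lies on the line and in the charts that use only \<open>u_m\<close>.\<close>
  let ?i = "const_chart (length ks) m" and ?j = "const_chart (length ls) m" and ?x = "line_point m m' 0"
  obtain h h' where h: "vb_morphism ?E ?F h" "vb_morphism ?F ?E h'" and
    inv: "\<And>i j x. i \<in> vb_idx ?E \<Longrightarrow> j \<in> vb_idx ?F \<Longrightarrow> x \<in> chart ?E i \<Longrightarrow> x \<in> chart ?F j \<Longrightarrow>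
        h' i j x * h j i x = 1\<^sub>m (vb_rank ?E) \<and> h j i x * h' i j x = 1\<^sub>m (vb_rank ?F)"
    using iso unfolding vb_iso_def by blast
  have idx: "?i \<in> vb_idx ?E" "?j \<in> vb_idx ?F" using O_sum_idx_const[OF m(1)] by simp_all
  have "coords ?x $ m \<noteq> 0" "coords ?x $ i = 0"
    by (rule coords_line_point[OF m(1), of m' 0]; use m i in simp)+
  then have x: "?x \<in> chart ?E ?i" "?x \<in> chart ?F ?j" by (auto simp: O_sum_chart coord_line_def)
  have c: "h ?j ?i ?x \<in> carrier_mat (length ls) (length ks)" "h' ?i ?j ?x \<in> carrier_mat (length ks) (length ls)"
    using vb_morphism_carrier[OF h(1) idx x] vb_morphism_carrier[OF h(2) idx(2,1) x(2,1)] by simp_all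
  have "(h' ?i ?j ?x * h ?j ?i ?x) $$ (s, s) = 1"
    using inv[OF idx x] s by simp
  then have "(\<Sum>r<length ls. h' ?i ?j ?x $$ (s, r) * h ?j ?i ?x $$ (r, s)) \<noteq> 0"
    using c s by (simp add: scalar_prod_def atLeast0LessThan)
  then obtain r where r: "r < length ls" "h' ?i ?j ?x $$ (s, r) \<noteq> 0" "h ?j ?i ?x $$ (r, s) \<noteq> 0"
    by (metis (no_types, lifting) lessThan_iff mult_eq_0_iff sum.neutral)
  have "\<not> ls ! r < ks ! s" "\<not> ks ! s < ls ! r"
    using O_sum_morphism_line_zero[OF h(1) i m(1-5) r(1) s(1)]
      O_sum_morphism_line_zero[OF h(2) i m(1-5) s(1) r(1)] r by auto
  then show "k \<in> set ls" using r(1) s by (metis linorder_neqE nth_mem)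
qed

lemma O_sum_line_degrees:
  assumes "vb_iso (vb_restrict (O_sum ks) (coord_line i)) (vb_restrict (O_sum ls) (coord_line i))" "i < 3"
  shows "set ks = set ls"
  using O_sum_line_degrees_subset[OF assms] O_sum_line_degrees_subset[OF vb_iso_sym[OF assms(1)] assms(2)] by simp

subsection \<open>Splitting types of \<open>E(a, b, c) \<otimes> O(n)\<close>\<close>

text \<open>An equality of records: the charts of a tensor product are intersections, so
  \<open>Z\<close> can be moved onto the first factor alone.\<close>

lemma vb_restrict_tensor: "vb_restrict (vb_tensor E L) Z = vb_tensor (vb_restrict E Z) L"
  unfolding vb_restrict_def vb_tensor_def vb_common_chart_def by auto

lemma vb_pullback_tensor: "vb_pullback f (vb_tensor E L) = vb_tensor (vb_pullback f E) (vb_pullback f L)"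
  unfolding vb_pullback_def vb_tensor_def vb_common_chart_def by auto

lemma E_bundle_twist_equivariant:
  assumes E: "is_E_bundle a b c E"
  shows "equivariant (vb_tensor E (O_bundle n))"
  unfolding equivariant_def
proof
  fix t assume t: "t \<in> torus"
  have vE: "vector_bundle E" using E unfolding is_E_bundle_def by simp
  have "vb_iso (vb_pullback (torus_act t) (O_bundle n)) (O_bundle n)"
    using equivariant_O t unfolding equivariant_def by blast
  then show "vb_iso (vb_pullback (torus_act t) (vb_tensor E (O_bundle n))) (vb_tensor E (O_bundle n))"
    unfolding vb_pullback_tensor
    by (intro vb_twist.iso vector_bundle_pullback[OF t] vE vector_bundle_O E_bundle_pullback_iso[OF E t]) simp_all
qed

lemma E_bundle_twist_restrict:
  assumes E: "is_E_bundle a b c E"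
    and ijk: "i < 3" "j < 3" "k < 3" "i \<noteq> j" "i \<noteq> k" "j \<noteq> k" and pos: "[a, b, c] ! i > 0"
  shows "vb_iso (vb_restrict (vb_tensor E (O_bundle n)) (coord_line i))
    (vb_restrict (O_sum [int ([a, b, c] ! j) + int ([a, b, c] ! k) + n, int ([a, b, c] ! i) + n]) (coord_line i))"
proof -
  let ?ls = "[int ([a, b, c] ! j) + int ([a, b, c] ! k), int ([a, b, c] ! i)]" and ?Z = "coord_line i"
  have vE: "vector_bundle E" using E unfolding is_E_bundle_def by simp
  have 1: "vb_iso (vb_restrict (vb_tensor E (O_bundle n)) ?Z) (vb_restrict (vb_tensor (O_sum ?ls) (O_bundle n)) ?Z)"
    unfolding vb_restrict_tensor
    by (intro vb_twist.iso vector_bundle_restrict vE vector_bundle_O vector_bundle_O_sum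
        vb_iso_refl E_bundle_restrict_iso[OF E ijk pos]) simp_all
  have 2: "vb_iso (vb_restrict (vb_tensor (O_sum ?ls) (O_bundle n)) ?Z) (vb_restrict (O_sum (map (\<lambda>k. k + n) ?ls)) ?Z)"
    by (rule vb_iso_restrict[OF vb_iso_O_sum_tensor])
  have "vb_iso (vb_restrict (vb_tensor E (O_bundle n)) ?Z) (vb_restrict (O_sum (map (\<lambda>k. k + n) ?ls)) ?Z)"
    by (rule vb_iso_trans[OF _ _ _ 1 2]) (simp_all add: vector_bundle_restrict vb_twist.vector_bundle vE
        vector_bundle_O vector_bundle_O_sum)
  then show ?thesis by simp
qed

text \<open>On each coordinate line \<open>i\<close> the restrictions of the given sum and of the
  explicit one are both isomorphic to the restriction of the twisted bundle, so their degree sets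
  agree; \<open>k1\<close> and \<open>k2\<close> are the same for all three lines.\<close>

lemma splitting_type_degrees:
  assumes E: "is_E_bundle a b c E" and Ls: "splitting_type (vb_tensor E (O_bundle n)) Ls"
  obtains L1 L2 k1 k2 where "Ls = [L1, L2]" "vb_iso L1 (O_bundle k1)" "vb_iso L2 (O_bundle k2)"
    "\<And>i j k. i < 3 \<Longrightarrow> j < 3 \<Longrightarrow> k < 3 \<Longrightarrow> i \<noteq> j \<Longrightarrow> i \<noteq> k \<Longrightarrow> j \<noteq> k \<Longrightarrow> [a, b, c] ! i > 0 \<Longrightarrow>
      {k1, k2} = {int ([a, b, c] ! j) + int ([a, b, c] ! k) + n, int ([a, b, c] ! i) + n}"
proof -
  let ?T = "vb_tensor E (O_bundle n)"
  have vE: "vector_bundle E" using E unfolding is_E_bundle_def by simp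
  have vT: "vector_bundle ?T" by (intro vb_twist.vector_bundle vE vector_bundle_O) simp
  have "vb_rank E = 2" by (rule E_bundle_framed[OF E])
  then have "length Ls = 2" using Ls unfolding splitting_type_def by (simp add: vb_tensor_simps)
  then obtain L1 L2 where L: "Ls = [L1, L2]" by (auto simp: length_Suc_conv numeral_2_eq_2)
  have vL: "vector_bundle L1" "vector_bundle L2"
    using Ls unfolding splitting_type_def line_bundle_def L by auto
  \<comment> \<open>Either sign condition on \<open>c1\<close> includes an isomorphism with some
    \<open>O_bundle k\<close>; this is where the degrees come from.\<close>
  have "\<exists>k. vb_iso L (O_bundle k)" if "L \<in> set Ls" for L
    using Ls that unfolding splitting_type_def c1_nonneg_def c1_neg_def by blast
  from this[of L1] this[of L2] obtain k1 k2 where k: "vb_iso L1 (O_bundle k1)" "vb_iso L2 (O_bundle k2)"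
    unfolding L by auto
  have sum: "vb_iso (vb_sum_list [L1, L2]) (O_sum [k1, k2])"
    unfolding O_sum_def vb_sum_list_def
    by (simp, intro vb_sum.iso vb_sum.vector_bundle TrueI vL vector_bundle_O vector_bundle_zero vb_iso_refl k)
  have "{k1, k2} = {int ([a, b, c] ! j) + int ([a, b, c] ! k) + n, int ([a, b, c] ! i) + n}"
    if ijk: "i < 3" "j < 3" "k < 3" "i \<noteq> j" "i \<noteq> k" "j \<noteq> k" "[a, b, c] ! i > 0" for i j k
  proof -
    let ?Z = "coord_line i" and ?ls = "[int ([a, b, c] ! j) + int ([a, b, c] ! k) + n, int ([a, b, c] ! i) + n]"
    have v: "vector_bundle (vb_restrict (O_sum ks) ?Z)" "vector_bundle (vb_restrict ?T ?Z)"
      "vector_bundle (vb_restrict (vb_sum_list [L1, L2]) ?Z)" for ks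
      using vL by (auto intro!: vector_bundle_restrict vector_bundle_O_sum vT vector_bundle_sum_list)
    have T: "vb_iso (vb_restrict ?T ?Z) (vb_restrict (vb_sum_list [L1, L2]) ?Z)"
      using Ls ijk(1) unfolding splitting_type_def L by blast
    have "vb_iso (vb_restrict (O_sum [k1, k2]) ?Z) (vb_restrict ?T ?Z)"
      by (rule vb_iso_sym[OF vb_iso_trans[OF v(2,3,1) T vb_iso_restrict[OF sum]]])
    then have "vb_iso (vb_restrict (O_sum [k1, k2]) ?Z) (vb_restrict (O_sum ?ls) ?Z)"
      by (rule vb_iso_trans[OF v(1,2,1) _ E_bundle_twist_restrict[OF E ijk]])
    then show ?thesis using O_sum_line_degrees[OF _ ijk(1)] by fastforce
  qed
  then show thesis by (rule that[OF L k])
qed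

lemma line_bundle_O: "line_bundle (O_bundle k)"
  unfolding line_bundle_def by (simp add: vector_bundle_O)

text \<open>With equal exponents the restriction has degrees \<open>2 * int a + n\<close> and
  \<open>int a + n\<close> on every coordinate line, so one pair of global line bundles serves all
  three.\<close>

lemma splitting_type_E_aaa:
  assumes E: "is_E_bundle a a a E" and a: "a > 0"
  shows "splitting_type (vb_tensor E (O_bundle n)) [O_bundle (2 * int a + n), O_bundle (int a + n)]"
proof -
  obtain \<Phi> G where vE: "vector_bundle E" "vb_base E = UNIV" "vb_rank E = 2" using E_bundle_framed[OF E] by metis
  have "vb_iso (vb_restrict (vb_tensor E (O_bundle n)) (coord_line i))
      (vb_restrict (vb_sum_list [O_bundle (2 * int a + n), O_bundle (int a + n)]) (coord_line i))" if i: "i < 3" for i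
  proof -
    have w: "[a, a, a] ! l = a" if "l < 3" for l using that by (auto simp: less_Suc_eq numeral_3_eq_3)
    have jk: "(i + 1) mod 3 < 3" "(i + 2) mod 3 < 3" "i \<noteq> (i + 1) mod 3" "i \<noteq> (i + 2) mod 3" "(i + 1) mod 3 \<noteq> (i + 2) mod 3"
      using i by presburger+
    show ?thesis
      using E_bundle_twist_restrict[OF E i jk, of n] a unfolding w[OF i] w[OF jk(1)] w[OF jk(2)]
      by (simp add: O_sum_def)
  qed
  moreover have "c1_nonneg (O_bundle k) \<or> c1_neg (O_bundle k)" for k
    unfolding c1_nonneg_def c1_neg_def using vb_iso_refl[OF vector_bundle_O[of k]] by (meson not_le_imp_less)
  moreover have "vector_bundle (vb_tensor E (O_bundle n))"
    by (intro vb_twist.vector_bundle vE vector_bundle_O) simp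
  ultimately show ?thesis
    unfolding splitting_type_def using vE E_bundle_twist_equivariant[OF E]
    by (auto simp: vb_tensor_simps line_bundle_O equivariant_O)
qed

theorem mainTheorem1:
  fixes a b c :: nat and n :: int
  assumes "a > 0" and "b > 0" and "c > 0"
  shows "(\<exists>E. is_E_bundle a b c E) \<and>
    (\<forall>E. is_E_bundle a b c E \<longrightarrow>
      vector_bundle (vb_tensor E (O_bundle n)) \<and>
      vb_base (vb_tensor E (O_bundle n)) = UNIV \<and>
      vb_rank (vb_tensor E (O_bundle n)) = 2 \<and>
      equivariant (vb_tensor E (O_bundle n)) \<and>
      ((\<exists>Ls. splitting_type (vb_tensor E (O_bundle n)) Ls) \<longrightarrow> a = b \<and> b = c) \<and>
      (a = b \<and> b = c \<longrightarrow>
        splitting_type (vb_tensor E (O_bundle n))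
          [O_bundle (2 * int a + n), O_bundle (int a + n)] \<and>
        (\<forall>Ls. splitting_type (vb_tensor E (O_bundle n)) Ls \<longrightarrow>
          same_up_to_order_iso Ls [O_bundle (2 * int a + n), O_bundle (int a + n)])))"
proof (intro conjI allI impI)
  show "\<exists>E. is_E_bundle a b c E" using E_model_is_E_bundle by blast
next
  fix E assume E: "is_E_bundle a b c E"
  obtain \<Phi> G where vE: "vector_bundle E" "vb_base E = UNIV" "vb_rank E = 2" using E_bundle_framed[OF E] by metis
  show "vector_bundle (vb_tensor E (O_bundle n))"
    by (intro vb_twist.vector_bundle vE vector_bundle_O) simp
  show "vb_base (vb_tensor E (O_bundle n)) = UNIV" "vb_rank (vb_tensor E (O_bundle n)) = 2"
    using vE by (simp_all add: vb_tensor_simps)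
  show "equivariant (vb_tensor E (O_bundle n))" by (rule E_bundle_twist_equivariant[OF E])
next
  fix E assume E: "is_E_bundle a b c E" and "\<exists>Ls. splitting_type (vb_tensor E (O_bundle n)) Ls"
  then obtain Ls where Ls: "splitting_type (vb_tensor E (O_bundle n)) Ls" by blast
  obtain k1 k2 where k: "\<And>i j k. i < 3 \<Longrightarrow> j < 3 \<Longrightarrow> k < 3 \<Longrightarrow> i \<noteq> j \<Longrightarrow> i \<noteq> k \<Longrightarrow> j \<noteq> k \<Longrightarrow> [a, b, c] ! i > 0 \<Longrightarrow>
      {k1, k2} = {int ([a, b, c] ! j) + int ([a, b, c] ! k) + n, int ([a, b, c] ! i) + n}"
    using splitting_type_degrees[OF E Ls] by metis
  have nth: "[a, b, c] ! 0 = a" "[a, b, c] ! 1 = b" "[a, b, c] ! 2 = c" by simp_all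
  have 0: "{k1, k2} = {int b + int c + n, int a + n}" by (rule k[of 0 1 2, unfolded nth]) (use assms in simp_all)
  have 1: "{k1, k2} = {int a + int c + n, int b + n}" by (rule k[of 1 0 2, unfolded nth]) (use assms in simp_all)
  have 2: "{k1, k2} = {int a + int b + n, int c + n}" by (rule k[of 2 0 1, unfolded nth]) (use assms in simp_all)
  have "int b + int c + n = int a + int c + n \<or> int b + int c + n = int b + n"
    using 0 1 by (metis doubleton_eq_iff)
  then show "a = b" using assms by linarith
  have "int a + int c + n = int a + int b + n \<or> int a + int c + n = int c + n"
    using 1 2 by (metis doubleton_eq_iff)
  then show "b = c" using assms by linarith
next
  fix E assume E: "is_E_bundle a b c E" and "a = b \<and> b = c"
  then have abc: "b = a" "c = a" by auto
  show "splitting_type (vb_tensor E (O_bundle n)) [O_bundle (2 * int a + n), O_bundle (int a + n)]"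
    using splitting_type_E_aaa[of a E n] E assms unfolding abc by simp
  fix Ls assume Ls: "splitting_type (vb_tensor E (O_bundle n)) Ls"
  obtain L1 L2 k1 k2 where L: "Ls = [L1, L2]" "vb_iso L1 (O_bundle k1)" "vb_iso L2 (O_bundle k2)"
    and k: "\<And>i j k. i < 3 \<Longrightarrow> j < 3 \<Longrightarrow> k < 3 \<Longrightarrow> i \<noteq> j \<Longrightarrow> i \<noteq> k \<Longrightarrow> j \<noteq> k \<Longrightarrow> [a, b, c] ! i > 0 \<Longrightarrow>
      {k1, k2} = {int ([a, b, c] ! j) + int ([a, b, c] ! k) + n, int ([a, b, c] ! i) + n}"
    using splitting_type_degrees[OF E Ls] by metis
  have nth: "[a, b, c] ! 0 = a" "[a, b, c] ! 1 = b" "[a, b, c] ! 2 = c" by simp_all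
  have "{k1, k2} = {int b + int c + n, int a + n}" by (rule k[of 0 1 2, unfolded nth]) (use assms in simp_all)
  then have "{k1, k2} = {2 * int a + n, int a + n}" unfolding abc by simp
  then have "k1 = 2 * int a + n \<and> k2 = int a + n \<or> k1 = int a + n \<and> k2 = 2 * int a + n"
    by (simp add: doubleton_eq_iff)
  \<comment> \<open>The degrees may come in either order, so the rearranged list is
    \<open>[O_bundle k1, O_bundle k2]\<close>, which matches \<open>Ls\<close> entry by
    entry.\<close>
  then have "mset [O_bundle k1, O_bundle k2] = mset [O_bundle (2 * int a + n), O_bundle (int a + n)]"
    by (auto simp: add_mset_commute)
  moreover have "list_all2 vb_iso Ls [O_bundle k1, O_bundle k2]" using L by simp
  ultimately show "same_up_to_order_iso Ls [O_bundle (2 * int a + n), O_bundle (int a + n)]"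
    unfolding same_up_to_order_iso_def by blast
qed

end
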